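(* Let $G$ be a connected Lie group and $\mathfrak{g}=T_eG$ its Lie algebra, with bracket $[\,,\,]$. Let $\nabla^0$ be the left invariant linear connection on $G$ given by $\nabla^0_{u^+}v^+=\frac12[u^+,v^+]$ for all $u,v\in\mathfrak{g}$. Then: 1. Let $\nabla$ be a left invariant linear connection on $G$ and let $\circ$ be the product on $\mathfrak{g}$ given by $u\circ v=(\nabla_{u^+}v^+)(e)-\frac12[u,v]$. Then $(\mathfrak{g},[\,,\,],\circ)$ is a Poisson algebra if and only if $\nabla$ is torsion free, bi-invariant and has the same curvature as $\nabla^0$. 2. Let $\circ$ be a product on $\mathfrak{g}$ such that $(\mathfrak{g},[\,,\,],\circ)$ is a Poisson algebra. Then the linear connection on $G$ given by $\nabla_{u^+}v^+=\frac12[u^+,v^+]+(u\circ v)^+$ for all $u,v\in\mathfrak{g}$ is torsion free, bi-invariant and has the same curvature as $\nabla^0$.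
   Context: For $u\in\mathfrak{g}$, $u^+$ denotes the left invariant vector field on $G$ with $u^+(e)=u$. A linear connection on $G$ is left invariant if it is invariant under all left multiplications, and bi-invariant if it is invariant under all left and all right multiplications. The torsion and curvature are $T^\nabla(X,Y)=\nabla_XY-\nabla_YX-[X,Y]$ and $K^\nabla(X,Y)=[\nabla_X,\nabla_Y]-\nabla_{[X,Y]}$. A Poisson algebra is a finite dimensional Lie algebra $(\mathfrak{g},[\,,\,])$ endowed with a commutative and associative bilinear product $\circ$ such that $[u,v\circ w]=[u,v]\circ w+v\circ[u,w]$ for all $u,v,w\in\mathfrak{g}$. *)

theory Defs
  imports "HOL-Analysis.Analysis" "HOL-Algebra.Group" "HOL-Library.Function_Algebras"
begin

text \<open>
  Functions are added and multiplied pointwise as in \<^theory>\<open>HOL-Library.Function_Algebras\<close>;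
  the pointwise scalar multiplication makes tangent vectors (functionals on functions) and
  vector fields elements of a real vector space.
\<close>

instantiation "fun" :: (type, real_vector) real_vector
begin

definition scaleR_fun_def: "c *\<^sub>R f = (\<lambda>x. c *\<^sub>R f x)"

instance
  by standard (simp_all add: scaleR_fun_def plus_fun_def fun_eq_iff scaleR_add_right scaleR_add_left)

end


section \<open>Smooth manifolds\<close>

text \<open>
  These are meant for open \<open>S\<close> and finite-dimensional domains, where being \<open>C\<^sup>k\<^sup>+\<^sup>1\<close> amounts to being
  differentiable with all directional derivatives of class \<open>C\<^sup>k\<close>.
\<close>

primrec Ck_on :: "nat \<Rightarrow> 'a::real_normed_vector set \<Rightarrow> ('a \<Rightarrow> 'b::real_normed_vector) \<Rightarrow> bool" where
  "Ck_on 0 S f \<longleftrightarrow> continuous_on S f"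
| "Ck_on (Suc k) S f \<longleftrightarrow>
     (\<forall>x\<in>S. f differentiable (at x)) \<and> (\<forall>v. Ck_on k S (\<lambda>x. frechet_derivative f (at x) v))"

definition smooth_on :: "'a::real_normed_vector set \<Rightarrow> ('a \<Rightarrow> 'b::real_normed_vector) \<Rightarrow> bool" where
  "smooth_on S f \<longleftrightarrow> (\<forall>k. Ck_on k S f)"

text \<open>
  An atlas is a set of pairs of a chart domain and a chart map (whose values outside the domain
  are irrelevant); it need not be maximal. The model space is a
  finite-dimensional real inner product space; the class \<open>euclidean_space\<close> would exclude
  dimension zero.
\<close>

type_synonym ('m, 'e) atlas = "('m set \<times> ('m \<Rightarrow> 'e)) set"

definition smooth_atlas :: "('m::topological_space, 'e::real_inner) atlas \<Rightarrow> bool" where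
  "smooth_atlas A \<longleftrightarrow>
     (\<exists>B::'e set. finite B \<and> span B = UNIV) \<and>
     (\<Union>(U, \<phi>)\<in>A. U) = UNIV \<and>
     (\<forall>(U, \<phi>)\<in>A. open U \<and> open (\<phi> ` U) \<and> (\<exists>\<psi>. homeomorphism U (\<phi> ` U) \<phi> \<psi>)) \<and>
     (\<forall>(U, \<phi>)\<in>A. \<forall>(V, \<psi>)\<in>A. smooth_on (\<phi> ` (U \<inter> V)) (\<psi> \<circ> inv_into U \<phi>))"

definition smooth_map ::
  "('m::topological_space, 'e::real_normed_vector) atlas \<Rightarrow>
   ('n::topological_space, 'f::real_normed_vector) atlas \<Rightarrow> ('m \<Rightarrow> 'n) \<Rightarrow> bool" where
  "smooth_map A B F \<longleftrightarrow>
     continuous_on UNIV F \<and>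
     (\<forall>(U, \<phi>)\<in>A. \<forall>(V, \<psi>)\<in>B. smooth_on (\<phi> ` (U \<inter> F -` V)) (\<psi> \<circ> F \<circ> inv_into U \<phi>))"

definition prod_atlas :: "('m, 'e) atlas \<Rightarrow> ('n, 'f) atlas \<Rightarrow> ('m \<times> 'n, 'e \<times> 'f) atlas" where
  "prod_atlas A B = {(U \<times> V, map_prod \<phi> \<psi>) | U \<phi> V \<psi>. (U, \<phi>) \<in> A \<and> (V, \<psi>) \<in> B}"

definition real_atlas :: "(real, real) atlas" where
  "real_atlas = {(UNIV, id)}"

definition smooth_functions :: "('m::topological_space, 'e::real_normed_vector) atlas \<Rightarrow> ('m \<Rightarrow> real) set" where
  "smooth_functions A = {f. smooth_map A real_atlas f}"


section \<open>Tangent vectors and vector fields\<close>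

text \<open>
  Tangent vectors at \<open>p\<close> are the derivations at \<open>p\<close> of the algebra of smooth functions, extended by
  \<open>0\<close> to all functions so that equality of tangent vectors is equality in HOL.
\<close>

type_synonym 'm tangent = "('m \<Rightarrow> real) \<Rightarrow> real"

definition tangent_space :: "('m::topological_space, 'e::real_normed_vector) atlas \<Rightarrow> 'm \<Rightarrow> 'm tangent set" where
  "tangent_space A p = {v.
     (\<forall>f. f \<notin> smooth_functions A \<longrightarrow> v f = 0) \<and>
     (\<forall>f\<in>smooth_functions A. \<forall>g\<in>smooth_functions A. v (f + g) = v f + v g) \<and>
     (\<forall>c. \<forall>f\<in>smooth_functions A. v (c *\<^sub>R f) = c * v f) \<and>
     (\<forall>f\<in>smooth_functions A. \<forall>g\<in>smooth_functions A. v (f * g) = f p * v g + g p * v f)}"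

type_synonym 'm vfield = "'m \<Rightarrow> 'm tangent"

definition app_vf :: "'m vfield \<Rightarrow> ('m \<Rightarrow> real) \<Rightarrow> ('m \<Rightarrow> real)" where
  "app_vf X f = (\<lambda>p. X p f)"

definition vector_fields :: "('m::topological_space, 'e::real_normed_vector) atlas \<Rightarrow> 'm vfield set" where
  "vector_fields A = {X. (\<forall>p. X p \<in> tangent_space A p) \<and>
     (\<forall>f\<in>smooth_functions A. app_vf X f \<in> smooth_functions A)}"

definition scale_vf :: "('m \<Rightarrow> real) \<Rightarrow> 'm vfield \<Rightarrow> 'm vfield" where
  "scale_vf f X = (\<lambda>p. f p *\<^sub>R X p)"

text \<open>
  For a non-smooth \<open>f\<close> both terms are \<open>0\<close>, so the bracket is again extended by \<open>0\<close>.
\<close>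

definition bracket_vf :: "'m vfield \<Rightarrow> 'm vfield \<Rightarrow> 'm vfield" where
  "bracket_vf X Y = (\<lambda>p f. X p (app_vf Y f) - Y p (app_vf X f))"

text \<open>
  Push-forward of a vector field along a diffeomorphism \<open>F\<close>:
  \<open>(F\<^sub>* X)(p) = dF (X (F\<^sup>-\<^sup>1 p))\<close>, where \<open>(dF v) f = v (f \<circ> F)\<close>.
\<close>

definition push_vf :: "('m \<Rightarrow> 'm) \<Rightarrow> 'm vfield \<Rightarrow> 'm vfield" where
  "push_vf F X = (\<lambda>p f. X (the_inv F p) (f \<circ> F))"


section \<open>Linear connections\<close>

type_synonym 'm connection = "'m vfield \<Rightarrow> 'm vfield \<Rightarrow> 'm vfield"

text \<open>
  The last clause is the convention that makes equality of connections equality in HOL;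
  \<open>\<real>\<close>-linearity in \<open>Y\<close> is the Leibniz rule for constant \<open>f\<close>.
\<close>

definition linear_connection ::
  "('m::topological_space, 'e::real_normed_vector) atlas \<Rightarrow> 'm connection \<Rightarrow> bool" where
  "linear_connection A D \<longleftrightarrow>
     (\<forall>X\<in>vector_fields A. \<forall>Y\<in>vector_fields A. D X Y \<in> vector_fields A) \<and>
     (\<forall>X\<in>vector_fields A. \<forall>X'\<in>vector_fields A. \<forall>Y\<in>vector_fields A.
        D (X + X') Y = D X Y + D X' Y) \<and>
     (\<forall>X\<in>vector_fields A. \<forall>Y\<in>vector_fields A. \<forall>Y'\<in>vector_fields A.
        D X (Y + Y') = D X Y + D X Y') \<and>
     (\<forall>f\<in>smooth_functions A. \<forall>X\<in>vector_fields A. \<forall>Y\<in>vector_fields A.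
        D (scale_vf f X) Y = scale_vf f (D X Y)) \<and>
     (\<forall>f\<in>smooth_functions A. \<forall>X\<in>vector_fields A. \<forall>Y\<in>vector_fields A.
        D X (scale_vf f Y) = scale_vf f (D X Y) + scale_vf (app_vf X f) Y) \<and>
     (\<forall>X Y. X \<notin> vector_fields A \<or> Y \<notin> vector_fields A \<longrightarrow> D X Y = 0)"

definition torsion :: "'m connection \<Rightarrow> 'm vfield \<Rightarrow> 'm vfield \<Rightarrow> 'm vfield" where
  "torsion D X Y = D X Y - D Y X - bracket_vf X Y"

definition torsion_free ::
  "('m::topological_space, 'e::real_normed_vector) atlas \<Rightarrow> 'm connection \<Rightarrow> bool" where
  "torsion_free A D \<longleftrightarrow> (\<forall>X\<in>vector_fields A. \<forall>Y\<in>vector_fields A. torsion D X Y = 0)"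

definition curvature :: "'m connection \<Rightarrow> 'm vfield \<Rightarrow> 'm vfield \<Rightarrow> 'm vfield \<Rightarrow> 'm vfield" where
  "curvature D X Y Z = D X (D Y Z) - D Y (D X Z) - D (bracket_vf X Y) Z"

definition same_curvature ::
  "('m::topological_space, 'e::real_normed_vector) atlas \<Rightarrow> 'm connection \<Rightarrow> 'm connection \<Rightarrow> bool" where
  "same_curvature A D D' \<longleftrightarrow>
     (\<forall>X\<in>vector_fields A. \<forall>Y\<in>vector_fields A. \<forall>Z\<in>vector_fields A.
        curvature D X Y Z = curvature D' X Y Z)"

definition invariant_connection ::
  "('m::topological_space, 'e::real_normed_vector) atlas \<Rightarrow> ('m \<Rightarrow> 'm) \<Rightarrow> 'm connection \<Rightarrow> bool" where
  "invariant_connection A F D \<longleftrightarrow>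
     (\<forall>X\<in>vector_fields A. \<forall>Y\<in>vector_fields A.
        D (push_vf F X) (push_vf F Y) = push_vf F (D X Y))"


section \<open>Lie groups\<close>

record ('g, 'e) lie_group_data = "'g monoid" +
  atlas :: "('g, 'e) atlas"

text \<open>
  The underlying manifold is the whole type, which carries the (Hausdorff, second countable)
  topology.
\<close>

definition lie_group ::
  "('g::{t2_space, second_countable_topology}, 'e::real_inner) lie_group_data \<Rightarrow> bool" where
  "lie_group G \<longleftrightarrow>
     group G \<and> carrier G = UNIV \<and> smooth_atlas (atlas G) \<and>
     smooth_map (prod_atlas (atlas G) (atlas G)) (atlas G) (\<lambda>(x, y). x \<otimes>\<^bsub>G\<^esub> y) \<and>
     smooth_map (atlas G) (atlas G) (\<lambda>x. inv\<^bsub>G\<^esub> x)"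

context
  fixes G :: "('g::topological_space, 'e::real_normed_vector) lie_group_data"
begin

definition left_invariant_vf :: "'g vfield \<Rightarrow> bool" where
  "left_invariant_vf X \<longleftrightarrow>
     X \<in> vector_fields (atlas G) \<and> (\<forall>a. push_vf (\<lambda>x. a \<otimes>\<^bsub>G\<^esub> x) X = X)"

definition lie_alg :: "'g tangent set" where
  "lie_alg = tangent_space (atlas G) \<one>\<^bsub>G\<^esub>"

definition left_inv_field :: "'g tangent \<Rightarrow> 'g vfield" where
  "left_inv_field u = (THE X. left_invariant_vf X \<and> X \<one>\<^bsub>G\<^esub> = u)"

definition lie_bracket :: "'g tangent \<Rightarrow> 'g tangent \<Rightarrow> 'g tangent" where
  "lie_bracket u v = bracket_vf (left_inv_field u) (left_inv_field v) \<one>\<^bsub>G\<^esub>"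

definition left_invariant_connection :: "'g connection \<Rightarrow> bool" where
  "left_invariant_connection D \<longleftrightarrow>
     (\<forall>a. invariant_connection (atlas G) (\<lambda>x. a \<otimes>\<^bsub>G\<^esub> x) D)"

definition bi_invariant_connection :: "'g connection \<Rightarrow> bool" where
  "bi_invariant_connection D \<longleftrightarrow>
     left_invariant_connection D \<and>
     (\<forall>a. invariant_connection (atlas G) (\<lambda>x. x \<otimes>\<^bsub>G\<^esub> a) D)"

text \<open>
  \<open>D\<close> is a linear connection with \<open>D\<^bsub>u\<^sup>+\<^esub> v\<^sup>+ = b u v\<close>, where \<open>u\<^sup>+\<close> is \<open>left_inv_field G u\<close>.
\<close>

definition connection_given_by :: "('g tangent \<Rightarrow> 'g tangent \<Rightarrow> 'g vfield) \<Rightarrow> 'g connection \<Rightarrow> bool" where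
  "connection_given_by b D \<longleftrightarrow>
     linear_connection (atlas G) D \<and>
     (\<forall>u\<in>lie_alg. \<forall>v\<in>lie_alg. D (left_inv_field u) (left_inv_field v) = b u v)"

definition half_bracket :: "'g tangent \<Rightarrow> 'g tangent \<Rightarrow> 'g vfield" where
  "half_bracket u v = (1/2) *\<^sub>R bracket_vf (left_inv_field u) (left_inv_field v)"

end


section \<open>Poisson algebras\<close>

definition bilinear_product_on :: "'a::real_vector set \<Rightarrow> ('a \<Rightarrow> 'a \<Rightarrow> 'a) \<Rightarrow> bool" where
  "bilinear_product_on V b \<longleftrightarrow>
     (\<forall>u\<in>V. \<forall>v\<in>V. b u v \<in> V) \<and>
     (\<forall>u\<in>V. \<forall>v\<in>V. \<forall>w\<in>V. b (u + v) w = b u w + b v w \<and> b u (v + w) = b u v + b u w) \<and>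
     (\<forall>c. \<forall>u\<in>V. \<forall>v\<in>V. b (c *\<^sub>R u) v = c *\<^sub>R b u v \<and> b u (c *\<^sub>R v) = c *\<^sub>R b u v)"

definition lie_algebra_on :: "'a::real_vector set \<Rightarrow> ('a \<Rightarrow> 'a \<Rightarrow> 'a) \<Rightarrow> bool" where
  "lie_algebra_on V br \<longleftrightarrow>
     subspace V \<and> bilinear_product_on V br \<and>
     (\<forall>u\<in>V. br u u = 0) \<and>
     (\<forall>u\<in>V. \<forall>v\<in>V. \<forall>w\<in>V. br u (br v w) + br v (br w u) + br w (br u v) = 0)"

definition poisson_algebra ::
  "'a::real_vector set \<Rightarrow> ('a \<Rightarrow> 'a \<Rightarrow> 'a) \<Rightarrow> ('a \<Rightarrow> 'a \<Rightarrow> 'a) \<Rightarrow> bool" where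
  "poisson_algebra V br pr \<longleftrightarrow>
     (\<exists>B. finite B \<and> span B = V) \<and>
     lie_algebra_on V br \<and> bilinear_product_on V pr \<and>
     (\<forall>u\<in>V. \<forall>v\<in>V. pr u v = pr v u) \<and>
     (\<forall>u\<in>V. \<forall>v\<in>V. \<forall>w\<in>V. pr (pr u v) w = pr u (pr v w)) \<and>
     (\<forall>u\<in>V. \<forall>v\<in>V. \<forall>w\<in>V. br u (pr v w) = pr (br u v) w + pr v (br u w))"

end

theory Submission
  imports Defs
begin

text \<open>
  Left translations trivialise the tangent bundle: every vector field is a combination of the fields
  \<open>u\<^sup>+\<close> with smooth coefficients. Hence a left invariant connection amounts to the bilinear product
  \<open>\<beta>(u, v) = (\<nabla>\<^bsub>u\<^sup>+\<^esub> v\<^sup>+)(e)\<close> on the Lie algebra, and torsion and curvature, being tensors, can be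
  compared on left invariant fields. Write \<open>\<beta>(u, v) = [u, v]/2 + u \<circ> v\<close>. The connection is torsion free
  iff \<open>\<circ>\<close> is commutative. Right translations act on left invariant fields through \<open>Ad\<close>, so
  bi-invariance means that \<open>\<beta>\<close> is \<open>Ad\<close>-invariant. Differentiating
  \<open>a \<mapsto> Ad(a\<^sup>-\<^sup>1) \<beta>(Ad(a) u, Ad(a) v)\<close>, which is constant iff all its derivatives vanish because the group is
  connected, turns this into: each \<open>[w, -]\<close> is a derivation of \<open>\<beta>\<close>, equivalently (Jacobi) of \<open>\<circ>\<close>.
  Under this Leibniz rule the curvature differs from that of \<open>\<nabla>\<^sup>0\<close> by
  \<open>u \<circ> (v \<circ> w) - v \<circ> (u \<circ> w)\<close>, which for commutative \<open>\<circ>\<close> vanishes iff \<open>\<circ>\<close> is associative.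
  Hadamard's lemma and bump functions identify derivations of the smooth functions with directional
  derivatives in a chart, which makes the tangent spaces finite dimensional.
\<close>

text \<open>The Leibniz rule only gives the derivative at the identity, whereas constancy needs the
  derivative at every point \<open>p\<close>. The gap is closed by replacing \<beta> by its
  conjugate under \<open>Ad p\<close>: \<open>Ad p\<close> is an automorphism of the bracket, so the
  conjugate satisfies the same rule, and the derivative at \<open>p\<close> for \<beta> is the
  derivative at the identity for the conjugate. That the derivative of \<open>Ad\<close> at the
  identity is the bracket rests on the symmetry of second derivatives, since a derivative along
  \<open>u\<close> and one along \<open>w\<close> have to be exchanged. Tangent vectors act on
  globally defined functions only, so local constructions (coordinates, the coefficients in
  Hadamard's lemma) must first be extended by bump functions. The model space is an inner product
  space with a finite spanning set, possibly of dimension zero, so calculus is developed relative to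
  a finite reproducing family. The frame of left invariant fields inherits this: it may be
  redundant, and the proof works with one fixed choice of coefficients, never with uniqueness of an
  expansion.\<close>

abbreviation fderiv ("\<D>") where "\<D> f x \<equiv> frechet_derivative f (at x)"
notation smooth_functions ("\<C>") and tangent_space ("\<T>")

section \<open>Calculus on finite-dimensional inner product spaces\<close>

text \<open>
  A family with this reproducing property need not be linearly independent; it may contain \<open>0\<close>.
\<close>

definition coord_basis :: "'a::real_inner set \<Rightarrow> bool" where
  "coord_basis B \<longleftrightarrow> finite B \<and> (\<forall>x. (\<Sum>b\<in>B. (x \<bullet> b) *\<^sub>R b) = x)"

lemma coord_basis_finite: "coord_basis B \<Longrightarrow> finite B"
  and coord_basis_sum: "coord_basis B \<Longrightarrow> (\<Sum>b\<in>B. (x \<bullet> b) *\<^sub>R b) = x"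
  by (simp_all add: coord_basis_def)

text \<open>Both sides of the reproducing identity are linear in \<open>x\<close>, so after
  normalising an orthogonal spanning set \<open>C\<close> it suffices to check the identity on the
  members of \<open>C\<close>.\<close>

lemma coord_basis_exists:
  assumes "finite (B::'a::real_inner set)" "span B = UNIV"
  shows "\<exists>C::'a set. coord_basis C"
proof -
  obtain C :: "'a set" where C: "finite C" "span C = UNIV" "pairwise orthogonal C"
    using basis_orthogonal[OF assms(1)] assms(2) by auto
  have "(\<Sum>b\<in>sgn ` C. (x \<bullet> b) *\<^sub>R b) = x" for x
  proof -
    have "x \<in> span C" using C(2) by simp
    then show ?thesis
    proof (induction rule: span_induct_alt)
      case base
      then show ?case by simp
    next
      case (step r c y)
      \<comment> \<open>The sum runs over the image of \<open>C\<close> under \<open>sgn\<close>,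
        where different members may coincide. Distinct orthogonal \<open>c\<close> and
        \<open>d\<close> with the same \<open>sgn\<close> force \<open>c = 0\<close>, so the case
        distinction can be made on \<open>sgn d = sgn c\<close> instead of
        \<open>d = c\<close>.\<close>
      have "(c \<bullet> sgn d) *\<^sub>R sgn d = (if sgn d = sgn c then c else 0)" if "d \<in> C" for d
      proof (cases "d = c")
        case True
        then show ?thesis
          by (cases "c = 0") (simp_all add: sgn_div_norm dot_square_norm power2_eq_square mult.assoc)
      next
        case False
        then have "c \<bullet> d = 0" using C(3) that step(1) by (simp add: pairwise_def orthogonal_def)
        moreover have "c = 0" if "sgn d = sgn c"
        proof -
          have "c \<bullet> sgn d = 0" using \<open>c \<bullet> d = 0\<close> by (simp add: sgn_div_norm)
          then have "inverse (norm c) * (c \<bullet> c) = 0" unfolding that by (simp add: sgn_div_norm)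
          then show ?thesis by simp
        qed
        ultimately show ?thesis by (auto simp: sgn_div_norm)
      qed
      then have "(c \<bullet> b) *\<^sub>R b = (if b = sgn c then c else 0)" if "b \<in> sgn ` C" for b
        using that by (elim imageE) (simp only:)
      then have "(\<Sum>b\<in>sgn ` C. (c \<bullet> b) *\<^sub>R b) = (\<Sum>b\<in>sgn ` C. if b = sgn c then c else 0)"
        by (rule sum.cong[OF refl])
      then have "(\<Sum>b\<in>sgn ` C. (c \<bullet> b) *\<^sub>R b) = c" using step(1) C(1) by simp
      moreover have "(\<Sum>b\<in>sgn ` C. ((r *\<^sub>R c + y) \<bullet> b) *\<^sub>R b) =
          r *\<^sub>R (\<Sum>b\<in>sgn ` C. (c \<bullet> b) *\<^sub>R b) + (\<Sum>b\<in>sgn ` C. (y \<bullet> b) *\<^sub>R b)"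
        by (simp add: inner_add_left scaleR_add_left sum.distrib scaleR_sum_right)
      ultimately show ?case using step(2) by simp
    qed
  qed
  then show ?thesis using C(1) unfolding coord_basis_def by blast
qed

lemma coord_basis_linear:
  assumes "coord_basis B" "linear L"
  shows "L v = (\<Sum>b\<in>B. (v \<bullet> b) *\<^sub>R L b)"
proof -
  have "L v = L (\<Sum>b\<in>B. (v \<bullet> b) *\<^sub>R b)" by (simp add: coord_basis_sum[OF assms(1)])
  also have "\<dots> = (\<Sum>b\<in>B. (v \<bullet> b) *\<^sub>R L b)"
    by (simp add: linear_sum[OF assms(2)] linear_scale[OF assms(2)])
  finally show ?thesis .
qed

lemma coord_basis_real: "coord_basis {1::real}"
  by (simp add: coord_basis_def)

lemma coord_basis_prod:
  assumes "coord_basis (B::'a::real_inner set)" "coord_basis (C::'b::real_inner set)"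
  shows "\<exists>D :: ('a \<times> 'b) set. coord_basis D"
proof (rule coord_basis_exists)
  let ?D = "(\<lambda>b. (b, 0)) ` B \<union> (\<lambda>c. (0, c)) ` C :: ('a \<times> 'b) set"
  show "finite ?D" using assms by (simp add: coord_basis_def)
  show "span ?D = UNIV"
  proof (intro equalityI subsetI UNIV_I)
    fix z :: "'a \<times> 'b"
    have "z = (\<Sum>b\<in>B. (fst z \<bullet> b) *\<^sub>R (b, 0)) + (\<Sum>c\<in>C. (snd z \<bullet> c) *\<^sub>R (0, c))"
      by (rule prod_eqI)
        (simp_all add: fst_sum snd_sum coord_basis_sum[OF assms(1)] coord_basis_sum[OF assms(2)])
    also have "\<dots> \<in> span ?D"
      by (intro span_add span_sum span_scale span_base) auto
    finally show "z \<in> span ?D" .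
  qed
qed

text \<open>Cauchy-Schwarz bounds the coordinates of the points of the ball, which is therefore a
  closed subset of a finite sum of compact segments in the directions \<open>b\<close>. This is what
  makes the supports of bump functions compact.\<close>

lemma coord_basis_compact_cball:
  assumes "coord_basis (B::'a::real_inner set)"
  shows "compact (cball (x0::'a) r)"
proof -
  let ?R = "norm x0 + r"
  have "\<exists>K. compact K \<and> (\<forall>f. (\<forall>b\<in>F. \<bar>f b\<bar> \<le> ?R * norm b) \<longrightarrow> (\<Sum>b\<in>F. f b *\<^sub>R b) \<in> K)" if "finite F" for F :: "'a set"
    using that
  proof (induction F)
    case empty
    then show ?case by (intro exI[of _ "{0}"]) simp
  next
    case (insert b F)
    obtain K where K: "compact K" "\<And>f. \<forall>b\<in>F. \<bar>f b\<bar> \<le> ?R * norm b \<Longrightarrow> (\<Sum>b\<in>F. f b *\<^sub>R b) \<in> K"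
      using insert.IH by blast
    let ?I = "(\<lambda>t. t *\<^sub>R b) ` {- (?R * norm b)..?R * norm b}"
    have "compact ?I" by (intro compact_continuous_image continuous_intros compact_Icc)
    from compact_sums[OF this K(1)] have "compact {x + y |x y. x \<in> ?I \<and> y \<in> K}" .
    moreover have "(\<Sum>b\<in>insert b F. f b *\<^sub>R b) \<in> {x + y |x y. x \<in> ?I \<and> y \<in> K}"
      if f: "\<forall>b\<in>insert b F. \<bar>f b\<bar> \<le> ?R * norm b" for f
    proof -
      have "f b *\<^sub>R b \<in> ?I" using f by (intro imageI) (auto simp: abs_le_iff)
      moreover have "(\<Sum>b\<in>F. f b *\<^sub>R b) \<in> K" using f by (intro K(2)) simp
      ultimately show ?thesis using insert.hyps by auto
    qed
    ultimately show ?case by blast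
  qed
  then obtain K where K: "compact K" "\<And>f. \<forall>b\<in>B. \<bar>f b\<bar> \<le> ?R * norm b \<Longrightarrow> (\<Sum>b\<in>B. f b *\<^sub>R b) \<in> K"
    using coord_basis_finite[OF assms] by blast
  have "cball x0 r \<subseteq> K"
  proof
    fix x assume "x \<in> cball x0 r"
    then have "norm x \<le> ?R"
      by (metis mem_cball dist_norm norm_minus_commute norm_triangle_sub add_left_mono order_trans)
    then have "\<bar>x \<bullet> b\<bar> \<le> ?R * norm b" for b
      by (meson Cauchy_Schwarz_ineq2 mult_right_mono norm_ge_zero order_trans)
    then show "x \<in> K" using K(2)[of "\<lambda>b. x \<bullet> b"] by (simp add: coord_basis_sum[OF assms])
  qed
  then have "K \<inter> cball x0 r = cball x0 r" by (rule Int_absorb1)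
  moreover have "compact (K \<inter> cball x0 r)"
    by (rule compact_Int_closed[OF K(1) closed_cball])
  ultimately show ?thesis by (rule subst)
qed

subsection \<open>Functions of class $C^k$\<close>

lemma Ck_on_cong:
  fixes f g :: "'a::real_normed_vector \<Rightarrow> 'b::real_normed_vector"
  assumes "open S" "\<And>x. x \<in> S \<Longrightarrow> f x = g x" "Ck_on k S f"
  shows "Ck_on k S g"
  using assms(2,3)
proof (induction k arbitrary: f g)
  case 0
  then show ?case using continuous_on_cong by fastforce
next
  case (Suc k)
  have d: "(g has_derivative \<D> f x) (at x)" if "x \<in> S" for x
  proof (rule has_derivative_transform_within_open[OF _ assms(1) that Suc.prems(1)])
    show "(f has_derivative \<D> f x) (at x)"
      using Suc.prems(2) that by (simp add: frechet_derivative_works)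
  qed
  have eq: "\<D> g x = \<D> f x" if "x \<in> S" for x
    using frechet_derivative_at[OF d[OF that]] by (rule sym)
  have "Ck_on k S (\<lambda>x. \<D> g x v)" for v
  proof (rule Suc.IH)
    show "Ck_on k S (\<lambda>x. \<D> f x v)" using Suc.prems(2) by simp
  qed (simp add: eq)
  then show ?case using d by (auto simp: differentiable_def)
qed

lemma Ck_on_SucI:
  fixes f :: "'a::real_normed_vector \<Rightarrow> 'b::real_normed_vector"
  assumes "open S" "\<And>x. x \<in> S \<Longrightarrow> (f has_derivative f' x) (at x)" "\<And>v. Ck_on k S (\<lambda>x. f' x v)"
  shows "Ck_on (Suc k) S f"
proof -
  have "f' x = \<D> f x" if "x \<in> S" for x
    using assms(2)[OF that] by (rule frechet_derivative_at)
  then have "Ck_on k S (\<lambda>x. \<D> f x v)" for v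
    by (intro Ck_on_cong[OF assms(1) _ assms(3)[of v]]) simp
  then show ?thesis using assms(2) by (auto simp: differentiable_def)
qed

lemma Ck_on_SucD:
  assumes "Ck_on (Suc k) S f"
  shows "x \<in> S \<Longrightarrow> (f has_derivative \<D> f x) (at x)"
    and "Ck_on k S (\<lambda>x. \<D> f x v)"
  using assms by (auto simp: frechet_derivative_works)

lemma Ck_on_Suc_imp: "Ck_on (Suc k) S f \<Longrightarrow> Ck_on k S f"
proof (induction k arbitrary: f)
  case 0
  then show ?case
    by (simp add: continuous_at_imp_continuous_on differentiable_imp_continuous_within)
next
  case (Suc k)
  then show ?case by (simp del: Ck_on.simps(2) add: Ck_on.simps(2)[of "Suc k"]) (auto simp: Suc.IH)
qed

lemma Ck_on_imp_continuous: "Ck_on k S f \<Longrightarrow> continuous_on S f"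
proof (induction k)
  case (Suc k)
  then show ?case using Ck_on_Suc_imp by blast
qed simp

lemma Ck_on_subset: "Ck_on k S f \<Longrightarrow> T \<subseteq> S \<Longrightarrow> Ck_on k T f"
  by (induction k arbitrary: f) (auto intro: continuous_on_subset)

lemma Ck_on_local:
  assumes "\<And>x. x \<in> S \<Longrightarrow> \<exists>T. x \<in> T \<and> open T \<and> Ck_on k T f"
  shows "Ck_on k S f"
  using assms
proof (induction k arbitrary: f)
  case 0
  have "continuous (at x within S) f" if x: "x \<in> S" for x
  proof -
    obtain T where "x \<in> T" "open T" "continuous_on T f" using 0[OF x] by auto
    then show ?thesis
      using continuous_at_imp_continuous_at_within continuous_on_eq_continuous_at by blast
  qed
  then show ?case by (simp add: continuous_on_eq_continuous_within)
next
  case (Suc k)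
  show ?case
    unfolding Ck_on.simps
  proof (intro conjI ballI allI)
    fix x assume "x \<in> S"
    then show "f differentiable at x" using Suc.prems by fastforce
  next
    fix v
    show "Ck_on k S (\<lambda>x. \<D> f x v)"
      by (rule Suc.IH) (use Suc.prems in fastforce)
  qed
qed

lemma Ck_on_const: "Ck_on k S (\<lambda>x. c)"
  by (induction k arbitrary: c) auto

lemma Ck_on_add:
  "open S \<Longrightarrow> Ck_on k S f \<Longrightarrow> Ck_on k S g \<Longrightarrow> Ck_on k S (\<lambda>x. f x + g x)"
proof (induction k arbitrary: f g)
  case (Suc k)
  show ?case
    by (rule Ck_on_SucI[OF Suc.prems(1)
          has_derivative_add[OF Ck_on_SucD(1)[OF Suc.prems(2)] Ck_on_SucD(1)[OF Suc.prems(3)]]])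
      (use Suc in auto)
qed (simp add: continuous_on_add)

lemma Ck_on_sum:
  "open S \<Longrightarrow> (\<And>i. i \<in> I \<Longrightarrow> Ck_on k S (f i)) \<Longrightarrow> Ck_on k S (\<lambda>x. \<Sum>i\<in>I. f i x)"
  by (induction I rule: infinite_finite_induct) (auto intro: Ck_on_const Ck_on_add)

lemma Ck_on_bounded_linear:
  assumes "bounded_linear L" "open S"
  shows "Ck_on k S f \<Longrightarrow> Ck_on k S (\<lambda>x. L (f x))"
proof (induction k arbitrary: f)
  case 0
  then show ?case using bounded_linear.continuous_on[OF assms(1)] by simp
next
  case (Suc k)
  show ?case
    by (rule Ck_on_SucI[OF assms(2) bounded_linear.has_derivative[OF assms(1) Ck_on_SucD(1)[OF Suc.prems]]])
      (use Suc in auto)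
qed

lemma Ck_on_id: "open S \<Longrightarrow> Ck_on k S (\<lambda>x. x)"
proof (cases k)
  case (Suc m)
  assume "open S"
  then show ?thesis
    unfolding Suc by (rule Ck_on_SucI[OF _ has_derivative_ident]) (rule Ck_on_const)
qed (simp add: continuous_on_id)

lemma (in bounded_bilinear) Ck_on:
  "open S \<Longrightarrow> Ck_on k S f \<Longrightarrow> Ck_on k S g \<Longrightarrow> Ck_on k S (\<lambda>x. prod (f x) (g x))"
proof (induction k arbitrary: f g)
  case 0
  then show ?case by (auto intro: continuous_on)
next
  case (Suc k)
  show ?case
    by (rule Ck_on_SucI[OF Suc.prems(1)
          FDERIV[OF Ck_on_SucD(1)[OF Suc.prems(2)] Ck_on_SucD(1)[OF Suc.prems(3)]]])
      (use Suc.prems in \<open>auto intro!: Ck_on_add Suc.IH intro: Ck_on_Suc_imp[OF Suc.prems(2)] Ck_on_Suc_imp[OF Suc.prems(3)]\<close>)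
qed

text \<open>In the chain rule the direction \<open>\<D> f x v\<close> varies with \<open>x\<close>,
  whereas \<open>Ck_on\<close> speaks about fixed directions. Expanding it in \<open>B\<close>
  leaves products of functions to which the induction hypothesis applies.\<close>

lemma Ck_on_compose:
  fixes f :: "'a::real_normed_vector \<Rightarrow> 'b::real_inner" and g :: "'b \<Rightarrow> 'c::real_normed_vector"
  assumes "coord_basis (B::'b set)" "open S" "open T" "f ` S \<subseteq> T" "Ck_on k S f" "Ck_on k T g"
  shows "Ck_on k S (\<lambda>x. g (f x))"
  using assms(5,6)
proof (induction k arbitrary: g)
  case 0
  then show ?case using assms(4) by (auto intro: continuous_on_compose2)
next
  case (Suc k)
  have lin: "linear (\<D> g (f x))" if "x \<in> S" for x
    using assms(4) that by (intro has_derivative_linear[OF Ck_on_SucD(1)[OF Suc.prems(2)]]) auto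
  have "Ck_on k S (\<lambda>x. \<D> g (f x) (\<D> f x v))" for v
  proof (rule Ck_on_cong[OF assms(2)])
    show "Ck_on k S (\<lambda>x. \<Sum>b\<in>B. (\<D> f x v \<bullet> b) *\<^sub>R \<D> g (f x) b)"
    proof (rule Ck_on_sum[OF assms(2)])
      fix b
      have "Ck_on k S (\<lambda>x. \<D> f x v \<bullet> b)"
        by (rule Ck_on_bounded_linear[OF bounded_linear_inner_left assms(2) Ck_on_SucD(2)[OF Suc.prems(1)]])
      moreover have "Ck_on k S (\<lambda>x. \<D> g (f x) b)"
        by (rule Suc.IH[OF Ck_on_Suc_imp[OF Suc.prems(1)] Ck_on_SucD(2)[OF Suc.prems(2)]])
      ultimately show "Ck_on k S (\<lambda>x. (\<D> f x v \<bullet> b) *\<^sub>R \<D> g (f x) b)"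
        by (rule bounded_bilinear.Ck_on[OF bounded_bilinear_scaleR assms(2)])
    qed
  qed (simp add: coord_basis_linear[OF assms(1) lin, symmetric])
  then show ?case
    using assms(4)
    by (intro Ck_on_SucI[OF assms(2) has_derivative_compose[OF Ck_on_SucD(1)[OF Suc.prems(1)]
          Ck_on_SucD(1)[OF Suc.prems(2)]]]) auto
qed

lemma Ck_on_Pair:
  assumes "open S" "Ck_on k S f" "Ck_on k S g"
  shows "Ck_on k S (\<lambda>x. (f x, g x))"
proof -
  have "bounded_linear (\<lambda>x. (x, 0::'c))" "bounded_linear (\<lambda>x. (0::'b, x))"
    by (auto intro!: bounded_linear_intros)
  from Ck_on_add[OF assms(1) Ck_on_bounded_linear[OF this(1) assms(1,2)] Ck_on_bounded_linear[OF this(2) assms(1,3)]]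
  show ?thesis by simp
qed

lemma Ck_on_real_SucI:
  fixes f :: "real \<Rightarrow> real"
  assumes "open S" "\<And>x. x \<in> S \<Longrightarrow> (f has_real_derivative f' x) (at x)" "Ck_on k S f'"
  shows "Ck_on (Suc k) S f"
proof (rule Ck_on_SucI[OF assms(1) assms(2)[unfolded has_field_derivative_def]])
  show "Ck_on k S (\<lambda>x. f' x * v)" for v
    by (rule bounded_bilinear.Ck_on[OF bounded_bilinear_mult assms(1,3) Ck_on_const])
qed

lemma smooth_on_cong:
  "open S \<Longrightarrow> (\<And>x. x \<in> S \<Longrightarrow> f x = g x) \<Longrightarrow> smooth_on S f \<Longrightarrow> smooth_on S g"
  using Ck_on_cong unfolding smooth_on_def by blast

lemma smooth_on_subset: "smooth_on S f \<Longrightarrow> T \<subseteq> S \<Longrightarrow> smooth_on T f"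
  using Ck_on_subset unfolding smooth_on_def by blast

lemma smooth_on_local:
  "(\<And>x. x \<in> S \<Longrightarrow> \<exists>T. x \<in> T \<and> open T \<and> smooth_on T f) \<Longrightarrow> smooth_on S f"
  unfolding smooth_on_def by (meson Ck_on_local)

lemma smooth_on_const: "smooth_on S (\<lambda>x. c)"
  and smooth_on_id: "open S \<Longrightarrow> smooth_on S (\<lambda>x. x)"
  and smooth_on_add: "open S \<Longrightarrow> smooth_on S f \<Longrightarrow> smooth_on S g \<Longrightarrow> smooth_on S (\<lambda>x. f x + g x)"
  and smooth_on_sum: "open S \<Longrightarrow> (\<And>i. i \<in> I \<Longrightarrow> smooth_on S (h i)) \<Longrightarrow> smooth_on S (\<lambda>x. \<Sum>i\<in>I. h i x)"
  and smooth_on_bounded_linear: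
    "bounded_linear L \<Longrightarrow> open S \<Longrightarrow> smooth_on S f \<Longrightarrow> smooth_on S (\<lambda>x. L (f x))"
  and smooth_on_Pair: "open S \<Longrightarrow> smooth_on S f' \<Longrightarrow> smooth_on S g' \<Longrightarrow> smooth_on S (\<lambda>x. (f' x, g' x))"
  by (simp_all add: smooth_on_def Ck_on_const Ck_on_id Ck_on_add Ck_on_sum Ck_on_bounded_linear Ck_on_Pair)

lemma smooth_on_linear: "bounded_linear L \<Longrightarrow> open S \<Longrightarrow> smooth_on S L"
  by (rule smooth_on_bounded_linear[OF _ _ smooth_on_id])

lemma smooth_on_mult:
  fixes f g :: "'a::real_normed_vector \<Rightarrow> real"
  shows "open S \<Longrightarrow> smooth_on S f \<Longrightarrow> smooth_on S g \<Longrightarrow> smooth_on S (\<lambda>x. f x * g x)"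
  by (simp add: smooth_on_def bounded_bilinear.Ck_on[OF bounded_bilinear_mult])

lemma smooth_on_inner:
  "open S \<Longrightarrow> smooth_on S f \<Longrightarrow> smooth_on S g \<Longrightarrow> smooth_on S (\<lambda>x. f x \<bullet> g x)"
  by (simp add: smooth_on_def bounded_bilinear.Ck_on[OF bounded_bilinear_inner])

lemma smooth_on_compose:
  fixes f :: "'a::real_normed_vector \<Rightarrow> 'b::real_inner" and g :: "'b \<Rightarrow> 'c::real_normed_vector"
  assumes "coord_basis (B::'b set)" "open S" "open T" "f ` S \<subseteq> T" "smooth_on S f" "smooth_on T g"
  shows "smooth_on S (\<lambda>x. g (f x))"
  using assms(5,6) unfolding smooth_on_def by (blast intro: Ck_on_compose[OF assms(1-4)])

lemma smooth_on_frechet_derivative: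
  "smooth_on S f \<Longrightarrow> smooth_on S (\<lambda>x. \<D> f x v)"
  unfolding smooth_on_def using Ck_on_SucD(2) by blast

lemma smooth_on_has_derivative:
  "smooth_on S f \<Longrightarrow> x \<in> S \<Longrightarrow> (f has_derivative \<D> f x) (at x)"
  unfolding smooth_on_def using Ck_on_SucD(1) by blast

lemma smooth_on_imp_continuous: "smooth_on S f \<Longrightarrow> continuous_on S f"
  unfolding smooth_on_def using Ck_on_imp_continuous by blast

text \<open>The mean value theorem on the segment from \<open>x\<close> to \<open>y\<close> turns
  the increment into one directional derivative at an intermediate point. The criterion is needed
  because an integral is differentiated below in one real parameter at a time, which yields
  directional derivatives only.\<close>

lemma has_derivative_directional:
  fixes f :: "'a::real_inner \<Rightarrow> real"
  assumes B: "coord_basis B" and S: "open S" "x \<in> S"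
    and d: "\<And>y v. y \<in> S \<Longrightarrow> ((\<lambda>t. f (y + t *\<^sub>R v)) has_real_derivative D y v) (at 0)"
    and lin: "\<And>y v. y \<in> S \<Longrightarrow> D y v = (\<Sum>b\<in>B. (v \<bullet> b) * D y b)"
    and cont: "\<And>b. b \<in> B \<Longrightarrow> continuous_on S (\<lambda>y. D y b)"
  shows "(f has_derivative D x) (at x)"
proof -
  have "D x = (\<lambda>v. \<Sum>b\<in>B. (v \<bullet> b) * D x b)" using lin[OF S(2)] by (rule ext)
  moreover have "bounded_linear (\<lambda>v. \<Sum>b\<in>B. (v \<bullet> b) * D x b)"
    by (intro bounded_linear_sum bounded_linear_mult_left[THEN bounded_linear_compose] bounded_linear_inner_left)
  ultimately have bl: "bounded_linear (D x)" by simp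
  have "\<exists>d>0. \<forall>y. norm (y - x) < d \<longrightarrow> norm (f y - f x - D x (y - x)) \<le> e * norm (y - x)" if e: "e > 0" for e
  proof -
    \<comment> \<open>By linearity in the direction and Cauchy-Schwarz, \<open>norm v * E y\<close>
      bounds the difference of \<open>D y v\<close> and \<open>D x v\<close> for all directions
      \<open>v\<close> at once: finitely many continuous functions make the estimate
      uniform.\<close>
    define E where "E = (\<lambda>y. \<Sum>b\<in>B. norm b * \<bar>D y b - D x b\<bar>)"
    have "continuous_on S E" unfolding E_def by (intro continuous_intros cont)
    then have "isCont E x" using S continuous_on_eq_continuous_at by blast
    then have "(E \<longlongrightarrow> 0) (nhds x)"
      using tendsto_at_iff_tendsto_nhds[of E x] by (simp add: continuous_at E_def)
    from order_tendstoD(2)[OF this e] have "eventually (\<lambda>y. y \<in> S \<and> E y < e) (nhds x)"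
      by (intro eventually_conj eventually_nhds_in_open S)
    then obtain r where r: "r > 0" "\<And>y. dist y x < r \<Longrightarrow> y \<in> S \<and> E y < e"
      unfolding eventually_nhds_metric by blast
    have "norm (f y - f x - D x (y - x)) \<le> e * norm (y - x)" if y: "norm (y - x) < r" for y
    proof -
      have seg: "x + t *\<^sub>R (y - x) \<in> ball x r" if "0 \<le> t" "t \<le> 1" for t
      proof -
        have "norm (t *\<^sub>R (y - x)) \<le> 1 * norm (y - x)"
          using that unfolding norm_scaleR by (intro mult_right_mono) auto
        then show ?thesis using y by (simp add: dist_norm)
      qed
      have "\<exists>z>0. z < 1 \<and> f (x + 1 *\<^sub>R (y - x)) - f (x + 0 *\<^sub>R (y - x)) = (1 - 0) * D (x + z *\<^sub>R (y - x)) (y - x)"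
      proof (rule MVT2)
        fix t :: real assume "0 \<le> t" "t \<le> 1"
        then have "x + t *\<^sub>R (y - x) \<in> S" using seg r by (auto simp: dist_commute)
        from d[OF this, of "y - x"]
        have "((\<lambda>s. f (x + (t + s) *\<^sub>R (y - x))) has_real_derivative D (x + t *\<^sub>R (y - x)) (y - x)) (at 0)"
          by (simp add: scaleR_add_left add.assoc)
        then show "((\<lambda>t. f (x + t *\<^sub>R (y - x))) has_real_derivative D (x + t *\<^sub>R (y - x)) (y - x)) (at t)"
          using DERIV_at_within_shift[of "\<lambda>t. f (x + t *\<^sub>R (y - x))" _ t 0 UNIV]
          by (simp add: surj_plus)
      qed simp
      then obtain z where z: "0 < z" "z < 1" "f y - f x = D (x + z *\<^sub>R (y - x)) (y - x)" by auto
      define w where "w = x + z *\<^sub>R (y - x)"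
      have w: "dist w x < r" using seg[of z] z by (simp add: w_def dist_commute)
      have "f y - f x - D x (y - x) = (\<Sum>b\<in>B. ((y - x) \<bullet> b) * (D w b - D x b))"
        using lin[of w "y - x"] lin[OF S(2), of "y - x"] r(2)[OF w] z(3)
        by (simp add: w_def right_diff_distrib sum_subtractf)
      also have "norm \<dots> \<le> (\<Sum>b\<in>B. norm (y - x) * (norm b * \<bar>D w b - D x b\<bar>))"
        by (rule sum_norm_le)
          (simp add: abs_mult mult.assoc[symmetric] mult_right_mono Cauchy_Schwarz_ineq2)
      also have "\<dots> = norm (y - x) * E w" by (simp add: E_def sum_distrib_left)
      also have "\<dots> \<le> e * norm (y - x)"
        using r(2)[OF w] mult_right_mono[of "E w" e "norm (y - x)"] by (simp add: mult.commute)
      finally show ?thesis .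
    qed
    then show ?thesis using r(1) by blast
  qed
  then show ?thesis using bl by (simp add: has_derivative_at_alt)
qed

subsection \<open>Hadamard's lemma and the symmetry of second derivatives\<close>

lemma has_real_derivative_line:
  fixes g :: "'a::real_normed_vector \<Rightarrow> real"
  assumes g: "(g has_derivative g') (at (x + t *\<^sub>R v))"
  shows "((\<lambda>t. g (x + t *\<^sub>R v)) has_real_derivative g' v) (at t within T)"
proof -
  have "((\<lambda>t. g (x + t *\<^sub>R v)) has_derivative (\<lambda>r. g' (r *\<^sub>R v))) (at t within T)"
    by (intro has_derivative_compose[where g = g and f' = "\<lambda>r. r *\<^sub>R v"] g) (auto intro!: derivative_eq_intros)
  then show ?thesis
    unfolding has_field_derivative_def
    using linear_scale[OF has_derivative_linear[OF g]] by (simp add: mult_commute_abs)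
qed

lemma convex_segment_point:
  fixes x x0 :: "'a::real_vector"
  assumes "convex S" "x0 \<in> S" "x \<in> S" "0 \<le> t" "t \<le> 1"
  shows "x0 + t *\<^sub>R (x - x0) \<in> S"
proof -
  have "(1 - t) *\<^sub>R x0 + t *\<^sub>R x \<in> S" using assms by (intro convexD_alt) auto
  then show ?thesis by (simp add: algebra_simps)
qed

lemma continuous_on_ray:
  fixes h :: "'a::real_normed_vector \<Rightarrow> real"
  assumes "convex S" "x0 \<in> S" "continuous_on S h"
  shows "continuous_on (S \<times> {0..1}) (\<lambda>(x, t). t ^ m * h (x0 + t *\<^sub>R (x - x0)))"
  unfolding case_prod_beta
  by (intro continuous_intros continuous_on_compose2[OF assms(3)])
    (auto intro: convex_segment_point assms(1,2))

lemma integrable_on_ray: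
  fixes h :: "'a::real_normed_vector \<Rightarrow> real"
  assumes "convex S" "x0 \<in> S" "continuous_on S h" "x \<in> S"
  shows "(\<lambda>t. t ^ m * h (x0 + t *\<^sub>R (x - x0))) integrable_on {0..1}"
  by (intro integrable_continuous_real continuous_intros continuous_on_compose2[OF assms(3)])
    (auto intro: convex_segment_point assms)

text \<open>
  The weight \<open>t ^ m\<close> makes the induction on \<open>k\<close> work: differentiating in \<open>x\<close> brings out a factor \<open>t\<close>.
\<close>

lemma Ck_on_ray_integral:
  fixes h :: "'a::real_inner \<Rightarrow> real"
  assumes B: "coord_basis (B::'a set)" and S: "open S" "convex S" "x0 \<in> S"
  shows "Ck_on k S h \<Longrightarrow> Ck_on k S (\<lambda>x. integral {0..1} (\<lambda>t. t ^ m * h (x0 + t *\<^sub>R (x - x0))))"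
proof (induction k arbitrary: h m)
  case 0
  then have "continuous_on (S \<times> {0..1}) (\<lambda>(x, t). t ^ m * h (x0 + t *\<^sub>R (x - x0)))"
    by (intro continuous_on_ray[OF S(2,3)]) simp
  then show ?case
    using integral_continuous_on_param[of S 0 1 "\<lambda>x t. t ^ m * h (x0 + t *\<^sub>R (x - x0))"] by simp
next
  case (Suc k)
  define dh where "dh = (\<lambda>v y. \<D> h y v)"
  have hd: "(h has_derivative (\<lambda>v. dh v y)) (at y)" if "y \<in> S" for y
    using Ck_on_SucD(1)[OF Suc.prems that] by (simp add: dh_def)
  have dh: "Ck_on k S (dh v)" for v
    using Ck_on_SucD(2)[OF Suc.prems] by (simp add: dh_def)
  have dh_lin: "dh v y = (\<Sum>b\<in>B. (v \<bullet> b) * dh b y)" if "y \<in> S" for v y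
    using coord_basis_linear[OF B has_derivative_linear[OF hd[OF that]], of v] by simp
  define I where "I = (\<lambda>v x. integral {0..1} (\<lambda>t. t ^ Suc m * dh v (x0 + t *\<^sub>R (x - x0))))"
  have I: "Ck_on k S (I v)" for v
    unfolding I_def by (rule Suc.IH[OF dh])
  have D: "((\<lambda>x. integral {0..1} (\<lambda>t. t ^ m * h (x0 + t *\<^sub>R (x - x0)))) has_derivative (\<lambda>v. I v x)) (at x)"
    if "x \<in> S" for x
  proof (rule has_derivative_directional[OF B S(1) that])
    show "continuous_on S (I b)" for b using I Ck_on_imp_continuous by blast
  next
    fix y v assume y: "y \<in> S"
    have "I v y = integral {0..1} (\<lambda>t. \<Sum>b\<in>B. (v \<bullet> b) * (t ^ Suc m * dh b (x0 + t *\<^sub>R (y - x0))))"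
      unfolding I_def
    proof (rule integral_cong)
      fix t :: real assume "t \<in> {0..1}"
      then have "x0 + t *\<^sub>R (y - x0) \<in> S" using convex_segment_point[OF S(2,3) y] by simp
      from dh_lin[OF this, of v] show "t ^ Suc m * dh v (x0 + t *\<^sub>R (y - x0)) =
          (\<Sum>b\<in>B. (v \<bullet> b) * (t ^ Suc m * dh b (x0 + t *\<^sub>R (y - x0))))"
        by (simp add: sum_distrib_left mult_ac)
    qed
    also have "\<dots> = (\<Sum>b\<in>B. (v \<bullet> b) * I b y)"
      unfolding I_def
      by (subst integral_sum[OF coord_basis_finite[OF B]])
        (simp_all only: integral_mult_right
          integrable_cmul[OF integrable_on_ray[OF S(2,3) Ck_on_imp_continuous[OF dh] y], unfolded real_scaleR_def])
    finally show "I v y = (\<Sum>b\<in>B. (v \<bullet> b) * I b y)" .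
  next
    fix y v assume y: "y \<in> S"
    \<comment> \<open>The parameter \<open>s\<close> is confined to a ball, which is convex, as the
      rule for differentiating under the integral sign demands, and on which the shifted point stays
      in \<open>S\<close>.\<close>
    have "open ((\<lambda>s. y + s *\<^sub>R v) -` S)" by (intro open_vimage S continuous_intros)
    moreover have "0 \<in> (\<lambda>s. y + s *\<^sub>R v) -` S" using y by simp
    ultimately obtain \<epsilon> where \<epsilon>: "\<epsilon> > 0" "ball 0 \<epsilon> \<subseteq> (\<lambda>s. y + s *\<^sub>R v) -` S"
      using open_contains_ball by blast
    have in_S: "y + s *\<^sub>R v \<in> S" if "s \<in> ball 0 \<epsilon>" for s using \<epsilon>(2) that by auto
    have "((\<lambda>s. integral (cbox 0 1) (\<lambda>t. t ^ m * h (x0 + t *\<^sub>R (y + s *\<^sub>R v - x0)))) has_real_derivative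
        integral (cbox 0 1) (\<lambda>t. t ^ Suc m * dh v (x0 + t *\<^sub>R (y + 0 *\<^sub>R v - x0)))) (at 0 within ball 0 \<epsilon>)"
    proof (rule leibniz_rule_field_derivative)
      fix s t :: real assume s: "s \<in> ball 0 \<epsilon>" and t: "t \<in> cbox 0 1"
      define z where "z = x0 + t *\<^sub>R (y + s *\<^sub>R v - x0)"
      have "z \<in> S" unfolding z_def using convex_segment_point[OF S(2,3) in_S[OF s]] t by simp
      then have "((\<lambda>s. h (x0 + t *\<^sub>R (y + s *\<^sub>R v - x0))) has_derivative (\<lambda>r. dh (t *\<^sub>R (r *\<^sub>R v)) z)) (at s within ball 0 \<epsilon>)"
        by (intro has_derivative_compose[where g = h and f' = "\<lambda>r. t *\<^sub>R (r *\<^sub>R v)"])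
          (auto simp: z_def[symmetric] hd intro!: derivative_eq_intros)
      moreover have "dh (t *\<^sub>R (r *\<^sub>R v)) z = t * dh v z * r" for r
        using linear_scale[OF has_derivative_linear[OF hd[OF \<open>z \<in> S\<close>]]] by simp
      ultimately have "((\<lambda>s. h (x0 + t *\<^sub>R (y + s *\<^sub>R v - x0))) has_real_derivative t * dh v z) (at s within ball 0 \<epsilon>)"
        by (simp add: has_field_derivative_def mult_commute_abs)
      from DERIV_cmult[OF this, of "t ^ m"]
      show "((\<lambda>s. t ^ m * h (x0 + t *\<^sub>R (y + s *\<^sub>R v - x0))) has_real_derivative
          t ^ Suc m * dh v (x0 + t *\<^sub>R (y + s *\<^sub>R v - x0))) (at s within ball 0 \<epsilon>)"
        by (simp add: z_def mult_ac)
    next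
      fix s :: real assume s: "s \<in> ball 0 \<epsilon>"
      show "(\<lambda>t. t ^ m * h (x0 + t *\<^sub>R (y + s *\<^sub>R v - x0))) integrable_on cbox 0 1"
        using integrable_on_ray[OF S(2,3) Ck_on_imp_continuous[OF Suc.prems] in_S[OF s], of m] by simp
    next
      have "continuous_on (ball 0 \<epsilon> \<times> cbox 0 1) (\<lambda>z. (case (y + fst z *\<^sub>R v, snd z) of (x, t) \<Rightarrow> t ^ Suc m * dh v (x0 + t *\<^sub>R (x - x0))))"
        by (rule continuous_on_compose2[OF continuous_on_ray[OF S(2,3) Ck_on_imp_continuous[OF dh]]])
          (auto intro!: continuous_intros in_S)
      then show "continuous_on (ball 0 \<epsilon> \<times> cbox 0 1) (\<lambda>(s, t). t ^ Suc m * dh v (x0 + t *\<^sub>R (y + s *\<^sub>R v - x0)))"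
        by (simp add: case_prod_beta)
    qed (use \<epsilon> in auto)
    then show "((\<lambda>s. integral {0..1} (\<lambda>t. t ^ m * h (x0 + t *\<^sub>R (y + s *\<^sub>R v - x0)))) has_real_derivative I v y) (at 0)"
      using \<epsilon>(1) by (simp add: I_def at_within_open[of _ "ball 0 \<epsilon>"])
  qed
  show ?case by (rule Ck_on_SucI[OF S(1) D I])
qed

text \<open>By the fundamental theorem of calculus \<open>f x - f x0\<close> is the integral of the
  derivative along the segment, taken in the direction \<open>x - x0\<close>. Expanding this
  direction in \<open>B\<close> yields \<open>g b\<close> as the integral of the derivative in
  direction \<open>b\<close>, which is smooth by \<open>Ck_on_ray_integral\<close> with weight
  \<open>t ^ 0\<close>.\<close>

lemma hadamard:
  fixes f :: "'a::real_inner \<Rightarrow> real"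
  assumes B: "coord_basis (B::'a set)" and S: "open S" "convex S" "x0 \<in> S" and f: "smooth_on S f"
  shows "\<exists>g. (\<forall>b\<in>B. smooth_on S (g b) \<and> g b x0 = \<D> f x0 b) \<and>
    (\<forall>x\<in>S. f x = f x0 + (\<Sum>b\<in>B. ((x - x0) \<bullet> b) * g b x))"
proof -
  define df where "df = (\<lambda>v y. \<D> f y v)"
  define g where "g = (\<lambda>b x. integral {0..1} (\<lambda>t. t ^ 0 * df b (x0 + t *\<^sub>R (x - x0))))"
  have df_smooth: "smooth_on S (df v)" for v
    unfolding df_def by (rule smooth_on_frechet_derivative[OF f])
  have df: "continuous_on S (df v)" for v
    by (rule smooth_on_imp_continuous[OF df_smooth])
  have g_smooth: "smooth_on S (g b)" for b
    using df_smooth Ck_on_ray_integral[OF B S, of _ "df b" 0] unfolding smooth_on_def g_def by blast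
  have g_x0: "g b x0 = \<D> f x0 b" for b by (simp add: g_def df_def)
  have "f x = f x0 + (\<Sum>b\<in>B. ((x - x0) \<bullet> b) * g b x)" if x: "x \<in> S" for x
  proof -
  have hd: "(f has_derivative (\<lambda>v. df v y)) (at y)" if "y \<in> S" for y
    using smooth_on_has_derivative[OF f that] by (simp add: df_def)
  have "((\<lambda>t. df (x - x0) (x0 + t *\<^sub>R (x - x0))) has_integral
      f (x0 + 1 *\<^sub>R (x - x0)) - f (x0 + 0 *\<^sub>R (x - x0))) {0..1}"
  proof (rule fundamental_theorem_of_calculus)
    fix t :: real assume "t \<in> {0..1}"
    then have z: "x0 + t *\<^sub>R (x - x0) \<in> S" (is "?z \<in> S") using convex_segment_point[OF S(2,3) x] by simp
    show "((\<lambda>t. f (x0 + t *\<^sub>R (x - x0))) has_vector_derivative df (x - x0) ?z) (at t within {0..1})"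
      using has_real_derivative_line[OF hd[OF z]] by (simp add: has_real_derivative_iff_has_vector_derivative)
  qed simp
  then have "f x - f x0 = integral {0..1} (\<lambda>t. df (x - x0) (x0 + t *\<^sub>R (x - x0)))"
    by (simp add: integral_unique)
  also have "\<dots> = integral {0..1} (\<lambda>t. \<Sum>b\<in>B. ((x - x0) \<bullet> b) * (t ^ 0 * df b (x0 + t *\<^sub>R (x - x0))))"
  proof (rule integral_cong)
    fix t :: real assume "t \<in> {0..1}"
    then have z: "x0 + t *\<^sub>R (x - x0) \<in> S" using convex_segment_point[OF S(2,3) x] by simp
    show "df (x - x0) (x0 + t *\<^sub>R (x - x0)) = (\<Sum>b\<in>B. ((x - x0) \<bullet> b) * (t ^ 0 * df b (x0 + t *\<^sub>R (x - x0))))"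
      using coord_basis_linear[OF B has_derivative_linear[OF hd[OF z]], of "x - x0"] by simp
  qed
  also have "\<dots> = (\<Sum>b\<in>B. ((x - x0) \<bullet> b) * integral {0..1} (\<lambda>t. t ^ 0 * df b (x0 + t *\<^sub>R (x - x0))))"
    by (subst integral_sum[OF coord_basis_finite[OF B]])
      (simp_all only: integral_mult_right
        integrable_cmul[OF integrable_on_ray[OF S(2,3) df x], unfolded real_scaleR_def])
  finally show ?thesis by (simp add: g_def)
  qed
  then show ?thesis using g_smooth g_x0 by blast
qed

text \<open>The mean value theorem is used twice: in \<open>s\<close> for the difference of
  \<open>f\<close> over a step along \<open>v\<close>, then in \<open>t\<close> for the derivative
  of \<open>f\<close> along \<open>u\<close>.\<close>

lemma second_difference:
  fixes f :: "'a::real_normed_vector \<Rightarrow> real"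
  assumes f: "smooth_on S f" and h: "h > 0"
    and S: "\<And>s t. 0 \<le> s \<Longrightarrow> s \<le> h \<Longrightarrow> 0 \<le> t \<Longrightarrow> t \<le> h \<Longrightarrow> x + s *\<^sub>R u + t *\<^sub>R v \<in> S"
  shows "\<exists>s t. 0 < s \<and> s < h \<and> 0 < t \<and> t < h \<and>
    f (x + h *\<^sub>R u + h *\<^sub>R v) - f (x + h *\<^sub>R u) - f (x + h *\<^sub>R v) + f x =
    h * (h * \<D> (\<lambda>y. \<D> f y u) (x + s *\<^sub>R u + t *\<^sub>R v) v)"
proof -
  define fu where "fu = (\<lambda>y. \<D> f y u)"
  have fu: "smooth_on S fu" unfolding fu_def by (rule smooth_on_frechet_derivative[OF f])
  have dv: "((\<lambda>t. g (y + t *\<^sub>R w)) has_real_derivative \<D> g (y + t *\<^sub>R w) w) (at t)"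
    if "smooth_on S g" "y + t *\<^sub>R w \<in> S" for g :: "'a \<Rightarrow> real" and y w t
    by (rule has_real_derivative_line[OF smooth_on_has_derivative[OF that]])
  have du: "((\<lambda>s. f (x + s *\<^sub>R u + t *\<^sub>R v)) has_real_derivative fu (x + s *\<^sub>R u + t *\<^sub>R v)) (at s)"
    if "x + s *\<^sub>R u + t *\<^sub>R v \<in> S" for s t
    using dv[OF f, of "x + t *\<^sub>R v" s u] that by (simp add: fu_def add_ac)
  define \<phi> where "\<phi> = (\<lambda>s. f (x + s *\<^sub>R u + h *\<^sub>R v) - f (x + s *\<^sub>R u + 0 *\<^sub>R v))"
  have "\<exists>s>0. s < h \<and> \<phi> h - \<phi> 0 = (h - 0) * (fu (x + s *\<^sub>R u + h *\<^sub>R v) - fu (x + s *\<^sub>R u + 0 *\<^sub>R v))"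
  proof (rule MVT2[OF h])
    fix s assume "0 \<le> s" "s \<le> h"
    then show "(\<phi> has_real_derivative fu (x + s *\<^sub>R u + h *\<^sub>R v) - fu (x + s *\<^sub>R u + 0 *\<^sub>R v)) (at s)"
      unfolding \<phi>_def using h S[of s h] S[of s 0] by (intro DERIV_diff du) auto
  qed
  then obtain s where s: "0 < s" "s < h"
    "\<phi> h - \<phi> 0 = h * (fu (x + s *\<^sub>R u + h *\<^sub>R v) - fu (x + s *\<^sub>R u + 0 *\<^sub>R v))" by auto
  have "\<exists>t>0. t < h \<and> fu (x + s *\<^sub>R u + h *\<^sub>R v) - fu (x + s *\<^sub>R u + 0 *\<^sub>R v) =
      (h - 0) * \<D> fu (x + s *\<^sub>R u + t *\<^sub>R v) v"
    by (rule MVT2[OF h]) (use s S in \<open>auto intro!: dv[OF fu]\<close>)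
  then obtain t where t: "0 < t" "t < h" "fu (x + s *\<^sub>R u + h *\<^sub>R v) - fu (x + s *\<^sub>R u + 0 *\<^sub>R v) =
      h * \<D> fu (x + s *\<^sub>R u + t *\<^sub>R v) v" by auto
  have "\<phi> h - \<phi> 0 = f (x + h *\<^sub>R u + h *\<^sub>R v) - f (x + h *\<^sub>R u) - f (x + h *\<^sub>R v) + f x"
    by (simp add: \<phi>_def)
  then show ?thesis using s t unfolding fu_def by metis
qed

text \<open>The second difference is symmetric in \<open>u\<close> and \<open>v\<close>, so the two
  mixed derivatives take a common value at points (one for each) arbitrarily close to
  \<open>x\<close>; continuity carries the equality to \<open>x\<close>.\<close>

lemma frechet_derivative_symmetric:
  fixes f :: "'a::real_normed_vector \<Rightarrow> real"
  assumes f: "smooth_on S f" and S: "open S" "x \<in> S"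
  shows "\<D> (\<lambda>y. \<D> f y u) x v =
    \<D> (\<lambda>y. \<D> f y v) x u"
proof -
  define A where "A = (\<lambda>u v y. \<D> (\<lambda>y. \<D> f y u) y v)"
  have A: "continuous_on S (A u v)" for u v
    unfolding A_def by (intro smooth_on_imp_continuous smooth_on_frechet_derivative f)
  have "dist (A u v x) (A v u x) \<le> e" if e: "e > 0" for e
  proof -
    have cont: "isCont (\<lambda>y. A u v y) x" for u v
      using A S continuous_on_eq_continuous_at by blast
    have "((\<lambda>y. A u v y) \<longlongrightarrow> A u v x) (nhds x)" for u v
      using cont tendsto_at_iff_tendsto_nhds[of "\<lambda>y. A u v y" x for u v] by (simp add: continuous_at)
    then have "\<forall>\<^sub>F y in nhds x. dist (A u v y) (A u v x) < e / 2" for u v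
      by (rule tendstoD) (use e in simp)
    then have "\<forall>\<^sub>F y in nhds x. y \<in> S \<and> dist (A u v y) (A u v x) < e / 2 \<and> dist (A v u y) (A v u x) < e / 2"
      by (intro eventually_conj eventually_nhds_in_open[OF S])
    then obtain r where r: "r > 0"
      "\<And>y. dist y x < r \<Longrightarrow> y \<in> S \<and> dist (A u v y) (A u v x) < e / 2 \<and> dist (A v u y) (A v u x) < e / 2"
      unfolding eventually_nhds_metric by blast
    \<comment> \<open>With \<open>h * K = r / 2\<close> the whole parallelogram stays within
      \<open>r\<close> of \<open>x\<close>; the summand 1 keeps the denominator positive when
      \<open>u\<close> and \<open>v\<close> vanish.\<close>
    define K where "K = norm u + norm v + 1"
    define h where "h = r / (2 * K)"
    have pos: "K > 0" by (simp add: K_def add_nonneg_pos)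
    then have h: "h > 0" using r by (simp add: h_def)
    have near: "dist (x + s *\<^sub>R u + t *\<^sub>R v) x < r" if "0 \<le> s" "s \<le> h" "0 \<le> t" "t \<le> h" for s t
    proof -
      have "norm (s *\<^sub>R u + t *\<^sub>R v) \<le> s * norm u + t * norm v"
        using norm_triangle_ineq[of "s *\<^sub>R u" "t *\<^sub>R v"] that by simp
      also have "\<dots> \<le> h * norm u + h * norm v"
        using that by (intro add_mono mult_right_mono) auto
      also have "\<dots> \<le> h * K" using h by (simp add: K_def algebra_simps)
      also have "\<dots> = r / 2" using pos by (simp add: h_def)
      finally show ?thesis using r(1) by (simp add: dist_norm add.assoc)
    qed
    have near_S: "x + s *\<^sub>R u + t *\<^sub>R v \<in> S" if "0 \<le> s" "s \<le> h" "0 \<le> t" "t \<le> h" for s t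
      using near[OF that] r(2) by blast
    have near_S': "x + s *\<^sub>R v + t *\<^sub>R u \<in> S" if "0 \<le> s" "s \<le> h" "0 \<le> t" "t \<le> h" for s t
      using near_S[OF that(3,4,1,2)] by (simp add: add_ac)
    obtain s t where st: "0 < s" "s < h" "0 < t" "t < h"
      "f (x + h *\<^sub>R u + h *\<^sub>R v) - f (x + h *\<^sub>R u) - f (x + h *\<^sub>R v) + f x = h * (h * A u v (x + s *\<^sub>R u + t *\<^sub>R v))"
      using second_difference[OF f h, of x u v] near_S unfolding A_def by blast
    obtain s' t' where st': "0 < s'" "s' < h" "0 < t'" "t' < h"
      "f (x + h *\<^sub>R v + h *\<^sub>R u) - f (x + h *\<^sub>R v) - f (x + h *\<^sub>R u) + f x = h * (h * A v u (x + s' *\<^sub>R v + t' *\<^sub>R u))"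
      using second_difference[OF f h, of x v u] near_S' unfolding A_def by blast
    have "h * (h * A u v (x + s *\<^sub>R u + t *\<^sub>R v)) = h * (h * A v u (x + s' *\<^sub>R v + t' *\<^sub>R u))"
    proof -
      have swap: "x + h *\<^sub>R v + h *\<^sub>R u = x + h *\<^sub>R u + h *\<^sub>R v" by simp
      show ?thesis using st(5) st'(5)[unfolded swap] by linarith
    qed
    then have "A u v (x + s *\<^sub>R u + t *\<^sub>R v) = A v u (x + t' *\<^sub>R u + s' *\<^sub>R v)"
      using h by (simp add: add_ac)
    moreover have "dist (A u v (x + s *\<^sub>R u + t *\<^sub>R v)) (A u v x) < e / 2"
      using near[of s t] st r(2) by auto
    moreover have "dist (A v u (x + t' *\<^sub>R u + s' *\<^sub>R v)) (A v u x) < e / 2"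
      using near[of t' s'] st' r(2) by auto
    ultimately show ?thesis unfolding dist_real_def by linarith
  qed
  then have "dist (A u v x) (A v u x) \<le> 0" by (rule field_le_epsilon[of _ 0, simplified])
  then show ?thesis by (simp add: A_def)
qed

subsection \<open>Bump functions\<close>

text \<open>The span of these functions is closed under differentiation.\<close>

definition flat_exp :: "nat \<Rightarrow> real \<Rightarrow> real" where
  "flat_exp n x = (if x > 0 then inverse x ^ n * exp (- inverse x) else 0)"

lemma flat_exp_tendsto_0: "(flat_exp n \<longlongrightarrow> 0) (at 0)"
proof (rule filterlim_split_at)
  have "((\<lambda>x. x ^ n / exp x) \<longlongrightarrow> (0::real)) at_top" by (rule tendsto_power_div_exp_0)
  then have "((\<lambda>x. inverse x ^ n / exp (inverse x)) \<longlongrightarrow> (0::real)) (at_right 0)"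
    by (rule filterlim_compose[OF _ filterlim_inverse_at_top_right])
  then show "(flat_exp n \<longlongrightarrow> 0) (at_right 0)"
    by (rule Lim_transform_eventually)
      (auto simp: eventually_at_right_field flat_exp_def exp_minus divide_inverse intro: exI[of _ 1])
  show "(flat_exp n \<longlongrightarrow> 0) (at_left 0)"
    by (rule tendsto_eventually) (auto simp: eventually_at_left_field flat_exp_def intro: exI[of _ "-1"])
qed

text \<open>At 0 the difference quotient of \<open>flat_exp n\<close> is
  \<open>flat_exp (Suc n)\<close>, which tends to 0; for positive \<open>x\<close> the formula is
  the product rule.\<close>

lemma flat_exp_has_derivative:
  "(flat_exp n has_real_derivative flat_exp (n + 2) x - n * flat_exp (n + 1) x) (at x)"
proof -
  consider "x > 0" | "x < 0" | "x = 0" by linarith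
  then show ?thesis
  proof cases
    case 1
    have "((\<lambda>x. inverse x ^ n * exp (- inverse x)) has_real_derivative
        inverse x ^ (n + 2) * exp (- inverse x) - n * (inverse x ^ (n + 1) * exp (- inverse x))) (at x)"
    proof -
      have "real n * inverse x ^ (n - Suc 0) * inverse x = real n * inverse x ^ n" by (cases n) auto
      then show ?thesis
        using 1 by (auto intro!: derivative_eq_intros simp: power2_eq_square algebra_simps)
    qed
    then have "(flat_exp n has_real_derivative
        inverse x ^ (n + 2) * exp (- inverse x) - n * (inverse x ^ (n + 1) * exp (- inverse x))) (at x)"
      by (rule DERIV_cong_ev[THEN iffD1, rotated -1])
        (use 1 in \<open>auto simp: flat_exp_def eventually_nhds intro!: exI[of _ "{0<..}"]\<close>)
    then show ?thesis using 1 by (simp add: flat_exp_def)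
  next
    case 2
    have "((\<lambda>x. 0) has_real_derivative 0) (at x)" by simp
    then have "(flat_exp n has_real_derivative 0) (at x)"
      by (rule DERIV_cong_ev[THEN iffD1, rotated -1])
        (use 2 in \<open>auto simp: flat_exp_def eventually_nhds intro!: exI[of _ "{..<0}"]\<close>)
    then show ?thesis using 2 by (simp add: flat_exp_def)
  next
    case 3
    have "((\<lambda>y. (flat_exp n y - flat_exp n 0) / (y - 0)) \<longlongrightarrow> 0) (at 0)"
      using flat_exp_tendsto_0[of "Suc n"]
      by (rule Lim_transform_eventually)
        (auto simp: flat_exp_def divide_inverse intro!: always_eventually)
    then show ?thesis using 3 by (simp add: has_field_derivative_iff flat_exp_def)
  qed
qed

lemma smooth_on_flat_exp: "smooth_on UNIV (flat_exp n)"
  unfolding smooth_on_def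
proof
  fix k show "Ck_on k UNIV (flat_exp n)"
  proof (induction k arbitrary: n)
    case 0
    show ?case
      unfolding Ck_on.simps using flat_exp_has_derivative DERIV_isCont continuous_at_imp_continuous_on by blast
  next
    case (Suc k)
    have "Ck_on k UNIV (\<lambda>x. flat_exp (n + 2) x + (- real n) * flat_exp (n + 1) x)"
      by (rule Ck_on_add[OF open_UNIV Suc.IH Ck_on_bounded_linear[OF bounded_linear_mult_right open_UNIV Suc.IH]])
    then show ?case
      by (intro Ck_on_real_SucI[OF open_UNIV flat_exp_has_derivative]) simp
  qed
qed

lemma smooth_on_inverse: "smooth_on {0<..} (inverse :: real \<Rightarrow> real)"
  unfolding smooth_on_def
proof
  fix k show "Ck_on k {0<..} (inverse :: real \<Rightarrow> real)"
  proof (induction k)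
    case 0
    show ?case by (auto intro!: continuous_intros)
  next
    case (Suc k)
    have "Ck_on k {0<..} (\<lambda>x::real. (-1) * (inverse x * inverse x))"
      by (rule Ck_on_bounded_linear[OF bounded_linear_mult_right open_greaterThan
            bounded_bilinear.Ck_on[OF bounded_bilinear_mult open_greaterThan Suc.IH Suc.IH]])
    then show ?case
      by (rule Ck_on_real_SucI[OF open_greaterThan, rotated])
        (auto intro!: derivative_eq_intros simp: power2_eq_square)
  qed
qed

text \<open>The witness is \<open>e t / (e t + e (1 - t))\<close> with
  \<open>e = flat_exp 0\<close>: since \<open>t\<close> and \<open>1 - t\<close> are never both
  nonpositive, the denominator is positive.\<close>

lemma smooth_cutoff_exists:
  "\<exists>c::real \<Rightarrow> real. smooth_on UNIV c \<and> (\<forall>t\<le>0. c t = 0) \<and> (\<forall>t\<ge>1. c t = 1)"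
proof -
  define e where "e = flat_exp 0"
  define d where "d = (\<lambda>t. e t + e (1 - t))"
  let ?c = "\<lambda>t. e t * inverse (d t)"
  have e: "smooth_on UNIV e" unfolding e_def by (rule smooth_on_flat_exp)
  have "smooth_on UNIV (\<lambda>t::real. 1 + (-1) * t)"
    by (rule smooth_on_add[OF open_UNIV smooth_on_const
          smooth_on_bounded_linear[OF bounded_linear_mult_right open_UNIV smooth_on_id[OF open_UNIV]]])
  then have "smooth_on UNIV (\<lambda>t::real. 1 - t)" by simp
  from smooth_on_compose[OF coord_basis_real open_UNIV open_UNIV _ this e]
  have d: "smooth_on UNIV d" unfolding d_def using e by (intro smooth_on_add) auto
  have "d t \<in> {0<..}" for t
    by (cases "t > 0") (auto simp: d_def e_def flat_exp_def add_pos_nonneg)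
  then have "d ` UNIV \<subseteq> {0<..}" by blast
  from smooth_on_compose[OF coord_basis_real open_UNIV open_greaterThan this d smooth_on_inverse]
  have "smooth_on UNIV ?c" using e by (intro smooth_on_mult) auto
  moreover have "?c t = 0" if "t \<le> 0" for t using that by (simp add: e_def flat_exp_def)
  moreover have "?c t = 1" if "t \<ge> 1" for t using that by (simp add: d_def e_def flat_exp_def)
  ultimately show ?thesis by (intro exI[of _ ?c]) auto
qed

lemma bump_exists:
  assumes B: "coord_basis (B::'a::real_inner set)" and r: "r > 0"
  shows "\<exists>\<beta>::'a \<Rightarrow> real. smooth_on UNIV \<beta> \<and> (\<forall>x\<in>ball x0 (r / 2). \<beta> x = 1) \<and> (\<forall>x. x \<notin> ball x0 r \<longrightarrow> \<beta> x = 0)"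
proof -
  obtain c :: "real \<Rightarrow> real" where c: "smooth_on UNIV c" "\<And>t. t \<le> 0 \<Longrightarrow> c t = 0" "\<And>t. t \<ge> 1 \<Longrightarrow> c t = 1"
    using smooth_cutoff_exists by blast
  \<comment> \<open>A quadratic polynomial is smooth also at the centre, where the norm is not. The
    constants make it at least 3/2 on the half ball and at most 0 outside the ball, where the cutoff
    \<open>c\<close> is 1 and 0 respectively.\<close>
  define q where "q = (\<lambda>x. 2 + (- 2 / r\<^sup>2) * ((x + - x0) \<bullet> (x + - x0)))"
  have "smooth_on UNIV (\<lambda>x. x + - x0)"
    by (intro smooth_on_add smooth_on_id smooth_on_const) auto
  from smooth_on_inner[OF open_UNIV this this]
  have q: "smooth_on UNIV q"
    unfolding q_def
    by (intro smooth_on_add smooth_on_const smooth_on_bounded_linear[OF bounded_linear_mult_right]) auto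
  have q_eq: "q x = 2 - 2 * (dist x0 x / r)\<^sup>2" for x
    by (simp add: q_def dist_norm power_divide norm_minus_commute[of x0] flip: power2_norm_eq_inner)
  show ?thesis
  proof (intro exI conjI ballI allI impI)
    show "smooth_on UNIV (\<lambda>x. c (q x))"
      by (rule smooth_on_compose[OF coord_basis_real open_UNIV open_UNIV _ q c(1)]) simp
    show "c (q x) = 1" if "x \<in> ball x0 (r / 2)" for x
    proof (rule c(3))
      have "dist x0 x / r \<le> 1 / 2" using that r by (simp add: field_simps)
      then have "(dist x0 x / r)\<^sup>2 \<le> (1 / 2)\<^sup>2" using r by (intro power_mono) auto
      moreover have "(1 / 2)\<^sup>2 = (1 / 4::real)" by (simp add: power2_eq_square)
      ultimately show "1 \<le> q x" unfolding q_eq by linarith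
    qed
    show "c (q x) = 0" if "x \<notin> ball x0 r" for x
    proof (rule c(2))
      have "1 \<le> dist x0 x / r" using that r by (simp add: field_simps)
      then have "1\<^sup>2 \<le> (dist x0 x / r)\<^sup>2" by (intro power_mono) auto
      then show "q x \<le> 0" by (simp add: q_eq)
    qed
  qed
qed

section \<open>Smooth maps between manifolds\<close>

lemma smooth_atlas_basis:
  fixes A :: "('m::topological_space, 'e::real_inner) atlas"
  assumes "smooth_atlas A"
  obtains B :: "'e set" where "coord_basis B"
proof -
  obtain X :: "'e set" where "finite X" "span X = UNIV" using assms by (auto simp: smooth_atlas_def)
  from coord_basis_exists[OF this] show ?thesis using that by blast
qed

lemma chart_around:
  assumes "smooth_atlas A"
  obtains U \<phi> where "(U, \<phi>) \<in> A" "p \<in> U"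
proof -
  have "p \<in> (\<Union>(U, \<phi>)\<in>A. U)" using assms by (simp add: smooth_atlas_def)
  then show ?thesis using that by auto
qed

context
  fixes A :: "('m::topological_space, 'e::real_inner) atlas" and U \<phi>
  assumes SA: "smooth_atlas A" and ch: "(U, \<phi>) \<in> A"
begin

lemma chart_open: "open U"
  and chart_image_open: "open (\<phi> ` U)"
  and chart_homeomorphism: "\<exists>\<psi>. homeomorphism U (\<phi> ` U) \<phi> \<psi>"
  using SA ch unfolding smooth_atlas_def by blast+

lemma chart_inj: "inj_on \<phi> U"
  and chart_continuous: "continuous_on U \<phi>"
  using chart_homeomorphism unfolding homeomorphism_def by (auto intro: inj_on_inverseI)

lemma chart_inverse [simp]: "x \<in> U \<Longrightarrow> inv_into U \<phi> (\<phi> x) = x"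
  using chart_inj by simp

lemma chart_inverse_continuous: "continuous_on (\<phi> ` U) (inv_into U \<phi>)"
proof -
  obtain \<psi> where \<psi>: "homeomorphism U (\<phi> ` U) \<phi> \<psi>" using chart_homeomorphism by blast
  then have "\<psi> y = inv_into U \<phi> y" if "y \<in> \<phi> ` U" for y
    using that by (auto simp: homeomorphism_def)
  then show ?thesis using \<psi> continuous_on_cong unfolding homeomorphism_def by metis
qed

lemma chart_subimage_open:
  assumes "open W" "W \<subseteq> U"
  shows "open (\<phi> ` W)"
proof -
  have "\<phi> ` W = \<phi> ` U \<inter> inv_into U \<phi> -` W" using assms(2) by auto
  then show ?thesis
    using continuous_open_preimage[OF chart_inverse_continuous chart_image_open assms(1)] by simp
qed

lemma chart_transition: "(V, \<psi>) \<in> A \<Longrightarrow> smooth_on (\<phi> ` (U \<inter> V)) (\<psi> \<circ> inv_into U \<phi>)"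
  using SA ch unfolding smooth_atlas_def by blast

end

lemma smooth_map_continuous: "smooth_map A B F \<Longrightarrow> continuous_on UNIV F"
  by (simp add: smooth_map_def)

lemma smooth_map_open_vimage: "smooth_map A B F \<Longrightarrow> open V \<Longrightarrow> open (F -` V)"
  using smooth_map_continuous continuous_on_open_vimage[of UNIV F] by auto

lemma smooth_map_chart:
  "smooth_map A B F \<Longrightarrow> (U, \<phi>) \<in> A \<Longrightarrow> (V, \<psi>) \<in> B \<Longrightarrow>
    smooth_on (\<phi> ` (U \<inter> F -` V)) (\<psi> \<circ> F \<circ> inv_into U \<phi>)"
  unfolding smooth_map_def by blast

lemma smooth_map_comp:
  fixes A :: "('l::topological_space, 'd::real_inner) atlas"
    and B :: "('m::topological_space, 'e::real_inner) atlas"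
    and C :: "('n::topological_space, 'f::real_inner) atlas"
  assumes SA: "smooth_atlas A" and SB: "smooth_atlas B" and SC: "smooth_atlas C"
    and F: "smooth_map A B F" and H: "smooth_map B C H"
  shows "smooth_map A C (\<lambda>x. H (F x))"
proof -
  have cont: "continuous_on UNIV (\<lambda>x. H (F x))"
    by (rule continuous_on_compose2[OF smooth_map_continuous[OF H] smooth_map_continuous[OF F]]) simp
  obtain BB :: "'e set" where BB: "coord_basis BB" using smooth_atlas_basis[OF SB] .
  have "smooth_on (\<phi> ` (U \<inter> (\<lambda>x. H (F x)) -` V)) (\<kappa> \<circ> (\<lambda>x. H (F x)) \<circ> inv_into U \<phi>)"
    if A': "(U, \<phi>) \<in> A" and C': "(V, \<kappa>) \<in> C" for U \<phi> V \<kappa>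
  proof (rule smooth_on_local)
    fix y assume "y \<in> \<phi> ` (U \<inter> (\<lambda>x. H (F x)) -` V)"
    then obtain p where p: "p \<in> U" "H (F p) \<in> V" "y = \<phi> p" by auto
    obtain W \<psi> where B': "(W, \<psi>) \<in> B" "F p \<in> W" using chart_around[OF SB] .
    \<comment> \<open>The domain is shrunk until its image under \<open>F\<close> lies in the middle
      chart, where the two local representatives can be composed.\<close>
    define W' where "W' = U \<inter> F -` (W \<inter> H -` V)"
    have oWV: "open (W \<inter> H -` V)"
      by (intro open_Int smooth_map_open_vimage[OF H] chart_open[OF SB B'(1)] chart_open[OF SC C'])
    have "open W'"
      unfolding W'_def by (rule open_Int[OF chart_open[OF SA A'] smooth_map_open_vimage[OF F oWV]])
    then have oT: "open (\<phi> ` W')" by (rule chart_subimage_open[OF SA A']) (auto simp: W'_def)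
    have oWV': "open (\<psi> ` (W \<inter> H -` V))" by (rule chart_subimage_open[OF SB B'(1) oWV]) auto
    have inv: "inv_into U \<phi> (\<phi> x) = x" if "x \<in> W'" for x
      using that chart_inverse[OF SA A'] by (simp add: W'_def)
    have 1: "smooth_on (\<phi> ` W') (\<psi> \<circ> F \<circ> inv_into U \<phi>)"
      by (rule smooth_on_subset[OF smooth_map_chart[OF F A' B'(1)]]) (auto simp: W'_def)
    have "smooth_on (\<phi> ` W') (\<lambda>y. (\<kappa> \<circ> H \<circ> inv_into W \<psi>) ((\<psi> \<circ> F \<circ> inv_into U \<phi>) y))"
      by (rule smooth_on_compose[OF BB oT oWV' _ 1 smooth_map_chart[OF H B'(1) C']]) (auto simp: inv W'_def)
    then have "smooth_on (\<phi> ` W') (\<kappa> \<circ> (\<lambda>x. H (F x)) \<circ> inv_into U \<phi>)"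
      by (rule smooth_on_cong[OF oT, rotated]) (auto simp: inv W'_def chart_inverse[OF SB B'(1)])
    then show "\<exists>T. y \<in> T \<and> open T \<and> smooth_on T (\<kappa> \<circ> (\<lambda>x. H (F x)) \<circ> inv_into U \<phi>)"
      using oT p B'(2) by (intro exI[of _ "\<phi> ` W'"]) (auto simp: W'_def)
  qed
  then show ?thesis using cont unfolding smooth_map_def by blast
qed

lemma smooth_map_id: "smooth_atlas A \<Longrightarrow> smooth_map A A (\<lambda>x. x)"
  using chart_transition by (auto simp: smooth_map_def comp_def)

lemma smooth_map_const: "smooth_map A B (\<lambda>x. c)"
  by (auto simp: smooth_map_def comp_def intro: smooth_on_const)

lemma smooth_map_Pair:
  assumes F: "smooth_map A B F" and H: "smooth_map A C H"
    and SA: "smooth_atlas A" and SB: "smooth_atlas B" and SC: "smooth_atlas C"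
  shows "smooth_map A (prod_atlas B C) (\<lambda>x. (F x, H x))"
  unfolding smooth_map_def
proof (intro conjI ballI, goal_cases)
  case 1
  show ?case by (intro continuous_on_Pair smooth_map_continuous[OF F] smooth_map_continuous[OF H])
next
  case (2 c)
  obtain U \<phi> where c: "c = (U, \<phi>)" "(U, \<phi>) \<in> A" using 2 by (cases c) auto
  have "smooth_on (\<phi> ` (U \<inter> (\<lambda>x. (F x, H x)) -` (V \<times> W))) (map_prod \<psi> \<kappa> \<circ> (\<lambda>x. (F x, H x)) \<circ> inv_into U \<phi>)"
    if B': "(V, \<psi>) \<in> B" and C': "(W, \<kappa>) \<in> C" for V \<psi> W \<kappa>
  proof -
    have o: "open (\<phi> ` (U \<inter> (\<lambda>x. (F x, H x)) -` (V \<times> W)))"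
    proof (rule chart_subimage_open[OF SA c(2)])
      have "(\<lambda>x. (F x, H x)) -` (V \<times> W) = F -` V \<inter> H -` W" by auto
      then show "open (U \<inter> (\<lambda>x. (F x, H x)) -` (V \<times> W))"
        using smooth_map_open_vimage[OF F chart_open[OF SB B']] smooth_map_open_vimage[OF H chart_open[OF SC C']]
          chart_open[OF SA c(2)] by auto
    qed auto
    have "smooth_on (\<phi> ` (U \<inter> (\<lambda>x. (F x, H x)) -` (V \<times> W)))
        (\<lambda>y. ((\<psi> \<circ> F \<circ> inv_into U \<phi>) y, (\<kappa> \<circ> H \<circ> inv_into U \<phi>) y))"
      by (intro smooth_on_Pair[OF o] smooth_on_subset[OF smooth_map_chart[OF F c(2) B']]
          smooth_on_subset[OF smooth_map_chart[OF H c(2) C']]) auto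
    then show ?thesis by (simp add: comp_def)
  qed
  then show ?case by (auto simp: prod_atlas_def c(1))
qed

context
  fixes A :: "('m::topological_space, 'e::real_inner) atlas" and B :: "('n::topological_space, 'f::real_inner) atlas"
  assumes SA: "smooth_atlas A" and SB: "smooth_atlas B"
begin

lemma inv_into_map_prod:
  assumes "(U, \<phi>) \<in> A" "(V, \<psi>) \<in> B" "y \<in> \<phi> ` U" "z \<in> \<psi> ` V"
  shows "inv_into (U \<times> V) (map_prod \<phi> \<psi>) (y, z) = (inv_into U \<phi> y, inv_into V \<psi> z)"
proof (rule inv_into_f_eq)
  show "inj_on (map_prod \<phi> \<psi>) (U \<times> V)"
    using chart_inj[OF SA assms(1)] chart_inj[OF SB assms(2)] by (rule map_prod_inj_on)
  show "(inv_into U \<phi> y, inv_into V \<psi> z) \<in> U \<times> V"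
    using assms(3,4) by (simp add: inv_into_into)
  show "map_prod \<phi> \<psi> (inv_into U \<phi> y, inv_into V \<psi> z) = (y, z)"
    using assms(3,4) by (simp add: f_inv_into_f)
qed

lemma smooth_on_fst_compose:
  assumes "open S" "open T" "smooth_on S g"
  shows "smooth_on (S \<times> (T::'f set)) (\<lambda>z. g (fst z :: 'e))"
proof -
  obtain B0 :: "'e set" where B0: "coord_basis B0" using smooth_atlas_basis[OF SA] .
  show ?thesis
    by (rule smooth_on_compose[OF B0 open_Times[OF assms(1,2)] assms(1) _ _ assms(3)])
      (auto intro: smooth_on_linear[OF bounded_linear_fst open_Times[OF assms(1,2)]])
qed

lemma smooth_on_snd_compose:
  assumes "open S" "open T" "smooth_on T g"
  shows "smooth_on ((S::'e set) \<times> T) (\<lambda>z. g (snd z :: 'f))"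
proof -
  obtain B0 :: "'f set" where B0: "coord_basis B0" using smooth_atlas_basis[OF SB] .
  show ?thesis
    by (rule smooth_on_compose[OF B0 open_Times[OF assms(1,2)] assms(2) _ _ assms(3)])
      (auto intro: smooth_on_linear[OF bounded_linear_snd open_Times[OF assms(1,2)]])
qed

lemma smooth_map_fst: "smooth_map (prod_atlas A B) A fst"
  unfolding smooth_map_def
proof (intro conjI ballI, goal_cases)
  case 1
  show ?case by (intro continuous_intros)
next
  case (2 c)
  then obtain U \<phi> V \<psi> where c: "c = (U \<times> V, map_prod \<phi> \<psi>)" "(U, \<phi>) \<in> A" "(V, \<psi>) \<in> B"
    by (auto simp: prod_atlas_def)
  have "smooth_on (map_prod \<phi> \<psi> ` (U \<times> V \<inter> fst -` U')) (\<phi>' \<circ> fst \<circ> inv_into (U \<times> V) (map_prod \<phi> \<psi>))"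
    if A': "(U', \<phi>') \<in> A" for U' \<phi>'
  proof -
    have eq: "map_prod \<phi> \<psi> ` (U \<times> V \<inter> fst -` U') = \<phi> ` (U \<inter> U') \<times> \<psi> ` V" by force
    have o: "open (\<phi> ` (U \<inter> U'))" "open (\<psi> ` V)"
      using chart_subimage_open[OF SA c(2)] chart_open[OF SA c(2)] chart_open[OF SA A']
        chart_image_open[OF SB c(3)] by auto
    show ?thesis
      unfolding eq
      by (rule smooth_on_cong[OF open_Times[OF o] _ smooth_on_fst_compose[OF o chart_transition[OF SA c(2) A']]])
        (auto simp: inv_into_map_prod[OF c(2,3)])
  qed
  then show ?case using c(1) by auto
qed

lemma smooth_map_snd: "smooth_map (prod_atlas A B) B snd"
  unfolding smooth_map_def
proof (intro conjI ballI, goal_cases)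
  case 1
  show ?case by (intro continuous_intros)
next
  case (2 c)
  then obtain U \<phi> V \<psi> where c: "c = (U \<times> V, map_prod \<phi> \<psi>)" "(U, \<phi>) \<in> A" "(V, \<psi>) \<in> B"
    by (auto simp: prod_atlas_def)
  have "smooth_on (map_prod \<phi> \<psi> ` (U \<times> V \<inter> snd -` V')) (\<psi>' \<circ> snd \<circ> inv_into (U \<times> V) (map_prod \<phi> \<psi>))"
    if B': "(V', \<psi>') \<in> B" for V' \<psi>'
  proof -
    have eq: "map_prod \<phi> \<psi> ` (U \<times> V \<inter> snd -` V') = \<phi> ` U \<times> \<psi> ` (V \<inter> V')" by force
    have o: "open (\<phi> ` U)" "open (\<psi> ` (V \<inter> V'))"
      using chart_subimage_open[OF SB c(3)] chart_open[OF SB c(3)] chart_open[OF SB B']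
        chart_image_open[OF SA c(2)] by auto
    show ?thesis
      unfolding eq
      by (rule smooth_on_cong[OF open_Times[OF o] _ smooth_on_snd_compose[OF o chart_transition[OF SB c(3) B']]])
        (auto simp: inv_into_map_prod[OF c(2,3)])
  qed
  then show ?case using c(1) by auto
qed

lemma smooth_atlas_prod: "smooth_atlas (prod_atlas A B)"
  unfolding smooth_atlas_def
proof (intro conjI ballI, goal_cases)
  case 1
  obtain BA :: "'e set" where BA: "coord_basis BA" using smooth_atlas_basis[OF SA] .
  obtain BB :: "'f set" where BB: "coord_basis BB" using smooth_atlas_basis[OF SB] .
  obtain D :: "('e \<times> 'f) set" where D: "coord_basis D" using coord_basis_prod[OF BA BB] by blast
  have "x \<in> span D" for x
  proof -
    have "(\<Sum>b\<in>D. (x \<bullet> b) *\<^sub>R b) \<in> span D" by (intro span_sum span_scale span_base)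
    then show ?thesis by (simp add: coord_basis_sum[OF D])
  qed
  then show ?case using coord_basis_finite[OF D] by blast
next
  case 2
  have "\<exists>c\<in>prod_atlas A B. x \<in> fst c" for x
  proof -
    obtain U \<phi> where U: "(U, \<phi>) \<in> A" "fst x \<in> U" using chart_around[OF SA] .
    obtain V \<psi> where V: "(V, \<psi>) \<in> B" "snd x \<in> V" using chart_around[OF SB] .
    show ?thesis using U V by (intro bexI[of _ "(U \<times> V, map_prod \<phi> \<psi>)"]) (auto simp: prod_atlas_def mem_Times_iff)
  qed
  then show ?case by (force simp: case_prod_beta)
next
  case (3 c)
  then obtain U \<phi> V \<psi> where c: "c = (U \<times> V, map_prod \<phi> \<psi>)" "(U, \<phi>) \<in> A" "(V, \<psi>) \<in> B"
    by (auto simp: prod_atlas_def)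
  have im: "map_prod \<phi> \<psi> ` (U \<times> V) = \<phi> ` U \<times> \<psi> ` V" by force
  have "homeomorphism (U \<times> V) (\<phi> ` U \<times> \<psi> ` V) (map_prod \<phi> \<psi>) (map_prod (inv_into U \<phi>) (inv_into V \<psi>))"
  proof
    have f: "continuous_on (U \<times> V) (\<lambda>x. \<phi> (fst x))"
      by (rule continuous_on_compose2[OF chart_continuous[OF SA c(2)] continuous_on_fst[OF continuous_on_id]]) auto
    have s: "continuous_on (U \<times> V) (\<lambda>x. \<psi> (snd x))"
      by (rule continuous_on_compose2[OF chart_continuous[OF SB c(3)] continuous_on_snd[OF continuous_on_id]]) auto
    show "continuous_on (U \<times> V) (map_prod \<phi> \<psi>)"
      using continuous_on_Pair[OF f s] by (simp add: map_prod_def case_prod_beta)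
    have f': "continuous_on (\<phi> ` U \<times> \<psi> ` V) (\<lambda>x. inv_into U \<phi> (fst x))"
      by (rule continuous_on_compose2[OF chart_inverse_continuous[OF SA c(2)] continuous_on_fst[OF continuous_on_id]]) auto
    have s': "continuous_on (\<phi> ` U \<times> \<psi> ` V) (\<lambda>x. inv_into V \<psi> (snd x))"
      by (rule continuous_on_compose2[OF chart_inverse_continuous[OF SB c(3)] continuous_on_snd[OF continuous_on_id]]) auto
    show "continuous_on (\<phi> ` U \<times> \<psi> ` V) (map_prod (inv_into U \<phi>) (inv_into V \<psi>))"
      using continuous_on_Pair[OF f' s'] by (simp add: map_prod_def case_prod_beta)
  qed (auto simp: chart_inverse[OF SA c(2)] chart_inverse[OF SB c(3)])
  then show ?case
    unfolding c(1) prod.case im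
    using open_Times[OF chart_open[OF SA c(2)] chart_open[OF SB c(3)]]
      open_Times[OF chart_image_open[OF SA c(2)] chart_image_open[OF SB c(3)]] by blast
next
  case (4 c)
  then obtain U \<phi> V \<psi> where c: "c = (U \<times> V, map_prod \<phi> \<psi>)" "(U, \<phi>) \<in> A" "(V, \<psi>) \<in> B"
    by (auto simp: prod_atlas_def)
  have "smooth_on (map_prod \<phi> \<psi> ` (U \<times> V \<inter> U' \<times> V')) (map_prod \<phi>' \<psi>' \<circ> inv_into (U \<times> V) (map_prod \<phi> \<psi>))"
    if A': "(U', \<phi>') \<in> A" and B': "(V', \<psi>') \<in> B" for U' \<phi>' V' \<psi>'
  proof -
    have eq: "map_prod \<phi> \<psi> ` (U \<times> V \<inter> U' \<times> V') = \<phi> ` (U \<inter> U') \<times> \<psi> ` (V \<inter> V')" by force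
    have o: "open (\<phi> ` (U \<inter> U'))" "open (\<psi> ` (V \<inter> V'))"
      by (intro chart_subimage_open[OF SA c(2)] chart_subimage_open[OF SB c(3)] open_Int
          chart_open[OF SA c(2)] chart_open[OF SA A'] chart_open[OF SB c(3)] chart_open[OF SB B'] Int_lower1)+
    have "smooth_on (\<phi> ` (U \<inter> U') \<times> \<psi> ` (V \<inter> V'))
      (\<lambda>z. ((\<phi>' \<circ> inv_into U \<phi>) (fst z), (\<psi>' \<circ> inv_into V \<psi>) (snd z)))"
      by (intro smooth_on_Pair open_Times o smooth_on_fst_compose smooth_on_snd_compose
          chart_transition[OF SA c(2) A'] chart_transition[OF SB c(3) B'])
    then show ?thesis
      unfolding eq by (rule smooth_on_cong[OF open_Times[OF o], rotated]) (auto simp: inv_into_map_prod[OF c(2,3)])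
  qed
  then show ?case by (auto simp: prod_atlas_def c(1))
qed

end

lemma smooth_atlas_real: "smooth_atlas real_atlas"
proof -
  have "\<exists>B::real set. finite B \<and> span B = UNIV"
  proof (intro exI conjI equalityI subsetI UNIV_I)
    fix x :: real
    have "x *\<^sub>R 1 \<in> span {1::real}" by (intro span_scale span_base) simp
    then show "x \<in> span {1}" by simp
  qed simp
  moreover have "homeomorphism UNIV UNIV (id :: real \<Rightarrow> real) id" by (simp add: homeomorphism_def)
  moreover have "smooth_on UNIV (id :: real \<Rightarrow> real)" using smooth_on_id[OF open_UNIV] by (simp add: id_def)
  ultimately show ?thesis unfolding smooth_atlas_def real_atlas_def by auto
qed

subsection \<open>Smooth functions\<close>

text \<open>Because the transition maps are smooth, one chart around each point decides smoothness
  in all charts. The definition asks for every chart of the atlas and, separately, for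
  continuity.\<close>

lemma smooth_functions_localI:
  assumes SA: "smooth_atlas (A :: ('m::topological_space, 'e::real_inner) atlas)"
    and loc: "\<And>p. \<exists>U \<phi> W. (U, \<phi>) \<in> A \<and> open W \<and> p \<in> W \<and> W \<subseteq> U \<and> smooth_on (\<phi> ` W) (\<lambda>y. f (inv_into U \<phi> y))"
  shows "f \<in> \<C> A"
proof -
  have "\<exists>W. open W \<and> p \<in> W \<and> continuous_on W f" for p
  proof -
    obtain U \<phi> W where *: "(U, \<phi>) \<in> A" "open W" "p \<in> W" "W \<subseteq> U" "smooth_on (\<phi> ` W) (\<lambda>y. f (inv_into U \<phi> y))"
      using loc by meson
    have "continuous_on W (\<lambda>x. f (inv_into U \<phi> (\<phi> x)))"
      by (rule continuous_on_compose2[OF smooth_on_imp_continuous[OF *(5)]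
            continuous_on_subset[OF chart_continuous[OF SA *(1)] *(4)] order_refl])
    moreover have "inv_into U \<phi> (\<phi> x) = x" if "x \<in> W" for x
      using that chart_inverse[OF SA *(1)] *(4) by auto
    ultimately have "continuous_on W f" by (simp cong: continuous_on_cong)
    then show ?thesis using *(2,3) by blast
  qed
  then obtain N where N: "\<And>p. open (N p)" "\<And>p. p \<in> N p" "\<And>p. continuous_on (N p) f" by metis
  have "(\<Union>p. N p) = UNIV" using N(2) by blast
  then have cont: "continuous_on UNIV f"
    using continuous_on_open_UN[of UNIV N f] N(1,3) by simp
  obtain B :: "'e set" where B: "coord_basis B" using smooth_atlas_basis[OF SA] .
  have "smooth_on (\<phi>' ` U') (\<lambda>y. f (inv_into U' \<phi>' y))" if A': "(U', \<phi>') \<in> A" for U' \<phi>'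
  proof (rule smooth_on_local)
    fix y assume "y \<in> \<phi>' ` U'"
    then obtain p where p: "p \<in> U'" "y = \<phi>' p" by auto
    obtain U \<phi> W where *: "(U, \<phi>) \<in> A" "open W" "p \<in> W" "W \<subseteq> U" "smooth_on (\<phi> ` W) (\<lambda>y. f (inv_into U \<phi> y))"
      using loc by meson
    have "open (W \<inter> U')" using *(2) chart_open[OF SA A'] by blast
    then have oT: "open (\<phi>' ` (W \<inter> U'))" by (rule chart_subimage_open[OF SA A']) auto
    have oW: "open (\<phi> ` W)" using *(2,4) by (rule chart_subimage_open[OF SA *(1)])
    have 1: "smooth_on (\<phi>' ` (W \<inter> U')) (\<phi> \<circ> inv_into U' \<phi>')"
      by (rule smooth_on_subset[OF chart_transition[OF SA A' *(1)]]) (use *(4) in auto)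
    have "smooth_on (\<phi>' ` (W \<inter> U')) (\<lambda>y. f (inv_into U \<phi> ((\<phi> \<circ> inv_into U' \<phi>') y)))"
      by (rule smooth_on_compose[OF B oT oW _ 1 *(5)]) (auto simp: chart_inverse[OF SA A'])
    then have "smooth_on (\<phi>' ` (W \<inter> U')) (\<lambda>y. f (inv_into U' \<phi>' y))"
      by (rule smooth_on_cong[OF oT, rotated])
        (use *(4) in \<open>auto simp: chart_inverse[OF SA A'] chart_inverse[OF SA *(1)] subset_iff\<close>)
    then show "\<exists>T. y \<in> T \<and> open T \<and> smooth_on T (\<lambda>y. f (inv_into U' \<phi>' y))"
      using oT p *(3) by (intro exI[of _ "\<phi>' ` (W \<inter> U')"]) auto
  qed
  then show ?thesis using cont by (auto simp: smooth_functions_def smooth_map_def real_atlas_def comp_def)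
qed

lemma smooth_functions_chart:
  assumes "f \<in> \<C> A" "(U, \<phi>) \<in> A"
  shows "smooth_on (\<phi> ` U) (\<lambda>y. f (inv_into U \<phi> y))"
proof -
  have "(UNIV, id) \<in> real_atlas" by (simp add: real_atlas_def)
  from smooth_map_chart[OF _ assms(2) this, of f] show ?thesis
    using assms(1) by (simp add: smooth_functions_def comp_def)
qed

lemma smooth_functions_chartI:
  assumes SA: "smooth_atlas (A :: ('m::topological_space, 'e::real_inner) atlas)"
    and sm: "\<And>U \<phi>. (U, \<phi>) \<in> A \<Longrightarrow> smooth_on (\<phi> ` U) (\<lambda>y. f (inv_into U \<phi> y))"
  shows "f \<in> \<C> A"
proof (rule smooth_functions_localI[OF SA])
  fix p
  obtain U \<phi> where U: "(U, \<phi>) \<in> A" "p \<in> U" using chart_around[OF SA] .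
  then show "\<exists>U \<phi> W. (U, \<phi>) \<in> A \<and> open W \<and> p \<in> W \<and> W \<subseteq> U \<and> smooth_on (\<phi> ` W) (\<lambda>y. f (inv_into U \<phi> y))"
    using sm[OF U(1)] chart_open[OF SA U(1)] by blast
qed

lemma smooth_functions_comp:
  assumes "smooth_atlas (A :: ('m::topological_space, 'e::real_inner) atlas)"
    and "smooth_atlas (B :: ('n::topological_space, 'f::real_inner) atlas)"
    and "f \<in> \<C> B" "smooth_map A B F"
  shows "(\<lambda>x. f (F x)) \<in> \<C> A"
  unfolding smooth_functions_def mem_Collect_eq
  by (rule smooth_map_comp[OF assms(1,2) smooth_atlas_real assms(4)])
    (use assms(3) in \<open>simp add: smooth_functions_def\<close>)

lemma smooth_functions_const: "(\<lambda>x. c) \<in> \<C> A"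
  by (simp add: smooth_functions_def smooth_map_const)

context
  fixes A :: "('m::topological_space, 'e::real_inner) atlas"
  assumes SA: "smooth_atlas A"
begin

lemma smooth_functions_add:
  assumes "f \<in> \<C> A" "g \<in> \<C> A"
  shows "(\<lambda>x. f x + g x) \<in> \<C> A"
  by (intro smooth_functions_chartI[OF SA] smooth_on_add) (auto intro: chart_image_open[OF SA] smooth_functions_chart assms)

lemma smooth_functions_mult:
  assumes "f \<in> \<C> A" "g \<in> \<C> A"
  shows "(\<lambda>x. f x * g x) \<in> \<C> A"
  by (intro smooth_functions_chartI[OF SA] smooth_on_mult) (auto intro: chart_image_open[OF SA] smooth_functions_chart assms)

lemma smooth_functions_sum:
  assumes "\<And>i. i \<in> I \<Longrightarrow> f i \<in> \<C> A"
  shows "(\<lambda>x. \<Sum>i\<in>I. f i x) \<in> \<C> A"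
  by (intro smooth_functions_chartI[OF SA] smooth_on_sum) (auto intro: chart_image_open[OF SA] smooth_functions_chart assms)

lemma smooth_functions_cmult:
  assumes "f \<in> \<C> A"
  shows "(\<lambda>x. c * f x) \<in> \<C> A"
  by (rule smooth_functions_mult[OF smooth_functions_const assms])

lemma smooth_functions_diff:
  assumes "f \<in> \<C> A" "g \<in> \<C> A"
  shows "(\<lambda>x. f x - g x) \<in> \<C> A"
  using smooth_functions_add[OF assms(1) smooth_functions_cmult[OF assms(2), of "-1"]] by simp

end

section \<open>Tangent vectors\<close>

text \<open>\<open>W\<close> and the complement of \<open>K\<close> are open and cover the manifold;
  on the first smoothness is assumed, on the second the function is 0.\<close>

lemma smooth_functions_zero_extension:
  fixes A :: "('m::topological_space, 'e::real_inner) atlas"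
  assumes SA: "smooth_atlas A" and ch: "(U, \<phi>) \<in> A" and W: "open W" "W \<subseteq> U" and K: "closed K" "K \<subseteq> W"
    and f: "smooth_on (\<phi> ` W) (\<lambda>y. f (inv_into U \<phi> y))" and zero: "\<And>q. q \<notin> K \<Longrightarrow> f q = 0"
  shows "f \<in> \<C> A"
proof (rule smooth_functions_localI[OF SA])
  fix q
  show "\<exists>U \<phi> W. (U, \<phi>) \<in> A \<and> open W \<and> q \<in> W \<and> W \<subseteq> U \<and> smooth_on (\<phi> ` W) (\<lambda>y. f (inv_into U \<phi> y))"
  proof (cases "q \<in> W")
    case True
    then show ?thesis using ch W f by blast
  next
    case False
    obtain U' \<phi>' where ch': "(U', \<phi>') \<in> A" "q \<in> U'" using chart_around[OF SA] .
    have o: "open (U' \<inter> - K)" using K(1) chart_open[OF SA ch'(1)] by auto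
    then have o': "open (\<phi>' ` (U' \<inter> - K))" by (rule chart_subimage_open[OF SA ch'(1)]) auto
    have "smooth_on (\<phi>' ` (U' \<inter> - K)) (\<lambda>y. f (inv_into U' \<phi>' y))"
      by (rule smooth_on_cong[OF o' _ smooth_on_const[of _ 0]]) (auto simp: zero chart_inverse[OF SA ch'(1)])
    then show ?thesis using ch' o False K(2) by (intro exI[of _ U'] exI[of _ \<phi>'] exI[of _ "U' \<inter> - K"]) auto
  qed
qed

text \<open>The support lies in the preimage \<open>K\<close> of a closed ball of the chart.
  \<open>K\<close> is compact and hence closed in the manifold, because the space is Hausdorff;
  being closed inside the chart would not be enough for extension by zero.\<close>

lemma manifold_bump:
  fixes A :: "('m::t2_space, 'e::real_inner) atlas"
  assumes SA: "smooth_atlas A" and ch: "(U, \<phi>) \<in> A" and W: "open W" "p \<in> W" "W \<subseteq> U"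
  shows "\<exists>\<rho>\<in>\<C> A. \<exists>N K. open N \<and> p \<in> N \<and> N \<subseteq> K \<and> closed K \<and> K \<subseteq> W \<and>
    (\<forall>q\<in>N. \<rho> q = 1) \<and> (\<forall>q. q \<notin> K \<longrightarrow> \<rho> q = 0)"
proof -
  obtain B :: "'e set" where B: "coord_basis B" using smooth_atlas_basis[OF SA] .
  have inv: "inv_into U \<phi> (\<phi> x) = x" if "x \<in> W" for x
    using that chart_inverse[OF SA ch] W(3) by auto
  have oW: "open (\<phi> ` W)" by (rule chart_subimage_open[OF SA ch W(1,3)])
  then obtain r where r: "r > 0" "cball (\<phi> p) r \<subseteq> \<phi> ` W"
    using W(2) open_contains_cball by blast
  obtain \<beta> :: "'e \<Rightarrow> real" where \<beta>: "smooth_on UNIV \<beta>" "\<And>x. x \<in> ball (\<phi> p) (r / 2) \<Longrightarrow> \<beta> x = 1"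
    "\<And>x. x \<notin> ball (\<phi> p) r \<Longrightarrow> \<beta> x = 0"
    using bump_exists[OF B r(1)] by meson
  define \<rho> where "\<rho> = (\<lambda>q. if q \<in> W then \<beta> (\<phi> q) else 0)"
  define K where "K = inv_into U \<phi> ` cball (\<phi> p) r"
  define N where "N = W \<inter> \<phi> -` ball (\<phi> p) (r / 2)"
  have "compact K"
    unfolding K_def
    by (rule compact_continuous_image[OF continuous_on_subset[OF chart_inverse_continuous[OF SA ch]] coord_basis_compact_cball[OF B]])
      (use r(2) W(3) in blast)
  then have "closed K" by (rule compact_imp_closed)
  have KW: "K \<subseteq> W" using r(2) inv by (auto simp: K_def)
  have oN: "open N"
    unfolding N_def using continuous_on_subset[OF chart_continuous[OF SA ch] W(3)] W(1)
    by (intro continuous_open_preimage) auto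
  have NK: "N \<subseteq> K"
  proof
    fix q assume q: "q \<in> N"
    then have "q = inv_into U \<phi> (\<phi> q)" "\<phi> q \<in> cball (\<phi> p) r" using inv r(1) by (auto simp: N_def)
    then show "q \<in> K" unfolding K_def by blast
  qed
  have zero: "\<rho> q = 0" if "q \<notin> K" for q
  proof (cases "q \<in> W")
    case True
    have "\<phi> q \<notin> ball (\<phi> p) r"
    proof
      assume "\<phi> q \<in> ball (\<phi> p) r"
      then have "inv_into U \<phi> (\<phi> q) \<in> K" unfolding K_def by (intro imageI) auto
      then show False using inv[OF True] that by simp
    qed
    then show ?thesis using \<beta>(3) by (simp add: \<rho>_def)
  qed (simp add: \<rho>_def)
  have "smooth_on (\<phi> ` W) (\<lambda>y. \<rho> (inv_into U \<phi> y))"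
    by (rule smooth_on_cong[OF oW _ smooth_on_subset[OF \<beta>(1)]]) (auto simp: \<rho>_def inv)
  then have "\<rho> \<in> \<C> A"
    by (rule smooth_functions_zero_extension[OF SA ch W(1,3) \<open>closed K\<close> KW _ zero])
  moreover have "\<forall>q\<in>N. \<rho> q = 1" using \<beta>(2) by (auto simp: N_def \<rho>_def)
  moreover have "p \<in> N" using W(2) r(1) by (simp add: N_def)
  ultimately show ?thesis using oN NK \<open>closed K\<close> KW zero by blast
qed

text \<open>The function is multiplied by a bump function that equals 1 on \<open>N\<close>. The
  neighbourhood is chosen before \<open>g\<close>, so that several local functions can be extended
  with a common \<open>N\<close>.\<close>

lemma smooth_extension:
  fixes A :: "('m::t2_space, 'e::real_inner) atlas"
  assumes SA: "smooth_atlas A" and ch: "(U, \<phi>) \<in> A" and W: "open W" "p \<in> W" "W \<subseteq> U"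
  shows "\<exists>N. open N \<and> p \<in> N \<and> N \<subseteq> W \<and>
    (\<forall>g. smooth_on (\<phi> ` W) (\<lambda>y. g (inv_into U \<phi> y)) \<longrightarrow> (\<exists>f\<in>\<C> A. \<forall>q\<in>N. f q = g q))"
proof -
  obtain \<rho> N K where \<rho>: "\<rho> \<in> \<C> A" "open N" "p \<in> N" "N \<subseteq> K" "closed K" "K \<subseteq> W"
    "\<And>q. q \<in> N \<Longrightarrow> \<rho> q = 1" "\<And>q. q \<notin> K \<Longrightarrow> \<rho> q = 0"
    using manifold_bump[OF SA ch W] by metis
  have oW: "open (\<phi> ` W)" by (rule chart_subimage_open[OF SA ch W(1,3)])
  have "\<exists>f\<in>\<C> A. \<forall>q\<in>N. f q = g q" if g: "smooth_on (\<phi> ` W) (\<lambda>y. g (inv_into U \<phi> y))" for g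
  proof
    define f where "f = (\<lambda>q. \<rho> q * g q)"
    show "\<forall>q\<in>N. f q = g q" using \<rho> by (simp add: f_def)
    have "smooth_on (\<phi> ` W) (\<lambda>y. f (inv_into U \<phi> y))"
      unfolding f_def using W(3)
      by (intro smooth_on_mult[OF oW] g smooth_on_subset[OF smooth_functions_chart[OF \<rho>(1) ch]]) auto
    then show "f \<in> \<C> A"
      by (rule smooth_functions_zero_extension[OF SA ch W(1,3) \<rho>(5,6)]) (simp add: f_def \<rho>(8))
  qed
  then show ?thesis using \<rho>(2-4,6) by blast
qed

lemma tangent_nonsmooth: "v \<in> \<T> A p \<Longrightarrow> f \<notin> \<C> A \<Longrightarrow> v f = 0"
  by (simp add: tangent_space_def)

lemma tangent_add:
  "v \<in> \<T> A p \<Longrightarrow> f \<in> \<C> A \<Longrightarrow> g \<in> \<C> A \<Longrightarrow>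
    v (\<lambda>x. f x + g x) = v f + v g"
  unfolding tangent_space_def plus_fun_def by blast

lemma tangent_cmult:
  "v \<in> \<T> A p \<Longrightarrow> f \<in> \<C> A \<Longrightarrow> v (\<lambda>x. c * f x) = c * v f"
  unfolding tangent_space_def scaleR_fun_def real_scaleR_def by blast

lemma tangent_mult:
  "v \<in> \<T> A p \<Longrightarrow> f \<in> \<C> A \<Longrightarrow> g \<in> \<C> A \<Longrightarrow>
    v (\<lambda>x. f x * g x) = f p * v g + g p * v f"
  unfolding tangent_space_def times_fun_def by blast

lemma tangent_eqI:
  assumes "u \<in> \<T> A p" "v \<in> \<T> A p" "\<And>f. f \<in> \<C> A \<Longrightarrow> u f = v f"
  shows "u = v"
  using assms(3) tangent_nonsmooth[OF assms(1)] tangent_nonsmooth[OF assms(2)] by (intro ext) metis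

lemma tangent_spaceI:
  assumes "\<And>f. f \<notin> \<C> A \<Longrightarrow> v f = 0"
    "\<And>f g. f \<in> \<C> A \<Longrightarrow> g \<in> \<C> A \<Longrightarrow> v (\<lambda>x. f x + g x) = v f + v g"
    "\<And>c f. f \<in> \<C> A \<Longrightarrow> v (\<lambda>x. c * f x) = c * v f"
    "\<And>f g. f \<in> \<C> A \<Longrightarrow> g \<in> \<C> A \<Longrightarrow> v (\<lambda>x. f x * g x) = f p * v g + g p * v f"
  shows "v \<in> \<T> A p"
  using assms unfolding tangent_space_def plus_fun_def times_fun_def scaleR_fun_def real_scaleR_def by blast

context
  fixes A :: "('m::topological_space, 'e::real_inner) atlas"
  assumes SA: "smooth_atlas A"
begin

lemma tangent_const: "v \<in> \<T> A p \<Longrightarrow> v (\<lambda>x. c) = 0"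
proof -
  assume v: "v \<in> \<T> A p"
  have "v (\<lambda>x. 1 * 1) = 1 * v (\<lambda>x. 1) + 1 * v (\<lambda>x. 1)"
    by (rule tangent_mult[OF v smooth_functions_const smooth_functions_const])
  then have "v (\<lambda>x. 1) = 0" by simp
  then show ?thesis using tangent_cmult[OF v smooth_functions_const[of 1], of c] by simp
qed

lemma tangent_sum:
  assumes v: "v \<in> \<T> A p" and "\<And>i. i \<in> I \<Longrightarrow> f i \<in> \<C> A"
  shows "v (\<lambda>x. \<Sum>i\<in>I. f i x) = (\<Sum>i\<in>I. v (f i))"
  using assms(2)
  by (induction I rule: infinite_finite_induct)
    (simp_all add: tangent_const[OF v] tangent_add[OF v] smooth_functions_sum[OF SA])

lemma tangent_diff:
  assumes v: "v \<in> \<T> A p" and f: "f \<in> \<C> A" and g: "g \<in> \<C> A"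
  shows "v (\<lambda>x. f x - g x) = v f - v g"
  using tangent_add[OF v f smooth_functions_cmult[OF SA g, of "-1"]] tangent_cmult[OF v g, of "-1"] by simp

lemma tangent_space_zero: "0 \<in> \<T> A p"
  by (rule tangent_spaceI) simp_all

lemma tangent_space_add: "u \<in> \<T> A p \<Longrightarrow> v \<in> \<T> A p \<Longrightarrow> u + v \<in> \<T> A p"
  by (rule tangent_spaceI)
    (simp_all add: tangent_nonsmooth tangent_add tangent_cmult tangent_mult algebra_simps)

lemma tangent_space_scale: "u \<in> \<T> A p \<Longrightarrow> c *\<^sub>R u \<in> \<T> A p"
  by (rule tangent_spaceI)
    (simp_all add: scaleR_fun_def tangent_nonsmooth tangent_add tangent_cmult tangent_mult algebra_simps)

lemma subspace_tangent_space: "subspace (\<T> A p)"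
  by (simp add: subspace_def tangent_space_zero tangent_space_add tangent_space_scale)

end

text \<open>For a bump function \<rho> supported where \<open>f = g\<close>, the product of
  \<open>f - g\<close> and \<rho> is 0. The product rule then gives \<open>v (f - g) = 0\<close>,
  since \<open>\<rho> p = 1\<close> and \<open>f p = g p\<close>.\<close>

lemma tangent_local:
  fixes A :: "('m::t2_space, 'e::real_inner) atlas"
  assumes SA: "smooth_atlas A" and v: "v \<in> \<T> A p"
    and f: "f \<in> \<C> A" and g: "g \<in> \<C> A"
    and N: "open N" "p \<in> N" "\<And>q. q \<in> N \<Longrightarrow> f q = g q"
  shows "v f = v g"
proof -
  obtain U \<phi> where ch: "(U, \<phi>) \<in> A" "p \<in> U" using chart_around[OF SA] .
  obtain \<rho> N' K where \<rho>: "\<rho> \<in> \<C> A" "p \<in> N'" "N' \<subseteq> K" "K \<subseteq> U \<inter> N"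
    "\<And>q. q \<in> N' \<Longrightarrow> \<rho> q = 1" "\<And>q. q \<notin> K \<Longrightarrow> \<rho> q = 0"
    using manifold_bump[OF SA ch(1), of "U \<inter> N" p] N(1,2) ch chart_open[OF SA ch(1)] by (metis IntI Int_lower1 open_Int)
  have d: "(\<lambda>x. f x - g x) \<in> \<C> A" by (rule smooth_functions_diff[OF SA f g])
  have "(f q - g q) * \<rho> q = 0" for q using \<rho>(4,6) N(3) by (cases "q \<in> K") auto
  then have "(\<lambda>x. (f x - g x) * \<rho> x) = (\<lambda>x. 0)" by (rule ext)
  then have "v (\<lambda>x. (f x - g x) * \<rho> x) = 0" using tangent_const[OF SA v] by simp
  moreover have "\<rho> p = 1" using \<rho>(2,5) by simp
  ultimately have "v (\<lambda>x. f x - g x) = 0" using tangent_mult[OF v d \<rho>(1)] N(2,3) by simp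
  then show ?thesis using tangent_diff[OF SA v f g] by simp
qed

definition chart_deriv :: "'m set \<Rightarrow> ('m \<Rightarrow> 'e::real_normed_vector) \<Rightarrow> 'm \<Rightarrow> ('m \<Rightarrow> real) \<Rightarrow> 'e \<Rightarrow> real" where
  "chart_deriv U \<phi> q f b = \<D> (\<lambda>y. f (inv_into U \<phi> y)) (\<phi> q) b"

lemma chart_has_derivative:
  "f \<in> \<C> A \<Longrightarrow> (U, \<phi>) \<in> A \<Longrightarrow> q \<in> U \<Longrightarrow>
    ((\<lambda>y. f (inv_into U \<phi> y)) has_derivative chart_deriv U \<phi> q f) (at (\<phi> q))"
  unfolding chart_deriv_def[abs_def]
  by (rule smooth_on_has_derivative[OF smooth_functions_chart]) auto

definition chart_vector ::
  "('m::topological_space, 'e::real_normed_vector) atlas \<Rightarrow> 'm set \<Rightarrow> ('m \<Rightarrow> 'e) \<Rightarrow> 'm \<Rightarrow> 'e \<Rightarrow> 'm tangent" where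
  "chart_vector A U \<phi> q b = (\<lambda>f. if f \<in> \<C> A then chart_deriv U \<phi> q f b else 0)"

lemma chart_vector_tangent:
  fixes A :: "('m::topological_space, 'e::real_inner) atlas"
  assumes SA: "smooth_atlas A" and ch: "(U, \<phi>) \<in> A" and q: "q \<in> U"
  shows "chart_vector A U \<phi> q b \<in> \<T> A q"
proof (rule tangent_spaceI)
  show "chart_vector A U \<phi> q b f = 0" if "f \<notin> \<C> A" for f
    using that by (simp add: chart_vector_def)
next
  fix f g assume f: "f \<in> \<C> A" and g: "g \<in> \<C> A"
  note df = chart_has_derivative[OF f ch q] and dg = chart_has_derivative[OF g ch q]
  have "chart_deriv U \<phi> q (\<lambda>x. f x + g x) = (\<lambda>b. chart_deriv U \<phi> q f b + chart_deriv U \<phi> q g b)"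
    by (rule has_derivative_unique[OF chart_has_derivative[OF smooth_functions_add[OF SA f g] ch q]
          has_derivative_add[OF df dg]])
  then show "chart_vector A U \<phi> q b (\<lambda>x. f x + g x) = chart_vector A U \<phi> q b f + chart_vector A U \<phi> q b g"
    using f g smooth_functions_add[OF SA f g] by (simp add: chart_vector_def)
  have "chart_deriv U \<phi> q (\<lambda>x. f x * g x) = (\<lambda>b. f q * chart_deriv U \<phi> q g b + chart_deriv U \<phi> q f b * g q)"
    using has_derivative_unique[OF chart_has_derivative[OF smooth_functions_mult[OF SA f g] ch q]
        has_derivative_mult[OF df dg]] by (simp add: chart_inverse[OF SA ch q])
  then show "chart_vector A U \<phi> q b (\<lambda>x. f x * g x) =
      f q * chart_vector A U \<phi> q b g + g q * chart_vector A U \<phi> q b f"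
    using f g smooth_functions_mult[OF SA f g] by (simp add: chart_vector_def)
next
  fix c f assume f: "f \<in> \<C> A"
  have "chart_deriv U \<phi> q (\<lambda>x. c * f x) = (\<lambda>b. c * chart_deriv U \<phi> q f b)"
    by (rule has_derivative_unique[OF chart_has_derivative[OF smooth_functions_cmult[OF SA f] ch q]
          has_derivative_mult_right[OF chart_has_derivative[OF f ch q]]])
  then show "chart_vector A U \<phi> q b (\<lambda>x. c * f x) = c * chart_vector A U \<phi> q b f"
    using f smooth_functions_cmult[OF SA f] by (simp add: chart_vector_def)
qed

text \<open>The global functions \<open>x b\<close> stand in for the coordinates
  \<open>\<phi> y \<bullet> b\<close>, which make sense in the chart only. They are given from
  outside so that the same functions serve for all points \<open>q\<close> of \<open>N\<close>, as
  smooth families of tangent vectors require.\<close>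

lemma tangent_coordinates:
  fixes A :: "('m::t2_space, 'e::real_inner) atlas"
  assumes SA: "smooth_atlas A" and ch: "(U, \<phi>) \<in> A" and B: "coord_basis B"
    and v: "v \<in> \<T> A q" and f: "f \<in> \<C> A"
    and x: "\<And>b. b \<in> B \<Longrightarrow> x b \<in> \<C> A" "open N" "q \<in> N" "N \<subseteq> U"
      "\<And>b y. b \<in> B \<Longrightarrow> y \<in> N \<Longrightarrow> x b y = \<phi> y \<bullet> b"
  shows "v f = (\<Sum>b\<in>B. v (x b) * chart_deriv U \<phi> q f b)"
proof -
  have oN: "open (\<phi> ` N)" by (rule chart_subimage_open[OF SA ch x(2,4)])
  then obtain r where r: "r > 0" "ball (\<phi> q) r \<subseteq> \<phi> ` N" using x(3) open_contains_ball by blast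
  \<comment> \<open>A ball, because Hadamard's lemma integrates along segments; it lies in the image
    of \<open>N\<close>, where \<open>x b\<close> is the coordinate.\<close>
  define S where "S = ball (\<phi> q) r"
  define W where "W = N \<inter> \<phi> -` S"
  have inv: "inv_into U \<phi> (\<phi> y) = y" if "y \<in> N" for y
    using that chart_inverse[OF SA ch] x(4) by auto
  have S: "open S" "convex S" "\<phi> q \<in> S" using r by (auto simp: S_def)
  have SW: "\<phi> ` W = S" using r(2) by (auto simp: W_def S_def)
  have W: "open W" "q \<in> W" "W \<subseteq> U"
    using continuous_open_preimage[OF continuous_on_subset[OF chart_continuous[OF SA ch] x(4)] x(2) S(1)] x(3,4) S(3)
    by (auto simp: W_def)
  have "smooth_on S (\<lambda>y. f (inv_into U \<phi> y))"
    by (rule smooth_on_subset[OF smooth_functions_chart[OF f ch]]) (use SW W(3) in blast)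
  \<comment> \<open>With the \<open>g b\<close> extended to global functions \<open>h b\<close>, Hadamard's lemma gives
    \<open>f y = f q + (\<Sum>b\<in>B. (x b y - x b q) * h b y)\<close> near \<open>q\<close>, to which the Leibniz rule applies.\<close>
  from hadamard[OF B S this] obtain g where g: "\<And>b. b \<in> B \<Longrightarrow> smooth_on S (g b)"
    "\<And>b. b \<in> B \<Longrightarrow> g b (\<phi> q) = chart_deriv U \<phi> q f b"
    "\<And>y. y \<in> S \<Longrightarrow> f (inv_into U \<phi> y) = f (inv_into U \<phi> (\<phi> q)) + (\<Sum>b\<in>B. ((y - \<phi> q) \<bullet> b) * g b y)"
    unfolding chart_deriv_def by blast
  obtain N' where N': "open N'" "q \<in> N'" "N' \<subseteq> W"
    "\<And>h. smooth_on (\<phi> ` W) (\<lambda>y. h (inv_into U \<phi> y)) \<Longrightarrow> \<exists>f\<in>\<C> A. \<forall>q\<in>N'. f q = h q"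
    using smooth_extension[OF SA ch W] by blast
  have "\<exists>h\<in>\<C> A. \<forall>y\<in>N'. h y = g b (\<phi> y)" if b: "b \<in> B" for b
  proof (rule N'(4))
    show "smooth_on (\<phi> ` W) (\<lambda>y. g b (\<phi> (inv_into U \<phi> y)))"
      unfolding SW
    proof (rule smooth_on_cong[OF S(1) _ g(1)[OF b]])
      fix y assume "y \<in> S"
      then obtain z where "z \<in> W" "y = \<phi> z" using SW by blast
      then show "g b y = g b (\<phi> (inv_into U \<phi> y))" using inv by (simp add: W_def)
    qed
  qed
  then obtain h where h: "\<And>b. b \<in> B \<Longrightarrow> h b \<in> \<C> A"
    "\<And>b y. b \<in> B \<Longrightarrow> y \<in> N' \<Longrightarrow> h b y = g b (\<phi> y)" by metis
  let ?F = "\<lambda>y. f q + (\<Sum>b\<in>B. (x b y - x b q) * h b y)"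
  have sm: "(\<lambda>y. (x b y - x b q) * h b y) \<in> \<C> A" if "b \<in> B" for b
    by (intro smooth_functions_mult[OF SA] smooth_functions_diff[OF SA] smooth_functions_const x h that)
  have F: "?F \<in> \<C> A"
    by (intro smooth_functions_add[OF SA] smooth_functions_const smooth_functions_sum[OF SA] sm)
  have "f y = ?F y" if y: "y \<in> N'" for y
  proof -
    have "y \<in> N" "\<phi> y \<in> S" using N'(3) y by (auto simp: W_def)
    then have "f y = f q + (\<Sum>b\<in>B. ((\<phi> y - \<phi> q) \<bullet> b) * g b (\<phi> y))"
      using g(3)[of "\<phi> y"] inv x(3) by simp
    also have "(\<Sum>b\<in>B. ((\<phi> y - \<phi> q) \<bullet> b) * g b (\<phi> y)) = (\<Sum>b\<in>B. (x b y - x b q) * h b y)"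
      using \<open>y \<in> N\<close> x(3,5) h(2) y by (intro sum.cong) (auto simp: inner_diff_left)
    finally show ?thesis .
  qed
  from tangent_local[OF SA v f F N'(1,2) this] have "v f = v ?F" .
  also have "\<dots> = v (\<lambda>y. f q) + v (\<lambda>y. \<Sum>b\<in>B. (x b y - x b q) * h b y)"
    by (rule tangent_add[OF v smooth_functions_const smooth_functions_sum[OF SA sm]])
  also have "\<dots> = (\<Sum>b\<in>B. v (\<lambda>y. (x b y - x b q) * h b y))"
    by (simp add: tangent_const[OF SA v] tangent_sum[OF SA v sm])
  also have "\<dots> = (\<Sum>b\<in>B. v (x b) * chart_deriv U \<phi> q f b)"
  proof (rule sum.cong[OF refl])
    fix b assume b: "b \<in> B"
    have "v (\<lambda>y. (x b y - x b q) * h b y) = h b q * v (\<lambda>y. x b y - x b q)"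
      using tangent_mult[OF v smooth_functions_diff[OF SA x(1)[OF b] smooth_functions_const] h(1)[OF b]] by simp
    also have "v (\<lambda>y. x b y - x b q) = v (x b)"
      using tangent_diff[OF SA v x(1)[OF b] smooth_functions_const] tangent_const[OF SA v] by simp
    finally show "v (\<lambda>y. (x b y - x b q) * h b y) = v (x b) * chart_deriv U \<phi> q f b"
      using h(2)[OF b N'(2)] g(2)[OF b] by simp
  qed
  finally show ?thesis .
qed

lemma coordinate_functions:
  fixes A :: "('m::t2_space, 'e::real_inner) atlas"
  assumes SA: "smooth_atlas A" and ch: "(U, \<phi>) \<in> A" and p: "p \<in> U"
  shows "\<exists>x N. open N \<and> p \<in> N \<and> N \<subseteq> U \<and> (\<forall>b. x b \<in> \<C> A) \<and> (\<forall>b. \<forall>y\<in>N. x b y = \<phi> y \<bullet> b)"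
proof -
  obtain N where N: "open N" "p \<in> N" "N \<subseteq> U"
    "\<And>h. smooth_on (\<phi> ` U) (\<lambda>y. h (inv_into U \<phi> y)) \<Longrightarrow> \<exists>f\<in>\<C> A. \<forall>q\<in>N. f q = h q"
    using smooth_extension[OF SA ch chart_open[OF SA ch] p order_refl] by blast
  have o: "open (\<phi> ` U)" by (rule chart_image_open[OF SA ch])
  have "\<exists>f\<in>\<C> A. \<forall>q\<in>N. f q = \<phi> q \<bullet> b" for b
  proof (rule N(4))
    show "smooth_on (\<phi> ` U) (\<lambda>y. \<phi> (inv_into U \<phi> y) \<bullet> b)"
      by (rule smooth_on_cong[OF o _ smooth_on_bounded_linear[OF bounded_linear_inner_left o smooth_on_id[OF o]]])
        (auto simp: chart_inverse[OF SA ch])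
  qed
  then obtain x where "\<And>b. x b \<in> \<C> A" "\<And>b y. y \<in> N \<Longrightarrow> x b y = \<phi> y \<bullet> b" by metis
  then show ?thesis using N(1-3) by blast
qed

text \<open>By linearity of the derivative, the coordinate formula is the derivative in the
  direction \<xi> with the components \<open>v (x b)\<close>. This lets statements about tangent
  vectors be proved by ordinary calculus in a chart.\<close>

lemma tangent_chart_deriv:
  fixes A :: "('m::t2_space, 'e::real_inner) atlas"
  assumes SA: "smooth_atlas A" and ch: "(U, \<phi>) \<in> A" "p \<in> U" and v: "v \<in> \<T> A p"
  shows "\<exists>\<xi>. \<forall>f\<in>\<C> A. v f = chart_deriv U \<phi> p f \<xi>"
proof -
  obtain B :: "'e set" where B: "coord_basis B" using smooth_atlas_basis[OF SA] .
  obtain x N where x: "open N" "p \<in> N" "N \<subseteq> U" "\<And>b. x b \<in> \<C> A" "\<And>b y. y \<in> N \<Longrightarrow> x b y = \<phi> y \<bullet> b"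
    using coordinate_functions[OF SA ch] by blast
  have "v f = chart_deriv U \<phi> p f (\<Sum>b\<in>B. v (x b) *\<^sub>R b)" if f: "f \<in> \<C> A" for f
    using tangent_coordinates[OF SA ch(1) B v f x(4,1-3,5)]
      has_derivative_linear[OF chart_has_derivative[OF f ch]]
    by (simp add: linear_sum linear_scale)
  then show ?thesis by blast
qed

text \<open>The coefficients are values of \<open>v\<close> on fixed smooth functions; this form is
  what makes the coefficients of a vector field smooth later. The vectors \<open>c b\<close> may be
  linearly dependent.\<close>

lemma tangent_frame:
  fixes A :: "('m::t2_space, 'e::real_inner) atlas"
  assumes SA: "smooth_atlas A"
  shows "\<exists>B c x. finite (B::'e set) \<and> (\<forall>b. c b \<in> \<T> A p) \<and> (\<forall>b. x b \<in> \<C> A) \<and>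
    (\<forall>v\<in>\<T> A p. v = (\<Sum>b\<in>B. v (x b) *\<^sub>R c b))"
proof -
  obtain B :: "'e set" where B: "coord_basis B" using smooth_atlas_basis[OF SA] .
  obtain U \<phi> where ch: "(U, \<phi>) \<in> A" "p \<in> U" using chart_around[OF SA] .
  obtain x N where x: "open N" "p \<in> N" "N \<subseteq> U" "\<And>b. x b \<in> \<C> A" "\<And>b y. y \<in> N \<Longrightarrow> x b y = \<phi> y \<bullet> b"
    using coordinate_functions[OF SA ch] by blast
  have "v = (\<Sum>b\<in>B. v (x b) *\<^sub>R chart_vector A U \<phi> p b)" if v: "v \<in> \<T> A p" for v
  proof
    fix f
    have ev: "(\<Sum>b\<in>I. u b *\<^sub>R chart_vector A U \<phi> p b) f = (\<Sum>b\<in>I. u b * chart_vector A U \<phi> p b f)" for I u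
      by (induction I rule: infinite_finite_induct) (simp_all add: scaleR_fun_def)
    show "v f = (\<Sum>b\<in>B. v (x b) *\<^sub>R chart_vector A U \<phi> p b) f"
      using tangent_coordinates[OF SA ch(1) B v _ x(4,1-3,5), of f] tangent_nonsmooth[OF v, of f]
      unfolding ev by (cases "f \<in> \<C> A") (simp_all add: chart_vector_def)
  qed
  then show ?thesis using coord_basis_finite[OF B] chart_vector_tangent[OF SA ch] x(4) by blast
qed

lemma tangent_space_finite_dim:
  fixes A :: "('m::t2_space, 'e::real_inner) atlas"
  assumes SA: "smooth_atlas A"
  shows "\<exists>B. finite B \<and> span B = \<T> A p"
proof -
  obtain B :: "'e set" and c x where *: "finite B" "\<And>b. c b \<in> \<T> A p"
    "\<And>v. v \<in> \<T> A p \<Longrightarrow> v = (\<Sum>b\<in>B. v (x b) *\<^sub>R c b)"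
    using tangent_frame[OF SA, of p] by blast
  have "v \<in> span (c ` B)" if "v \<in> \<T> A p" for v
  proof -
    have "(\<Sum>b\<in>B. v (x b) *\<^sub>R c b) \<in> span (c ` B)" by (intro span_sum span_scale span_base imageI)
    then show ?thesis using *(3)[OF that] by simp
  qed
  moreover have "span (c ` B) \<subseteq> \<T> A p"
    by (rule span_minimal) (use *(2) subspace_tangent_space[OF SA] in auto)
  ultimately have "span (c ` B) = \<T> A p" by blast
  then show ?thesis using *(1) by blast
qed

section \<open>Partial derivatives on products and smooth families of tangent vectors\<close>

lemma has_derivative_partial_snd:
  "smooth_on S \<Phi> \<Longrightarrow> (y, z) \<in> S \<Longrightarrow>
    ((\<lambda>z. \<Phi> (y, z)) has_derivative (\<lambda>b. \<D> \<Phi> (y, z) (0, b))) (at z)"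
  by (rule has_derivative_compose[OF has_derivative_Pair[OF has_derivative_const has_derivative_ident]
        smooth_on_has_derivative])

lemma has_derivative_partial_fst:
  "smooth_on S \<Phi> \<Longrightarrow> (y, z) \<in> S \<Longrightarrow>
    ((\<lambda>y. \<Phi> (y, z)) has_derivative (\<lambda>b. \<D> \<Phi> (y, z) (b, 0))) (at y)"
  by (rule has_derivative_compose[OF has_derivative_Pair[OF has_derivative_ident has_derivative_const]
        smooth_on_has_derivative])

context
  fixes A :: "('m::topological_space, 'e::real_inner) atlas" and B :: "('n::topological_space, 'f::real_inner) atlas"
  assumes SA: "smooth_atlas A" and SB: "smooth_atlas B"
begin

lemma smooth_functions_partial_snd: "F \<in> \<C> (prod_atlas A B) \<Longrightarrow> (\<lambda>x. F (p, x)) \<in> \<C> B"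
  by (rule smooth_functions_comp[OF SB smooth_atlas_prod[OF SA SB] _
        smooth_map_Pair[OF smooth_map_const smooth_map_id[OF SB] SB SA SB]])

lemma smooth_functions_partial_fst: "F \<in> \<C> (prod_atlas A B) \<Longrightarrow> (\<lambda>x. F (x, q)) \<in> \<C> A"
  by (rule smooth_functions_comp[OF SA smooth_atlas_prod[OF SA SB] _
        smooth_map_Pair[OF smooth_map_id[OF SA] smooth_map_const SA SA SB]])

lemma smooth_functions_swap:
  "F \<in> \<C> (prod_atlas A B) \<Longrightarrow> (\<lambda>z. F (snd z, fst z)) \<in> \<C> (prod_atlas B A)"
  by (rule smooth_functions_comp[OF smooth_atlas_prod[OF SB SA] smooth_atlas_prod[OF SA SB] _
        smooth_map_Pair[OF smooth_map_snd[OF SB SA] smooth_map_fst[OF SB SA] smooth_atlas_prod[OF SB SA] SA SB]])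

context
  fixes F U \<phi> V \<psi>
  assumes F: "F \<in> \<C> (prod_atlas A B)" and ch: "(U, \<phi>) \<in> A" "(V, \<psi>) \<in> B"
begin

lemma smooth_functions_prod_chart:
  "smooth_on (\<phi> ` U \<times> \<psi> ` V) (\<lambda>z. F (inv_into U \<phi> (fst z), inv_into V \<psi> (snd z)))"
proof -
  have "(U \<times> V, map_prod \<phi> \<psi>) \<in> prod_atlas A B" using ch by (auto simp: prod_atlas_def)
  from smooth_functions_chart[OF F this]
  have "smooth_on (map_prod \<phi> \<psi> ` (U \<times> V)) (\<lambda>y. F (inv_into (U \<times> V) (map_prod \<phi> \<psi>) y))" .
  moreover have "map_prod \<phi> \<psi> ` (U \<times> V) = \<phi> ` U \<times> \<psi> ` V" by force
  ultimately have *: "smooth_on (\<phi> ` U \<times> \<psi> ` V) (\<lambda>y. F (inv_into (U \<times> V) (map_prod \<phi> \<psi>) y))" by simp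
  show ?thesis
    by (rule smooth_on_cong[OF open_Times[OF chart_image_open[OF SA ch(1)] chart_image_open[OF SB ch(2)]] _ *])
      (auto simp: inv_into_map_prod[OF SA SB ch])
qed

abbreviation "local_rep \<equiv> (\<lambda>z. F (inv_into U \<phi> (fst z), inv_into V \<psi> (snd z)))"

lemma chart_deriv_partial_snd:
  assumes "p \<in> U" "q \<in> V"
  shows "chart_deriv V \<psi> q (\<lambda>x. F (p, x)) b = \<D> local_rep (\<phi> p, \<psi> q) (0, b)"
proof -
  have "((\<lambda>y. F (p, inv_into V \<psi> y)) has_derivative (\<lambda>b. \<D> local_rep (\<phi> p, \<psi> q) (0, b))) (at (\<psi> q))"
    using has_derivative_partial_snd[OF smooth_functions_prod_chart, of "\<phi> p" "\<psi> q"] assms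
    by (simp add: chart_inverse[OF SA ch(1)])
  from fun_cong[OF frechet_derivative_at[OF this], of b] show ?thesis by (simp add: chart_deriv_def)
qed

lemma chart_deriv_partial_fst:
  assumes "p \<in> U" "q \<in> V"
  shows "chart_deriv U \<phi> p (\<lambda>x. F (x, q)) b = \<D> local_rep (\<phi> p, \<psi> q) (b, 0)"
proof -
  have "((\<lambda>y. F (inv_into U \<phi> y, q)) has_derivative (\<lambda>b. \<D> local_rep (\<phi> p, \<psi> q) (b, 0))) (at (\<phi> p))"
    using has_derivative_partial_fst[OF smooth_functions_prod_chart, of "\<phi> p" "\<psi> q"] assms
    by (simp add: chart_inverse[OF SB ch(2)])
  from fun_cong[OF frechet_derivative_at[OF this], of b] show ?thesis by (simp add: chart_deriv_def)
qed

end

end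

text \<open>In charts the value at \<open>p\<close> is the sum over \<open>b\<close> of
  \<open>Y p (x b)\<close> times a partial derivative of the representative of \<open>F\<close> at
  \<open>(p, h p)\<close>, and both factors are smooth in \<open>p\<close>. The footpoint map
  \<open>h\<close> covers a single tangent vector (\<open>h\<close> constant) as well as a vector
  field (\<open>h\<close> the identity).\<close>

lemma smooth_tangent_family:
  fixes A :: "('m::topological_space, 'e::real_inner) atlas" and B :: "('n::t2_space, 'f::real_inner) atlas"
  assumes SA: "smooth_atlas A" and SB: "smooth_atlas B" and h: "smooth_map A B h"
    and Y: "\<And>p. Y p \<in> \<T> B (h p)" "\<And>f. f \<in> \<C> B \<Longrightarrow> (\<lambda>p. Y p f) \<in> \<C> A"
    and F: "F \<in> \<C> (prod_atlas A B)"
  shows "(\<lambda>p. Y p (\<lambda>x. F (p, x))) \<in> \<C> A"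
proof (rule smooth_functions_localI[OF SA])
  fix p0
  obtain U \<phi> where chA: "(U, \<phi>) \<in> A" "p0 \<in> U" using chart_around[OF SA] .
  obtain V \<psi> where chB: "(V, \<psi>) \<in> B" "h p0 \<in> V" using chart_around[OF SB] .
  obtain BA :: "'e set" where BA: "coord_basis BA" using smooth_atlas_basis[OF SA] .
  obtain BB :: "'f set" where BB: "coord_basis BB" using smooth_atlas_basis[OF SB] .
  obtain BP :: "('e \<times> 'f) set" where BP: "coord_basis BP" using coord_basis_prod[OF BA BB] by blast
  obtain x N where x: "open N" "h p0 \<in> N" "N \<subseteq> V" "\<And>b. x b \<in> \<C> B"
    "\<And>b y. y \<in> N \<Longrightarrow> x b y = \<psi> y \<bullet> b"
    using coordinate_functions[OF SB chB] by blast
  define \<Phi> where "\<Phi> = (\<lambda>z. F (inv_into U \<phi> (fst z), inv_into V \<psi> (snd z)))"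
  have \<Phi>: "smooth_on (\<phi> ` U \<times> \<psi> ` V) \<Phi>"
    unfolding \<Phi>_def by (rule smooth_functions_prod_chart[OF SA SB F chA(1) chB(1)])
  define W where "W = U \<inter> h -` N"
  have W: "open W" "p0 \<in> W" "W \<subseteq> U" "h ` W \<subseteq> N"
    using chart_open[OF SA chA(1)] smooth_map_open_vimage[OF h x(1)] chA(2) x(2) by (auto simp: W_def)
  have hV: "h p \<in> V" if "p \<in> W" for p using that W(4) x(3) by auto
  have oW: "open (\<phi> ` W)" by (rule chart_subimage_open[OF SA chA(1) W(1,3)])
  have inv: "inv_into U \<phi> (\<phi> p) = p" if "p \<in> W" for p
    using that W(3) chart_inverse[OF SA chA(1)] by auto
  have o: "open (\<phi> ` U \<times> \<psi> ` V)"
    by (rule open_Times[OF chart_image_open[OF SA chA(1)] chart_image_open[OF SB chB(1)]])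
  have hW: "smooth_on (\<phi> ` W) (\<psi> \<circ> h \<circ> inv_into U \<phi>)"
    by (rule smooth_on_subset[OF smooth_map_chart[OF h chA(1) chB(1)]]) (use x(3) W(4) W(3) in \<open>auto intro!: imageI\<close>)
  let ?G = "\<lambda>b y. Y (inv_into U \<phi> y) (x b) *
    \<D> \<Phi> (y, (\<psi> \<circ> h \<circ> inv_into U \<phi>) y) (0, b)"
  have G: "smooth_on (\<phi> ` W) (?G b)" for b
  proof (rule smooth_on_mult[OF oW])
    show "smooth_on (\<phi> ` W) (\<lambda>y. Y (inv_into U \<phi> y) (x b))"
      by (rule smooth_on_subset[OF smooth_functions_chart[OF Y(2)[OF x(4)] chA(1)]]) (use W(3) in auto)
    show "smooth_on (\<phi> ` W) (\<lambda>y. \<D> \<Phi> (y, (\<psi> \<circ> h \<circ> inv_into U \<phi>) y) (0, b))"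
      by (rule smooth_on_compose[OF BP oW o _ smooth_on_Pair[OF oW smooth_on_id[OF oW] hW]
            smooth_on_frechet_derivative[OF \<Phi>]]) (use W(3) hV inv in \<open>auto intro!: imageI\<close>)
  qed
  have "smooth_on (\<phi> ` W) (\<lambda>y. Y (inv_into U \<phi> y) (\<lambda>x. F (inv_into U \<phi> y, x)))"
  proof (rule smooth_on_cong[OF oW _ smooth_on_sum[OF oW G]])
    fix y assume "y \<in> \<phi> ` W"
    then obtain p where p: "p \<in> W" "y = \<phi> p" by blast
    then have hp: "p \<in> U" "h p \<in> N" "h p \<in> V" using W(3,4) x(3) by auto
    have "Y p (\<lambda>x. F (p, x)) = (\<Sum>b\<in>BB. Y p (x b) * chart_deriv V \<psi> (h p) (\<lambda>x. F (p, x)) b)"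
      by (rule tangent_coordinates[OF SB chB(1) BB Y(1) smooth_functions_partial_snd[OF SA SB F] x(4,1) hp(2) x(3,5)])
    also have "\<dots> = (\<Sum>b\<in>BB. ?G b y)"
      using p inv hp by (simp add: chart_deriv_partial_snd[OF SA SB F chA(1) chB(1)] \<Phi>_def)
    finally show "(\<Sum>b\<in>BB. ?G b y) = Y (inv_into U \<phi> y) (\<lambda>x. F (inv_into U \<phi> y, x))"
      using p inv by simp
  qed
  then show "\<exists>U \<phi> W. (U, \<phi>) \<in> A \<and> open W \<and> p0 \<in> W \<and> W \<subseteq> U \<and>
      smooth_on (\<phi> ` W) (\<lambda>y. Y (inv_into U \<phi> y) (\<lambda>x. F (inv_into U \<phi> y, x)))"
    using chA W by blast
qed

lemma smooth_tangent_param: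
  fixes A :: "('m::topological_space, 'e::real_inner) atlas" and B :: "('n::t2_space, 'f::real_inner) atlas"
  assumes "smooth_atlas A" "smooth_atlas B" "u \<in> \<T> B q" "F \<in> \<C> (prod_atlas A B)"
  shows "(\<lambda>p. u (\<lambda>x. F (p, x))) \<in> \<C> A"
  by (rule smooth_tangent_family[OF assms(1,2) smooth_map_const assms(3) smooth_functions_const assms(4)])

text \<open>In a chart, \<open>v\<close> differentiates along \<xi>, and the total derivative is
  linear on \<open>(\<xi>, \<xi>) = (\<xi>, 0) + (0, \<xi>)\<close>. This rule is used where a group
  element occurs twice in an expression.\<close>

lemma tangent_diagonal:
  fixes A :: "('m::t2_space, 'e::real_inner) atlas"
  assumes SA: "smooth_atlas A" and v: "v \<in> \<T> A p" and F: "F \<in> \<C> (prod_atlas A A)"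
  shows "v (\<lambda>s. F (s, s)) = v (\<lambda>s. F (s, p)) + v (\<lambda>s. F (p, s))"
proof -
  obtain U \<phi> where ch: "(U, \<phi>) \<in> A" "p \<in> U" using chart_around[OF SA] .
  obtain \<xi> where \<xi>: "\<And>f. f \<in> \<C> A \<Longrightarrow> v f = chart_deriv U \<phi> p f \<xi>"
    using tangent_chart_deriv[OF SA ch v] by blast
  define \<Phi> where "\<Phi> = (\<lambda>z. F (inv_into U \<phi> (fst z), inv_into U \<phi> (snd z)))"
  define D where "D = \<D> \<Phi> (\<phi> p, \<phi> p)"
  have hd: "(\<Phi> has_derivative D) (at (\<phi> p, \<phi> p))"
    unfolding \<Phi>_def D_def
    by (rule smooth_on_has_derivative[OF smooth_functions_prod_chart[OF SA SA F ch(1) ch(1)]]) (use ch in auto)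
  have "((\<lambda>y. \<Phi> (y, y)) has_derivative (\<lambda>b. D (b, b))) (at (\<phi> p))"
    by (rule has_derivative_compose[OF has_derivative_Pair[OF has_derivative_ident has_derivative_ident] hd])
  from fun_cong[OF frechet_derivative_at[OF this], of \<xi>]
  have "chart_deriv U \<phi> p (\<lambda>s. F (s, s)) \<xi> = D ((\<xi>, 0) + (0, \<xi>))"
    by (simp add: chart_deriv_def \<Phi>_def)
  also have "\<dots> = chart_deriv U \<phi> p (\<lambda>s. F (s, p)) \<xi> + chart_deriv U \<phi> p (\<lambda>s. F (p, s)) \<xi>"
    unfolding linear_add[OF has_derivative_linear[OF hd]]
    using ch by (simp add: D_def \<Phi>_def chart_deriv_partial_snd[OF SA SA F] chart_deriv_partial_fst[OF SA SA F])
  finally have eq: "chart_deriv U \<phi> p (\<lambda>s. F (s, s)) \<xi> =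
    chart_deriv U \<phi> p (\<lambda>s. F (s, p)) \<xi> + chart_deriv U \<phi> p (\<lambda>s. F (p, s)) \<xi>" .
  have "(\<lambda>s. F (s, s)) \<in> \<C> A"
    by (rule smooth_functions_comp[OF SA smooth_atlas_prod[OF SA SA] F
          smooth_map_Pair[OF smooth_map_id[OF SA] smooth_map_id[OF SA] SA SA SA]])
  then show ?thesis
    using eq \<xi> smooth_functions_partial_fst[OF SA SA F] smooth_functions_partial_snd[OF SA SA F] by simp
qed

text \<open>Both sides are mixed second derivatives of the local representative in the directions
  \<open>(\<xi>, 0)\<close> and \<open>(0, \<eta>)\<close>, taken in opposite orders.\<close>

lemma tangent_commute:
  fixes A :: "('m::t2_space, 'e::real_inner) atlas" and B :: "('n::t2_space, 'f::real_inner) atlas"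
  assumes SA: "smooth_atlas A" and SB: "smooth_atlas B"
    and u: "u \<in> \<T> A p" and w: "w \<in> \<T> B q"
    and F: "F \<in> \<C> (prod_atlas A B)"
  shows "w (\<lambda>t. u (\<lambda>x. F (x, t))) = u (\<lambda>x. w (\<lambda>t. F (x, t)))"
proof -
  obtain U \<phi> where chA: "(U, \<phi>) \<in> A" "p \<in> U" using chart_around[OF SA] .
  obtain V \<psi> where chB: "(V, \<psi>) \<in> B" "q \<in> V" using chart_around[OF SB] .
  obtain \<xi> where \<xi>: "\<And>f. f \<in> \<C> A \<Longrightarrow> u f = chart_deriv U \<phi> p f \<xi>"
    using tangent_chart_deriv[OF SA chA u] by blast
  obtain \<eta> where \<eta>: "\<And>f. f \<in> \<C> B \<Longrightarrow> w f = chart_deriv V \<psi> q f \<eta>"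
    using tangent_chart_deriv[OF SB chB w] by blast
  define \<Phi> where "\<Phi> = (\<lambda>z. F (inv_into U \<phi> (fst z), inv_into V \<psi> (snd z)))"
  define S where "S = \<phi> ` U \<times> \<psi> ` V"
  have S: "open S" "(\<phi> p, \<psi> q) \<in> S"
    using open_Times[OF chart_image_open[OF SA chA(1)] chart_image_open[OF SB chB(1)]] chA chB by (auto simp: S_def)
  have \<Phi>: "smooth_on S \<Phi>"
    unfolding \<Phi>_def S_def by (rule smooth_functions_prod_chart[OF SA SB F chA(1) chB(1)])
  define D where "D = (\<lambda>v z. \<D> \<Phi> z v)"
  have D: "smooth_on S (D v)" for v unfolding D_def by (rule smooth_on_frechet_derivative[OF \<Phi>])
  note partial = chart_deriv_partial_fst[OF SA SB F chA(1) chB(1)] chart_deriv_partial_snd[OF SA SB F chA(1) chB(1)]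

  have "((\<lambda>z. u (\<lambda>x. F (x, inv_into V \<psi> z))) has_derivative
      (\<lambda>c. \<D> (D (\<xi>, 0)) (\<phi> p, \<psi> q) (0, c))) (at (\<psi> q))"
  proof (rule has_derivative_transform_within_open[OF has_derivative_partial_snd[OF D S(2)] chart_image_open[OF SB chB(1)]])
    fix z assume "z \<in> \<psi> ` V"
    then show "D (\<xi>, 0) (\<phi> p, z) = u (\<lambda>x. F (x, inv_into V \<psi> z))"
      using chA \<xi>[OF smooth_functions_partial_fst[OF SA SB F]]
      by (auto simp: D_def \<Phi>_def partial chart_inverse[OF SB chB(1)])
  qed (use chB in auto)
  from fun_cong[OF frechet_derivative_at[OF this], of \<eta>]
  have 1: "chart_deriv V \<psi> q (\<lambda>t. u (\<lambda>x. F (x, t))) \<eta> =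
      \<D> (D (\<xi>, 0)) (\<phi> p, \<psi> q) (0, \<eta>)"
    by (simp add: chart_deriv_def)

  have "((\<lambda>y. w (\<lambda>t. F (inv_into U \<phi> y, t))) has_derivative
      (\<lambda>b. \<D> (D (0, \<eta>)) (\<phi> p, \<psi> q) (b, 0))) (at (\<phi> p))"
  proof (rule has_derivative_transform_within_open[OF has_derivative_partial_fst[OF D S(2)] chart_image_open[OF SA chA(1)]])
    fix y assume "y \<in> \<phi> ` U"
    then show "D (0, \<eta>) (y, \<psi> q) = w (\<lambda>t. F (inv_into U \<phi> y, t))"
      using chB \<eta>[OF smooth_functions_partial_snd[OF SA SB F]]
      by (auto simp: D_def \<Phi>_def partial chart_inverse[OF SA chA(1)])
  qed (use chA in auto)
  from fun_cong[OF frechet_derivative_at[OF this], of \<xi>]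
  have 2: "chart_deriv U \<phi> p (\<lambda>x. w (\<lambda>t. F (x, t))) \<xi> =
      \<D> (D (0, \<eta>)) (\<phi> p, \<psi> q) (\<xi>, 0)"
    by (simp add: chart_deriv_def)

  have "(\<lambda>t. u (\<lambda>x. F (x, t))) \<in> \<C> B"
    using smooth_tangent_param[OF SB SA u smooth_functions_swap[OF SA SB F]] by simp
  moreover have "(\<lambda>x. w (\<lambda>t. F (x, t))) \<in> \<C> A"
    by (rule smooth_tangent_param[OF SA SB w F])
  ultimately show ?thesis
    using frechet_derivative_symmetric[OF \<Phi> S, of "(\<xi>, 0)" "(0, \<eta>)"] by (simp add: \<xi> \<eta> 1 2 D_def)
qed

text \<open>Applied to the coordinate vectors, the hypothesis says that the derivative of
  \<open>f\<close> vanishes in every chart. So \<open>f\<close> is constant on small balls, and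
  connectedness does the rest.\<close>

lemma tangent_vanishing_constant:
  fixes A :: "('m::topological_space, 'e::real_inner) atlas"
  assumes SA: "smooth_atlas A" and f: "f \<in> \<C> A"
    and zero: "\<And>p v. v \<in> \<T> A p \<Longrightarrow> v f = 0" and conn: "connected (UNIV :: 'm set)"
  shows "f p = f q"
proof (rule connected_local_const[OF conn UNIV_I UNIV_I, of f], rule ballI)
  fix a
  obtain U \<phi> where ch: "(U, \<phi>) \<in> A" "a \<in> U" using chart_around[OF SA] .
  obtain r where r: "r > 0" "ball (\<phi> a) r \<subseteq> \<phi> ` U"
    using chart_image_open[OF SA ch(1)] ch(2) open_contains_ball by blast
  have "((\<lambda>y. f (inv_into U \<phi> y)) has_derivative (\<lambda>b. 0)) (at y within ball (\<phi> a) r)"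
    if "y \<in> ball (\<phi> a) r" for y
  proof -
    obtain s where s: "s \<in> U" "y = \<phi> s" using \<open>y \<in> ball (\<phi> a) r\<close> r(2) by blast
    have "chart_deriv U \<phi> s f b = 0" for b
      using zero[OF chart_vector_tangent[OF SA ch(1) s(1)], of b] f by (simp add: chart_vector_def)
    then have "chart_deriv U \<phi> s f = (\<lambda>b. 0)" by blast
    then show ?thesis
      using chart_has_derivative[OF f ch(1) s(1)] s(2) by (simp add: has_derivative_at_withinI)
  qed
  then obtain c where c: "\<And>y. y \<in> ball (\<phi> a) r \<Longrightarrow> f (inv_into U \<phi> y) = c"
    using has_derivative_zero_constant[OF convex_ball] by blast
  have o: "open (U \<inter> \<phi> -` ball (\<phi> a) r)"
    by (rule continuous_open_preimage[OF chart_continuous[OF SA ch(1)] chart_open[OF SA ch(1)] open_ball])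
  have "f a = f b" if "b \<in> U \<inter> \<phi> -` ball (\<phi> a) r" for b
    using c[of "\<phi> a"] c[of "\<phi> b"] that ch(2) r(1) by (simp add: chart_inverse[OF SA ch(1)])
  moreover have "a \<in> U \<inter> \<phi> -` ball (\<phi> a) r" using ch r by simp
  ultimately show "\<forall>\<^sub>F b in at a within UNIV. f a = f b"
    using o unfolding eventually_at_topological by blast
qed

section \<open>Vector fields and linear connections\<close>

lemma sum_fun_apply: "(\<Sum>i\<in>I. f i) x = (\<Sum>i\<in>I. f i x)"
  by (induction I rule: infinite_finite_induct) simp_all

lemma scale_vf_diff: "scale_vf f (X - Y) = scale_vf f X - scale_vf f Y"
  and scale_vf_zero: "scale_vf f 0 = 0"
  and scale_vf_const: "scale_vf (\<lambda>_. c) X = c *\<^sub>R X"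
  by (simp_all add: fun_eq_iff scale_vf_def scaleR_fun_def algebra_simps)

lemma vector_field_tangent: "X \<in> vector_fields A \<Longrightarrow> X p \<in> \<T> A p"
  and vector_field_app: "X \<in> vector_fields A \<Longrightarrow> f \<in> \<C> A \<Longrightarrow> app_vf X f \<in> \<C> A"
  by (auto simp: vector_fields_def)

lemma vector_field_smooth: "X \<in> vector_fields A \<Longrightarrow> f \<in> \<C> A \<Longrightarrow> (\<lambda>p. X p f) \<in> \<C> A"
  using vector_field_app[of X A f] by (simp add: app_vf_def)

lemma bracket_vf_app: "bracket_vf X Y p f = app_vf X (app_vf Y f) p - app_vf Y (app_vf X f) p"
  by (simp add: bracket_vf_def app_vf_def)

lemma app_bracket_vf: "app_vf (bracket_vf X Y) f = (\<lambda>p. app_vf X (app_vf Y f) p - app_vf Y (app_vf X f) p)"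
  by (simp add: bracket_vf_def app_vf_def)

lemma bracket_vf_swap: "bracket_vf X Y = - bracket_vf Y X"
  by (simp add: fun_eq_iff bracket_vf_def)

context
  fixes A :: "('m::topological_space, 'e::real_inner) atlas"
  assumes SA: "smooth_atlas A"
begin

abbreviation "CA \<equiv> \<C> A"
abbreviation "VF \<equiv> vector_fields A"

lemma vector_fields_zero: "0 \<in> VF"
  by (simp add: vector_fields_def tangent_space_zero[OF SA] app_vf_def smooth_functions_const)

lemma vector_fields_add: "X \<in> VF \<Longrightarrow> Y \<in> VF \<Longrightarrow> X + Y \<in> VF"
  by (simp add: vector_fields_def tangent_space_add[OF SA] app_vf_def smooth_functions_add[OF SA])

lemma vector_fields_scale: "f \<in> CA \<Longrightarrow> X \<in> VF \<Longrightarrow> scale_vf f X \<in> VF"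
proof -
  assume f: "f \<in> CA" and X: "X \<in> VF"
  have "scale_vf f X p \<in> \<T> A p" for p
    unfolding scale_vf_def by (rule tangent_space_scale[OF SA vector_field_tangent[OF X]])
  moreover have "app_vf (scale_vf f X) g = (\<lambda>p. f p * app_vf X g p)" for g
    by (simp add: app_vf_def scale_vf_def scaleR_fun_def)
  ultimately show ?thesis
    using f X by (simp add: vector_fields_def smooth_functions_mult[OF SA])
qed

lemma vector_fields_cmult: "X \<in> VF \<Longrightarrow> c *\<^sub>R X \<in> VF"
  using vector_fields_scale[OF smooth_functions_const, of X c] by (simp add: scale_vf_const)

lemma vector_fields_minus: "X \<in> VF \<Longrightarrow> - X \<in> VF"
  using vector_fields_cmult[of X "-1"] by simp

lemma vector_fields_diff: "X \<in> VF \<Longrightarrow> Y \<in> VF \<Longrightarrow> X - Y \<in> VF"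
  using vector_fields_add[OF _ vector_fields_minus, of X Y] by simp

lemma vector_fields_sum: "(\<And>i. i \<in> I \<Longrightarrow> X i \<in> VF) \<Longrightarrow> (\<Sum>i\<in>I. X i) \<in> VF"
  by (induction I rule: infinite_finite_induct) (simp_all add: vector_fields_zero vector_fields_add)

lemma app_vf_nonsmooth: "X \<in> VF \<Longrightarrow> f \<notin> CA \<Longrightarrow> app_vf X f = (\<lambda>p. 0)"
  using tangent_nonsmooth[OF vector_field_tangent, of X A f] by (simp add: app_vf_def)

lemma app_vf_fun_add:
  "X \<in> VF \<Longrightarrow> f \<in> CA \<Longrightarrow> g \<in> CA \<Longrightarrow>
    app_vf X (\<lambda>p. f p + g p) = (\<lambda>p. app_vf X f p + app_vf X g p)"
  using tangent_add[OF vector_field_tangent, of X A f g] by (simp add: app_vf_def)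

lemma app_vf_fun_mult:
  "X \<in> VF \<Longrightarrow> f \<in> CA \<Longrightarrow> g \<in> CA \<Longrightarrow>
    app_vf X (\<lambda>p. f p * g p) = (\<lambda>p. f p * app_vf X g p + g p * app_vf X f p)"
  using tangent_mult[OF vector_field_tangent, of X A f g] by (simp add: app_vf_def)

lemma app_vf_fun_cmult:
  "X \<in> VF \<Longrightarrow> f \<in> CA \<Longrightarrow> app_vf X (\<lambda>p. c * f p) = (\<lambda>p. c * app_vf X f p)"
  using tangent_cmult[OF vector_field_tangent[of X A]] by (simp add: app_vf_def)

lemma app_vf_fun_diff:
  "X \<in> VF \<Longrightarrow> f \<in> CA \<Longrightarrow> g \<in> CA \<Longrightarrow>
    app_vf X (\<lambda>p. f p - g p) = (\<lambda>p. app_vf X f p - app_vf X g p)"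
  using tangent_diff[OF SA vector_field_tangent, of X f g] by (simp add: app_vf_def)

lemma app_vf_fun_const: "X \<in> VF \<Longrightarrow> app_vf X (\<lambda>p. c) = (\<lambda>p. 0)"
  using tangent_const[OF SA vector_field_tangent[of X A]] by (simp add: app_vf_def)

subsection \<open>The bracket of vector fields\<close>

text \<open>The mixed terms of the product rule, \<open>X f\<close> times \<open>Y g\<close> and
  \<open>X g\<close> times \<open>Y f\<close>, occur in both iterated derivatives and cancel in the
  difference.\<close>

lemma bracket_vector_field:
  assumes X: "X \<in> VF" and Y: "Y \<in> VF"
  shows "bracket_vf X Y \<in> VF"
proof -
  have "bracket_vf X Y p \<in> \<T> A p" for p
  proof (rule tangent_spaceI)
    fix f assume "f \<notin> CA"
    then show "bracket_vf X Y p f = 0"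
      by (simp add: bracket_vf_app app_vf_nonsmooth X Y app_vf_fun_const)
  qed (simp_all add: bracket_vf_app X Y app_vf_fun_add app_vf_fun_mult app_vf_fun_cmult vector_field_app
      smooth_functions_mult[OF SA] algebra_simps)
  then show ?thesis
    using X Y by (simp add: vector_fields_def app_bracket_vf smooth_functions_diff[OF SA])
qed

lemma vector_field_eqI:
  "X \<in> VF \<Longrightarrow> Y \<in> VF \<Longrightarrow> (\<And>p f. f \<in> CA \<Longrightarrow> X p f = Y p f) \<Longrightarrow> X = Y"
  by (rule ext, rule tangent_eqI[OF vector_field_tangent vector_field_tangent])

lemma bracket_vf_add:
  assumes "X \<in> VF" "X' \<in> VF" "Y \<in> VF"
  shows "bracket_vf (X + X') Y = bracket_vf X Y + bracket_vf X' Y"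
proof (rule vector_field_eqI)
  fix p f assume f: "f \<in> CA"
  have "app_vf (X + X') f = (\<lambda>q. app_vf X f q + app_vf X' f q)" by (simp add: app_vf_def)
  then show "bracket_vf (X + X') Y p f = (bracket_vf X Y + bracket_vf X' Y) p f"
    using f assms by (simp add: bracket_vf_app app_vf_fun_add vector_field_app) (simp add: app_vf_def)
qed (intro vector_fields_add bracket_vector_field assms)+

lemma bracket_vf_scale:
  assumes "X \<in> VF" "Y \<in> VF" "g \<in> CA"
  shows "bracket_vf (scale_vf g X) Y = scale_vf g (bracket_vf X Y) - scale_vf (app_vf Y g) X"
proof (rule vector_field_eqI)
  fix p f assume f: "f \<in> CA"
  have "app_vf (scale_vf g X) f = (\<lambda>q. g q * app_vf X f q)"
    by (simp add: app_vf_def scale_vf_def scaleR_fun_def)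
  then show "bracket_vf (scale_vf g X) Y p f = (scale_vf g (bracket_vf X Y) - scale_vf (app_vf Y g) X) p f"
    using f assms by (simp add: bracket_vf_app app_vf_fun_mult vector_field_app scale_vf_def scaleR_fun_def)
      (simp add: app_vf_def scale_vf_def scaleR_fun_def algebra_simps)
qed (use assms in \<open>simp_all add: vector_fields_diff bracket_vector_field vector_fields_scale vector_field_app\<close>)

lemma bracket_vf_jacobi:
  assumes "X \<in> VF" "Y \<in> VF" "Z \<in> VF"
  shows "bracket_vf X (bracket_vf Y Z) + bracket_vf Y (bracket_vf Z X) + bracket_vf Z (bracket_vf X Y) = 0"
  by (rule vector_field_eqI)
    (use assms in \<open>simp_all add: vector_fields_add vector_fields_zero bracket_vector_field
      bracket_vf_app app_bracket_vf app_vf_fun_diff vector_field_app\<close>)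

subsection \<open>Tensoriality of torsion and curvature\<close>

context
  fixes D :: "'m connection"
  assumes D: "linear_connection A D"
begin

lemma conn_closed: "X \<in> VF \<Longrightarrow> Y \<in> VF \<Longrightarrow> D X Y \<in> VF"
  and conn_add1: "X \<in> VF \<Longrightarrow> X' \<in> VF \<Longrightarrow> Y \<in> VF \<Longrightarrow> D (X + X') Y = D X Y + D X' Y"
  and conn_add2: "X \<in> VF \<Longrightarrow> Y \<in> VF \<Longrightarrow> Y' \<in> VF \<Longrightarrow> D X (Y + Y') = D X Y + D X Y'"
  and conn_scale1: "f \<in> CA \<Longrightarrow> X \<in> VF \<Longrightarrow> Y \<in> VF \<Longrightarrow>
    D (scale_vf f X) Y = scale_vf f (D X Y)"
  and conn_scale2: "f \<in> CA \<Longrightarrow> X \<in> VF \<Longrightarrow> Y \<in> VF \<Longrightarrow>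
    D X (scale_vf f Y) = scale_vf f (D X Y) + scale_vf (app_vf X f) Y"
  and conn_outside: "X \<notin> VF \<or> Y \<notin> VF \<Longrightarrow> D X Y = 0"
  using D unfolding linear_connection_def by blast+

lemma conn_cmult1: "X \<in> VF \<Longrightarrow> Y \<in> VF \<Longrightarrow> D (c *\<^sub>R X) Y = c *\<^sub>R D X Y"
  using conn_scale1[OF smooth_functions_const, of X Y c] by (simp add: scale_vf_const)

lemma conn_cmult2: "X \<in> VF \<Longrightarrow> Y \<in> VF \<Longrightarrow> D X (c *\<^sub>R Y) = c *\<^sub>R D X Y"
  using conn_scale2[OF smooth_functions_const, of X Y c]
  by (simp add: scale_vf_const app_vf_fun_const)

lemma conn_minus1: "X \<in> VF \<Longrightarrow> Y \<in> VF \<Longrightarrow> D (- X) Y = - D X Y"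
  using conn_cmult1[of X Y "-1"] by simp

lemma conn_diff1: "X \<in> VF \<Longrightarrow> X' \<in> VF \<Longrightarrow> Y \<in> VF \<Longrightarrow> D (X - X') Y = D X Y - D X' Y"
  using conn_add1[of X "- X'" Y] by (simp add: conn_minus1 vector_fields_minus)

lemma conn_zero1: "Y \<in> VF \<Longrightarrow> D 0 Y = 0"
  using conn_add1[of 0 0 Y] by (simp add: vector_fields_zero)

lemma conn_zero2: "X \<in> VF \<Longrightarrow> D X 0 = 0"
  using conn_add2[of X 0 0] by (simp add: vector_fields_zero)

lemma torsion_swap: "torsion D X Y = - torsion D Y X"
  by (simp add: torsion_def bracket_vf_swap[of X Y])

lemma torsion_add:
  "X \<in> VF \<Longrightarrow> X' \<in> VF \<Longrightarrow> Y \<in> VF \<Longrightarrow>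
    torsion D (X + X') Y = torsion D X Y + torsion D X' Y"
  by (simp add: torsion_def conn_add1 conn_add2 bracket_vf_add)

text \<open>The derivative of \<open>f\<close> enters through \<open>D Y (scale_vf f X)\<close> and
  through the bracket, both times as \<open>scale_vf (app_vf Y f) X\<close>, and cancels. The second
  slot follows by \<open>torsion_swap\<close>.\<close>

lemma torsion_scale:
  "f \<in> CA \<Longrightarrow> X \<in> VF \<Longrightarrow> Y \<in> VF \<Longrightarrow>
    torsion D (scale_vf f X) Y = scale_vf f (torsion D X Y)"
  by (simp add: torsion_def conn_scale1 conn_scale2 bracket_vf_scale scale_vf_diff)

lemma curvature_swap: "X \<in> VF \<Longrightarrow> Y \<in> VF \<Longrightarrow> Z \<in> VF \<Longrightarrow>
    curvature D X Y Z = - curvature D Y X Z"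
  by (simp add: curvature_def bracket_vf_swap[of X Y] conn_minus1 bracket_vector_field)

lemma curvature_add1:
  "X \<in> VF \<Longrightarrow> X' \<in> VF \<Longrightarrow> Y \<in> VF \<Longrightarrow> Z \<in> VF \<Longrightarrow>
    curvature D (X + X') Y Z = curvature D X Y Z + curvature D X' Y Z"
  by (simp add: curvature_def conn_add1 conn_add2 conn_closed bracket_vf_add bracket_vector_field)

lemma curvature_add3:
  "X \<in> VF \<Longrightarrow> Y \<in> VF \<Longrightarrow> Z \<in> VF \<Longrightarrow> Z' \<in> VF \<Longrightarrow>
    curvature D X Y (Z + Z') = curvature D X Y Z + curvature D X Y Z'"
  by (simp add: curvature_def conn_add1 conn_add2 conn_closed bracket_vf_add bracket_vector_field)

lemma curvature_scale1:
  assumes "f \<in> CA" "X \<in> VF" "Y \<in> VF" "Z \<in> VF"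
  shows "curvature D (scale_vf f X) Y Z = scale_vf f (curvature D X Y Z)"
  using assms
  by (simp add: curvature_def conn_scale1 conn_scale2 conn_diff1 conn_closed bracket_vf_scale
      bracket_vector_field vector_fields_scale vector_field_app scale_vf_diff)

text \<open>The terms with first derivatives of \<open>f\<close> cancel in pairs; the second
  derivatives combine to the action of the bracket on \<open>f\<close>, which the summand with
  \<open>bracket_vf X Y\<close> removes.\<close>

lemma curvature_scale3:
  assumes "f \<in> CA" "X \<in> VF" "Y \<in> VF" "Z \<in> VF"
  shows "curvature D X Y (scale_vf f Z) = scale_vf f (curvature D X Y Z)"
proof -
  have "scale_vf (app_vf (bracket_vf X Y) f) Z =
      scale_vf (app_vf X (app_vf Y f)) Z - scale_vf (app_vf Y (app_vf X f)) Z"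
    by (simp add: app_bracket_vf scale_vf_def fun_eq_iff scaleR_fun_def algebra_simps)
  then show ?thesis
    using assms
    by (simp add: curvature_def conn_scale2 conn_add2 conn_closed
        bracket_vector_field vector_fields_scale vector_field_app scale_vf_diff)
qed

end

end

subsection \<open>Push-forward along a diffeomorphism\<close>

context
  fixes A :: "('m::topological_space, 'e::real_inner) atlas" and F F' :: "'m \<Rightarrow> 'm"
  assumes SA: "smooth_atlas A" and F: "smooth_map A A F" and F': "smooth_map A A F'"
    and FF': "\<And>x. F (F' x) = x" and F'F: "\<And>x. F' (F x) = x"
begin

text \<open>The description \<open>the_inv F\<close> is replaced by the given inverse
  \<open>F'\<close>, whose smoothness is at hand.\<close>

lemma push_vf_eq: "push_vf F X = (\<lambda>p f. X (F' p) (\<lambda>x. f (F x)))"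
proof -
  have "inj F" by (rule injI) (metis F'F)
  then have "the_inv F p = F' p" for p using the_inv_f_f[of F "F' p"] by (simp add: FF')
  then show ?thesis by (simp add: push_vf_def comp_def)
qed

text \<open>Tangent vectors are 0 on functions that are not smooth, so a push-forward also needs the
  implication from left to right: composing with \<open>F\<close> cannot make such a function
  smooth.\<close>

lemma smooth_functions_diffeo: "(\<lambda>x. f (F x)) \<in> \<C> A \<longleftrightarrow> f \<in> \<C> A"
proof
  assume "(\<lambda>x. f (F x)) \<in> \<C> A"
  from smooth_functions_comp[OF SA SA this F'] show "f \<in> \<C> A" by (simp add: FF')
qed (rule smooth_functions_comp[OF SA SA _ F])

lemma push_tangent:
  assumes v: "v \<in> \<T> A p"
  shows "(\<lambda>f. v (\<lambda>x. f (F x))) \<in> \<T> A (F p)"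
proof (rule tangent_spaceI)
  fix f assume "f \<notin> \<C> A"
  then show "v (\<lambda>x. f (F x)) = 0" by (simp add: tangent_nonsmooth[OF v] smooth_functions_diffeo)
qed (simp_all add: tangent_add[OF v] tangent_cmult[OF v] tangent_mult[OF v] smooth_functions_diffeo)

lemma push_vector_field:
  assumes X: "X \<in> vector_fields A"
  shows "push_vf F X \<in> vector_fields A"
proof -
  have "(\<lambda>p. X (F' p) (\<lambda>x. f (F x))) \<in> \<C> A" if "f \<in> \<C> A" for f
    by (rule smooth_functions_comp[OF SA SA vector_field_smooth[OF X] F']) (simp add: smooth_functions_diffeo that)
  then show ?thesis
    using push_tangent[OF vector_field_tangent[OF X], of "F' p" for p]
    by (simp add: vector_fields_def push_vf_eq app_vf_def FF')
qed

lemma push_add: "push_vf F (X + Y) = push_vf F X + push_vf F Y"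
  by (simp add: push_vf_eq fun_eq_iff)

lemma push_zero: "push_vf F 0 = 0"
  by (simp add: push_vf_eq fun_eq_iff)

lemma push_scale: "push_vf F (scale_vf f X) = scale_vf (\<lambda>p. f (F' p)) (push_vf F X)"
  by (simp add: push_vf_eq fun_eq_iff scale_vf_def scaleR_fun_def)

lemma app_push: "app_vf (push_vf F X) (\<lambda>p. f (F' p)) = (\<lambda>p. app_vf X f (F' p))"
  by (simp add: push_vf_eq app_vf_def F'F)

lemma push_bracket: "bracket_vf (push_vf F X) (push_vf F Y) = push_vf F (bracket_vf X Y)"
  by (simp add: push_vf_eq bracket_vf_def app_vf_def F'F)

end

section \<open>Lie groups\<close>

locale smooth_group =
  fixes G :: "('g::{t2_space, second_countable_topology}, 'e::real_inner) lie_group_data" (structure)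
  assumes lie: "lie_group G"
begin

abbreviation "M \<equiv> atlas G"
abbreviation "CM \<equiv> \<C> M"
abbreviation "VM \<equiv> vector_fields M"
abbreviation lie_alg_carrier ("\<gg>") where "\<gg> \<equiv> lie_alg G"
abbreviation "br \<equiv> lie_bracket G"

lemma carrier_UNIV [simp]: "carrier G = UNIV"
  and SM: "smooth_atlas M"
  using lie by (simp_all add: lie_group_def)

sublocale group G
  using lie by (simp add: lie_group_def)

lemma cancel [simp]: "inv p \<otimes> (p \<otimes> x) = x" "p \<otimes> (inv p \<otimes> x) = x"
  by (simp_all add: m_assoc[symmetric])

lemma inv_mult [simp]: "inv (x \<otimes> y) = inv y \<otimes> inv x"
  by (simp add: inv_mult_group)

lemma smooth_mult:
  fixes P :: "('p::topological_space, 'q::real_inner) atlas"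
  assumes "smooth_atlas P" "smooth_map P M f" "smooth_map P M h"
  shows "smooth_map P M (\<lambda>x. f x \<otimes> h x)"
proof -
  have "smooth_map (prod_atlas M M) M (\<lambda>(x, y). x \<otimes> y)" using lie by (simp add: lie_group_def)
  from smooth_map_comp[OF assms(1) smooth_atlas_prod[OF SM SM] SM
      smooth_map_Pair[OF assms(2,3,1) SM SM] this]
  show ?thesis by simp
qed

lemma smooth_inv:
  fixes P :: "('p::topological_space, 'q::real_inner) atlas"
  assumes "smooth_atlas P" "smooth_map P M f"
  shows "smooth_map P M (\<lambda>x. inv f x)"
proof -
  have "smooth_map M M (\<lambda>x. inv x)" using lie by (simp add: lie_group_def)
  from smooth_map_comp[OF assms(1) SM SM assms(2) this] show ?thesis .
qed

lemma smooth_left: "smooth_map M M (\<lambda>x. a \<otimes> x)"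
  by (rule smooth_mult[OF SM smooth_map_const smooth_map_id[OF SM]])

lemma smooth_right: "smooth_map M M (\<lambda>x. x \<otimes> a)"
  by (rule smooth_mult[OF SM smooth_map_id[OF SM] smooth_map_const])

lemma left_facts:
  "smooth_map M M (\<lambda>x. a \<otimes> x)" "smooth_map M M (\<lambda>x. inv a \<otimes> x)"
  "a \<otimes> (inv a \<otimes> x) = x" "inv a \<otimes> (a \<otimes> x) = x"
  by (simp_all add: smooth_left)

lemma right_facts:
  "smooth_map M M (\<lambda>x. x \<otimes> a)" "smooth_map M M (\<lambda>x. x \<otimes> inv a)"
  "x \<otimes> inv a \<otimes> a = x" "x \<otimes> a \<otimes> inv a = x"
  by (simp_all add: smooth_right m_assoc)

lemma conj_facts:
  "smooth_map M M (\<lambda>x. a \<otimes> x \<otimes> inv a)" "smooth_map M M (\<lambda>x. inv a \<otimes> x \<otimes> a)"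
  "a \<otimes> (inv a \<otimes> x \<otimes> a) \<otimes> inv a = x" "inv a \<otimes> (a \<otimes> x \<otimes> inv a) \<otimes> a = x"
  by (rule smooth_mult[OF SM smooth_left smooth_map_const])+ (simp_all add: m_assoc)

subsection \<open>Left invariant vector fields\<close>

text \<open>
  For \<open>u\<close> in the Lie algebra this is \<open>u\<^sup>+\<close>. If \<open>f\<close> is not smooth then neither are its translates, so the
  value is \<open>0\<close>, as required of tangent vectors.
\<close>

definition left_field :: "'g tangent \<Rightarrow> 'g vfield" where
  "left_field u = (\<lambda>p f. u (\<lambda>x. f (p \<otimes> x)))"

lemma lie_alg_tangent: "u \<in> \<gg> \<longleftrightarrow> u \<in> \<T> M \<one>"
  by (simp add: lie_alg_def)

lemma smooth_functions_mult_pair: "f \<in> CM \<Longrightarrow> (\<lambda>z. f (fst z \<otimes> snd z)) \<in> \<C> (prod_atlas M M)"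
  by (rule smooth_functions_comp[OF smooth_atlas_prod[OF SM SM] SM _
        smooth_mult[OF smooth_atlas_prod[OF SM SM] smooth_map_fst[OF SM SM] smooth_map_snd[OF SM SM]]])

lemma left_field_vector_field: "u \<in> \<gg> \<Longrightarrow> left_field u \<in> VM"
proof -
  assume u: "u \<in> \<gg>"
  have "(\<lambda>f. u (\<lambda>x. f (p \<otimes> x))) \<in> \<T> M (p \<otimes> \<one>)" for p
    using u unfolding lie_alg_tangent by (rule push_tangent[OF SM left_facts])
  then have "(\<lambda>f. u (\<lambda>x. f (p \<otimes> x))) \<in> \<T> M p" for p by simp
  moreover have "(\<lambda>p. u (\<lambda>x. f (p \<otimes> x))) \<in> CM" if "f \<in> CM" for f
    using smooth_tangent_param[OF SM SM u[unfolded lie_alg_tangent] smooth_functions_mult_pair[OF that]] by simp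
  ultimately show ?thesis by (simp add: vector_fields_def left_field_def app_vf_def)
qed

lemma left_field_one [simp]: "left_field u \<one> = u"
  by (simp add: left_field_def)

lemma push_left_field: "push_vf (\<lambda>x. a \<otimes> x) (left_field u) = left_field u"
  by (simp add: push_vf_eq[OF SM left_facts] left_field_def m_assoc[symmetric])

lemma left_invariant_left_field: "u \<in> \<gg> \<Longrightarrow> left_invariant_vf G (left_field u)"
  by (simp add: left_invariant_vf_def left_field_vector_field push_left_field)

text \<open>The push-forward along left translation by \<open>p\<close>, evaluated at the point
  \<open>p\<close>, is built from the value at the identity.\<close>

lemma left_invariant_eq:
  assumes "\<And>a. push_vf (\<lambda>x. a \<otimes> x) X = X"
  shows "X = left_field (X \<one>)"
proof (intro ext)
  fix p f
  have "X p f = push_vf (\<lambda>x. p \<otimes> x) X p f" by (simp add: assms)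
  then show "X p f = left_field (X \<one>) p f"
    by (simp add: push_vf_eq[OF SM left_facts] left_field_def)
qed

lemma left_inv_field_eq [simp]: "u \<in> \<gg> \<Longrightarrow> left_inv_field G u = left_field u"
  unfolding left_inv_field_def
proof (rule the_equality)
  fix X assume "left_invariant_vf G X \<and> X \<one> = u"
  then show "X = left_field u" using left_invariant_eq[of X] by (simp add: left_invariant_vf_def)
qed (simp add: left_invariant_left_field)

lemma left_field_add: "left_field (u + v) = left_field u + left_field v"
  and left_field_scale: "left_field (c *\<^sub>R u) = c *\<^sub>R left_field u"
  and left_field_diff: "left_field (u - v) = left_field u - left_field v"
  by (simp_all add: left_field_def fun_eq_iff scaleR_fun_def)

lemma left_field_eq_iff: "left_field u = left_field v \<longleftrightarrow> u = v"
  by (metis left_field_one)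

lemma subspace_lie_alg: "subspace (\<gg>)"
  by (simp add: lie_alg_def subspace_tangent_space[OF SM])

lemma lie_bracket_closed:
  assumes u: "u \<in> \<gg>" and v: "v \<in> \<gg>"
  shows "br u v \<in> \<gg>"
  using vector_field_tangent[OF bracket_vector_field[OF SM left_field_vector_field[OF u] left_field_vector_field[OF v]]]
    u v by (simp add: lie_bracket_def lie_alg_def)

lemma left_field_bracket:
  assumes u: "u \<in> \<gg>" and v: "v \<in> \<gg>"
  shows "bracket_vf (left_field u) (left_field v) = left_field (br u v)"
  using left_invariant_eq[of "bracket_vf (left_field u) (left_field v)"] u v
  by (simp add: push_bracket[OF SM left_facts, symmetric] push_left_field lie_bracket_def)

text \<open>No vector field is left in this formula, so it can be compared directly with derivatives
  of \<open>Ad\<close>.\<close>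

lemma lie_bracket_apply:
  assumes u: "u \<in> \<gg>" and v: "v \<in> \<gg>"
  shows "br u v f = u (\<lambda>s. v (\<lambda>x. f (s \<otimes> x))) - v (\<lambda>s. u (\<lambda>x. f (s \<otimes> x)))"
  using u v by (simp add: lie_bracket_def bracket_vf_def app_vf_def left_field_def)

lemma lie_bracket_swap: "u \<in> \<gg> \<Longrightarrow> v \<in> \<gg> \<Longrightarrow> br u v = - br v u"
  by (simp add: fun_eq_iff lie_bracket_apply)

lemma lie_algebra: "lie_algebra_on (\<gg>) (br)"
proof -
  note sub = subspace_add[OF subspace_lie_alg] subspace_scale[OF subspace_lie_alg]
  have add: "br (u + v) w = br u w + br v w"
    if "u \<in> \<gg>" "v \<in> \<gg>" "w \<in> \<gg>" for u v w
    using that by (simp add: lie_bracket_def sub left_field_add bracket_vf_add[OF SM] left_field_vector_field)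
  have scale: "br (c *\<^sub>R u) w = c *\<^sub>R br u w"
    if u: "u \<in> \<gg>" and w: "w \<in> \<gg>" for c u w
  proof -
    have "app_vf (left_field w) (\<lambda>_. c) = (\<lambda>p. 0)"
      by (rule app_vf_fun_const[OF SM left_field_vector_field[OF w]])
    then have "scale_vf (app_vf (left_field w) (\<lambda>_. c)) (left_field u) = 0"
      by (simp add: scale_vf_def fun_eq_iff)
    then have "bracket_vf (c *\<^sub>R left_field u) (left_field w) = c *\<^sub>R bracket_vf (left_field u) (left_field w)"
      using bracket_vf_scale[OF SM left_field_vector_field[OF u] left_field_vector_field[OF w] smooth_functions_const, of c]
      by (simp add: scale_vf_const)
    then have "bracket_vf (left_field (c *\<^sub>R u)) (left_field w) \<one> = c *\<^sub>R bracket_vf (left_field u) (left_field w) \<one>"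
      unfolding left_field_scale by (simp add: scaleR_fun_def)
    then show ?thesis using u w by (simp add: lie_bracket_def sub)
  qed
  have "bilinear_product_on (\<gg>) (br)"
    unfolding bilinear_product_on_def
  proof (intro conjI ballI allI)
    fix u v w assume *: "u \<in> \<gg>" "v \<in> \<gg>" "w \<in> \<gg>"
    show "br (u + v) w = br u w + br v w" by (rule add[OF *])
    show "br u (v + w) = br u v + br u w"
      using add[OF *(2,3,1)] * by (simp add: lie_bracket_swap[of u] sub)
  next
    fix c u v assume *: "u \<in> \<gg>" "v \<in> \<gg>"
    show "br u v \<in> \<gg>" by (rule lie_bracket_closed[OF *])
    show "br (c *\<^sub>R u) v = c *\<^sub>R br u v" by (rule scale[OF *])
    show "br u (c *\<^sub>R v) = c *\<^sub>R br u v"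
      using scale[OF *(2,1)] * by (simp add: lie_bracket_swap[of u] sub)
  qed
  moreover have "br u u = 0" if "u \<in> \<gg>" for u
    using that by (simp add: fun_eq_iff lie_bracket_apply)
  moreover have "br u (br v w) + br v (br w u) + br w (br u v) = 0"
    if "u \<in> \<gg>" "v \<in> \<gg>" "w \<in> \<gg>" for u v w
  proof -
    have "left_field (br u (br v w) + br v (br w u) + br w (br u v)) = 0"
      using that bracket_vf_jacobi[OF SM, of "left_field u" "left_field v" "left_field w"]
      by (simp add: left_field_bracket left_field_add lie_bracket_closed left_field_vector_field)
    then show ?thesis by (metis left_field_one zero_fun_apply)
  qed
  ultimately show ?thesis using subspace_lie_alg by (simp add: lie_algebra_on_def)
qed

subsection \<open>The adjoint representation\<close>

definition Ad :: "'g \<Rightarrow> 'g tangent \<Rightarrow> 'g tangent" where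
  "Ad a u = (\<lambda>f. u (\<lambda>x. f (a \<otimes> x \<otimes> inv a)))"

lemma Ad_closed: "u \<in> \<gg> \<Longrightarrow> Ad a u \<in> \<gg>"
  using push_tangent[OF SM conj_facts, of u \<one> a] by (simp add: lie_alg_def Ad_def)

lemma Ad_one [simp]: "Ad \<one> u = u"
  and Ad_mult: "Ad (a \<otimes> b) u = Ad a (Ad b u)"
  and Ad_inv [simp]: "Ad (inv a) (Ad a u) = u" "Ad a (Ad (inv a) u) = u"
  by (simp_all add: Ad_def m_assoc)

lemma Ad_add: "Ad a (u + v) = Ad a u + Ad a v"
  and Ad_scale: "Ad a (c *\<^sub>R u) = c *\<^sub>R Ad a u"
  by (simp_all add: Ad_def fun_eq_iff scaleR_fun_def)

text \<open>Conjugation is multiplicative, so in the iterated derivatives of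
  \<open>lie_bracket_apply\<close> it can be applied to each factor separately.\<close>

lemma Ad_bracket:
  "u \<in> \<gg> \<Longrightarrow> v \<in> \<gg> \<Longrightarrow> Ad a (br u v) = br (Ad a u) (Ad a v)"
  by (simp add: fun_eq_iff lie_bracket_apply Ad_closed) (simp add: Ad_def lie_bracket_apply m_assoc)

text \<open>The product \<open>p \<otimes> inv a \<otimes> x \<otimes> a\<close> is \<open>p\<close>
  times a conjugate of \<open>x\<close>. Through this identity right invariance of a connection
  becomes invariance of its product under \<open>Ad\<close>.\<close>

lemma push_right_left_field: "push_vf (\<lambda>x. x \<otimes> a) (left_field u) = left_field (Ad (inv a) u)"
  by (simp add: push_vf_eq[OF SM right_facts] left_field_def Ad_def m_assoc)

lemma smooth_Ad:
  assumes u: "u \<in> \<gg>" and f: "f \<in> CM"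
  shows "(\<lambda>a. Ad a u f) \<in> CM"
proof -
  note SP = smooth_atlas_prod[OF SM SM] and fst = smooth_map_fst[OF SM SM] and snd = smooth_map_snd[OF SM SM]
  have "(\<lambda>z. f (fst z \<otimes> snd z \<otimes> inv (fst z))) \<in> \<C> (prod_atlas M M)"
    by (rule smooth_functions_comp[OF SP SM f smooth_mult[OF SP smooth_mult[OF SP fst snd] smooth_inv[OF SP fst]]])
  from smooth_tangent_param[OF SM SM u[unfolded lie_alg_tangent] this] show ?thesis by (simp add: Ad_def)
qed

text \<open>The function \<open>h (s \<otimes> inv t)\<close> is constant on the diagonal, so by
  \<open>tangent_diagonal\<close> its two partial derivatives at the identity cancel.\<close>

lemma tangent_inv:
  assumes w: "w \<in> \<gg>" and h: "h \<in> CM"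
  shows "w (\<lambda>t. h (inv t)) = - w h"
proof -
  note w' = w[unfolded lie_alg_tangent]
  note SP = smooth_atlas_prod[OF SM SM] and fst = smooth_map_fst[OF SM SM] and snd = smooth_map_snd[OF SM SM]
  have "(\<lambda>z. h (fst z \<otimes> inv (snd z))) \<in> \<C> (prod_atlas M M)"
    by (rule smooth_functions_comp[OF SP SM h smooth_mult[OF SP fst smooth_inv[OF SP snd]]])
  from tangent_diagonal[OF SM w' this] show ?thesis by (simp add: tangent_const[OF SM w'])
qed

lemma tangent_Ad:
  assumes w: "w \<in> \<gg>" and u: "u \<in> \<gg>" and f: "f \<in> CM"
  shows "w (\<lambda>s. Ad s u f) = br w u f"
proof -
  note w' = w[unfolded lie_alg_tangent] and u' = u[unfolded lie_alg_tangent]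
  note SP = smooth_atlas_prod[OF SM SM] and fst = smooth_map_fst[OF SM SM] and snd = smooth_map_snd[OF SM SM]
  note SQ = smooth_atlas_prod[OF SP SM] and fst' = smooth_map_fst[OF SP SM] and snd' = smooth_map_snd[OF SP SM]
  note s = smooth_map_comp[OF SQ SP SM fst' fst] and t = smooth_map_comp[OF SQ SP SM fst' snd]
  have "(\<lambda>z. f (fst (fst z) \<otimes> snd z \<otimes> inv (snd (fst z)))) \<in> \<C> (prod_atlas (prod_atlas M M) M)"
    by (rule smooth_functions_comp[OF SQ SM f smooth_mult[OF SQ smooth_mult[OF SQ s snd'] smooth_inv[OF SQ t]]])
  from smooth_tangent_param[OF SP SM u' this]
  have F: "(\<lambda>z. u (\<lambda>x. f (fst z \<otimes> x \<otimes> inv (snd z)))) \<in> \<C> (prod_atlas M M)" by simp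
  have h: "(\<lambda>t. u (\<lambda>x. f (x \<otimes> t))) \<in> CM"
    using smooth_tangent_param[OF SM SM u' smooth_functions_swap[OF SM SM smooth_functions_mult_pair[OF f]]] by simp
  \<comment> \<open>Differentiate \<open>f (s \<otimes> x \<otimes> inv t)\<close> in \<open>x\<close> along \<open>u\<close> and then along \<open>w\<close> on the diagonal \<open>s = t\<close>.\<close>
  have "w (\<lambda>s. Ad s u f) = w (\<lambda>s. u (\<lambda>x. f (s \<otimes> x))) + w (\<lambda>t. u (\<lambda>x. f (x \<otimes> inv t)))"
    using tangent_diagonal[OF SM w' F] by (simp add: Ad_def)
  also have "w (\<lambda>t. u (\<lambda>x. f (x \<otimes> inv t))) = - w (\<lambda>t. u (\<lambda>x. f (x \<otimes> t)))"
    by (rule tangent_inv[OF w h])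
  \<comment> \<open>Exchanging the order of differentiation produces the second term of
    \<open>lie_bracket_apply\<close>.\<close>
  also have "w (\<lambda>t. u (\<lambda>x. f (x \<otimes> t))) = u (\<lambda>x. w (\<lambda>t. f (x \<otimes> t)))"
    using tangent_commute[OF SM SM u' w' smooth_functions_mult_pair[OF f]] by simp
  finally show ?thesis by (simp add: lie_bracket_apply[OF w u])
qed

text \<open>Left translation by \<open>inv p\<close> carries \<open>w\<close> to the identity; a
  derivative at \<open>p\<close> becomes a derivative at the identity of the translated
  function.\<close>

lemma tangent_translate:
  assumes "w \<in> \<T> M p"
  obtains w' where "w' \<in> \<gg>" "\<And>f. w f = w' (\<lambda>s. f (p \<otimes> s))"
proof
  show "(\<lambda>f. w (\<lambda>x. f (inv p \<otimes> x))) \<in> \<gg>"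
    using push_tangent[OF SM smooth_left[of "inv p"] smooth_left[of p] cancel(1)[of p] cancel(2)[of p] assms] by (simp add: lie_alg_def)
qed simp

end

subsection \<open>Linear connections in a left invariant frame\<close>

lemma bilinear_product_onD:
  assumes "bilinear_product_on V b" "u \<in> V" "v \<in> V"
  shows "b u v \<in> V"
    and "w \<in> V \<Longrightarrow> b (u + v) w = b u w + b v w" "w \<in> V \<Longrightarrow> b w (u + v) = b w u + b w v"
    and "b (c *\<^sub>R u) v = c *\<^sub>R b u v" "b u (c *\<^sub>R v) = c *\<^sub>R b u v"
  using assms unfolding bilinear_product_on_def by blast+

lemma bilinear_product_zero:
  assumes b: "bilinear_product_on V b" and "u \<in> V"
  shows "b 0 u = 0" "b u 0 = 0"
  using bilinear_product_onD(4)[OF b assms(2,2), of 0] bilinear_product_onD(5)[OF b assms(2,2), of 0] by simp_all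

lemma bilinear_product_sum:
  assumes V: "subspace V" and b: "bilinear_product_on V b"
    and c: "\<And>i. i \<in> I \<Longrightarrow> c i \<in> V" and d: "\<And>j. j \<in> J \<Longrightarrow> d j \<in> V"
  shows "b (\<Sum>i\<in>I. r i *\<^sub>R c i) (\<Sum>j\<in>J. s j *\<^sub>R d j) = (\<Sum>i\<in>I. \<Sum>j\<in>J. (r i * s j) *\<^sub>R b (c i) (d j))"
proof -
  have right: "b u (\<Sum>j\<in>J. s j *\<^sub>R d j) = (\<Sum>j\<in>J. s j *\<^sub>R b u (d j))" if u: "u \<in> V" for u
    using d
  proof (induction J rule: infinite_finite_induct)
    case (insert j J)
    have j: "d j \<in> V" using insert.prems by simp
    have J: "(\<Sum>j\<in>J. s j *\<^sub>R d j) \<in> V" using insert.prems by (intro subspace_sum[OF V] subspace_scale[OF V]) auto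
    show ?case
      using insert bilinear_product_onD(3)[OF b subspace_scale[OF V j] J u] bilinear_product_onD(5)[OF b u j] by simp
  qed (simp_all add: bilinear_product_zero[OF b u])
  let ?v = "\<Sum>j\<in>J. s j *\<^sub>R d j"
  have v: "?v \<in> V" using d by (intro subspace_sum[OF V] subspace_scale[OF V])
  have "b (\<Sum>i\<in>I. r i *\<^sub>R c i) ?v = (\<Sum>i\<in>I. r i *\<^sub>R b (c i) ?v)"
    using c
  proof (induction I rule: infinite_finite_induct)
    case (insert i I)
    have i: "c i \<in> V" using insert.prems by simp
    have I: "(\<Sum>i\<in>I. r i *\<^sub>R c i) \<in> V" using insert.prems by (intro subspace_sum[OF V] subspace_scale[OF V]) auto
    show ?case
      using insert bilinear_product_onD(2)[OF b subspace_scale[OF V i] I v] bilinear_product_onD(4)[OF b i v] by simp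
  qed (simp_all add: bilinear_product_zero[OF b v])
  also have "\<dots> = (\<Sum>i\<in>I. \<Sum>j\<in>J. (r i * s j) *\<^sub>R b (c i) (d j))"
    using c by (intro sum.cong refl) (simp add: right scaleR_sum_right)
  finally show ?thesis .
qed

text \<open>The data of \<open>tangent_frame\<close> at the identity, with an abstract index type:
  from here on all expansions refer to the frame and no longer to a chart.\<close>

locale framed_group = smooth_group +
  fixes B :: "'i set" and c :: "'i \<Rightarrow> 'a tangent" and x :: "'i \<Rightarrow> 'a \<Rightarrow> real"
  assumes finite_B: "finite B" and c: "\<And>b. c b \<in> lie_alg G" and x: "\<And>b. x b \<in> \<C> (atlas G)"
    and frame: "\<And>u. u \<in> lie_alg G \<Longrightarrow> u = (\<Sum>b\<in>B. u (x b) *\<^sub>R c b)"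
begin

lemma frame_apply: "u \<in> \<gg> \<Longrightarrow> u f = (\<Sum>b\<in>B. u (x b) * c b f)"
  using fun_cong[OF frame[of u], of f] by (simp add: sum_fun_apply scaleR_fun_def)

text \<open>
  Testing \<open>X p\<close> against the translated dual functions gives visibly smooth coefficients, without
  inverting the matrix of the frame.
\<close>

definition coef :: "'i \<Rightarrow> 'a vfield \<Rightarrow> 'a \<Rightarrow> real" where
  "coef b X = (\<lambda>p. X p (\<lambda>q. x b (inv p \<otimes> q)))"

lemma coef_smooth:
  assumes X: "X \<in> VM"
  shows "coef b X \<in> CM"
proof -
  note SP = smooth_atlas_prod[OF SM SM] and fst = smooth_map_fst[OF SM SM] and snd = smooth_map_snd[OF SM SM]
  have "(\<lambda>z. x b (inv (fst z) \<otimes> snd z)) \<in> \<C> (prod_atlas M M)"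
    by (rule smooth_functions_comp[OF SP SM x smooth_mult[OF SP smooth_inv[OF SP fst] snd]])
  \<comment> \<open>The tested function varies with \<open>p\<close> together with the footpoint,
    which is why joint smoothness on the product is used.\<close>
  from smooth_tangent_family[OF SM SM smooth_map_id[OF SM] vector_field_tangent[OF X] vector_field_smooth[OF X] this]
  show ?thesis by (simp add: coef_def)
qed

lemma coef_add: "coef b (X + Y) = (\<lambda>p. coef b X p + coef b Y p)"
  and coef_scale: "coef b (scale_vf f X) = (\<lambda>p. f p * coef b X p)"
  and coef_left_field: "coef b (left_field u) = (\<lambda>p. u (x b))"
  by (simp_all add: coef_def scale_vf_def scaleR_fun_def left_field_def)

lemma vector_field_expansion:
  assumes X: "X \<in> VM"
  shows "X = (\<Sum>b\<in>B. scale_vf (coef b X) (left_field (c b)))"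
proof (intro ext)
  fix p f
  have "(\<lambda>f. X p (\<lambda>q. f (inv p \<otimes> q))) \<in> \<gg>"
    using push_tangent[OF SM smooth_left[of "inv p"] smooth_left[of p] cancel(1)[of p] cancel(2)[of p] vector_field_tangent[OF X, of p]]
    by (simp add: lie_alg_def)
  from frame_apply[OF this, of "\<lambda>q. f (p \<otimes> q)"]
  show "X p f = (\<Sum>b\<in>B. scale_vf (coef b X) (left_field (c b))) p f"
    by (simp add: sum_fun_apply scale_vf_def scaleR_fun_def coef_def left_field_def)
qed

text \<open>By the expansion with smooth coefficients, the fields
  \<open>scale_vf f (left_field u)\<close> generate all vector fields additively. The factor
  \<open>f\<close> stays inside the generator because a connection is not function-linear in its
  second slot.\<close>

lemma vector_field_induct [consumes 1, case_names zero add scale]: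
  assumes X: "X \<in> VM"
    and zero: "P 0" and add: "\<And>X Y. X \<in> VM \<Longrightarrow> Y \<in> VM \<Longrightarrow> P X \<Longrightarrow> P Y \<Longrightarrow> P (X + Y)"
    and scale: "\<And>f u. f \<in> CM \<Longrightarrow> u \<in> \<gg> \<Longrightarrow> P (scale_vf f (left_field u))"
  shows "P X"
proof -
  have t: "scale_vf (coef b X) (left_field (c b)) \<in> VM" for b
    by (intro vector_fields_scale[OF SM] coef_smooth X left_field_vector_field c)
  have "P (\<Sum>b\<in>I. scale_vf (coef b X) (left_field (c b)))" for I
  proof (induction I rule: infinite_finite_induct)
    case (insert b I)
    have "P (scale_vf (coef b X) (left_field (c b)) + (\<Sum>b\<in>I. scale_vf (coef b X) (left_field (c b))))"
      by (intro add t vector_fields_sum[OF SM] scale coef_smooth X c insert.IH)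
    then show ?case
      by (rule back_subst[of P]) (rule sum.insert[OF insert.hyps, symmetric])
  next
    case (infinite I)
    show ?case by (rule back_subst[of P, OF zero]) (rule sum.infinite[OF infinite, symmetric])
  next
    case empty
    show ?case by (rule back_subst[of P, OF zero]) (rule sum.empty[symmetric])
  qed
  then have "P (\<Sum>b\<in>B. scale_vf (coef b X) (left_field (c b)))" .
  then show ?thesis by (subst vector_field_expansion[OF X])
qed

text \<open>Made for one slot of a tensor at a time; with \<open>T' = 0\<close> it proves vanishing
  of the torsion, and with two curvatures their equality.\<close>

lemma tensor_eqI:
  assumes X: "X \<in> VM"
    and T: "\<And>X Y. X \<in> VM \<Longrightarrow> Y \<in> VM \<Longrightarrow> T (X + Y) = T X + T Y"
      "\<And>f X. f \<in> CM \<Longrightarrow> X \<in> VM \<Longrightarrow> T (scale_vf f X) = scale_vf f (T X)"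
    and T': "\<And>X Y. X \<in> VM \<Longrightarrow> Y \<in> VM \<Longrightarrow> T' (X + Y) = T' X + T' Y"
      "\<And>f X. f \<in> CM \<Longrightarrow> X \<in> VM \<Longrightarrow> T' (scale_vf f X) = scale_vf f (T' X)"
    and eq: "\<And>u. u \<in> \<gg> \<Longrightarrow> T (left_field u) = (T' (left_field u) :: 'a vfield)"
  shows "T X = T' X"
  using X
proof (induction rule: vector_field_induct)
  case zero
  have "T 0 = T 0 + T 0" "T' 0 = T' 0 + T' 0"
    using T(1)[of 0 0] T'(1)[of 0 0] by (simp_all add: vector_fields_zero[OF SM])
  then have "T 0 = 0" "T' 0 = 0" by simp_all
  then show ?case by (rule trans[OF _ sym])
next
  case (add X Y)
  show ?case by (simp only: T(1)[OF add(1,2)] T'(1)[OF add(1,2)] add(3,4))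
next
  case (scale f u)
  note u = left_field_vector_field[OF scale(2)]
  show ?case by (simp only: T(2)[OF scale(1) u] T'(2)[OF scale(1) u] eq[OF scale(2)])
qed

text \<open>A connection is not tensorial in the second slot, but the additional Leibniz term
  \<open>scale_vf (app_vf X f) Y\<close> is the same for \<open>D\<close> and
  \<open>D'\<close>.\<close>

lemma connection_eqI:
  assumes D: "linear_connection M D" and D': "linear_connection M D'"
    and eq: "\<And>u v. u \<in> \<gg> \<Longrightarrow> v \<in> \<gg> \<Longrightarrow> D (left_field u) (left_field v) = D' (left_field u) (left_field v)"
  shows "D = D'"
proof (intro ext)
  fix X Y p f
  have "D X Y = D' X Y" if X: "X \<in> VM" and Y: "Y \<in> VM"
  proof (rule tensor_eqI[OF X])
    fix u assume u': "u \<in> \<gg>"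
    note u = left_field_vector_field[OF u']
    from Y show "D (left_field u) Y = D' (left_field u) Y"
    proof (induction rule: vector_field_induct)
      case (scale h v)
      then show ?case
        by (simp add: conn_scale2[OF SM D _ u] conn_scale2[OF SM D' _ u] left_field_vector_field eq u')
    next
      case zero
      show ?case by (rule trans[OF conn_zero2[OF SM D u] conn_zero2[OF SM D' u, symmetric]])
    next
      case (add Y Z)
      show ?case by (simp only: conn_add2[OF SM D u add(1,2)] conn_add2[OF SM D' u add(1,2)] add(3,4))
    qed
  qed (use Y in \<open>simp_all only: conn_add1[OF SM D] conn_add1[OF SM D'] conn_scale1[OF SM D] conn_scale1[OF SM D']\<close>)
  then show "D X Y p f = D' X Y p f"
    using conn_outside[OF SM D, of X Y] conn_outside[OF SM D', of X Y] by metis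
qed

lemma product_apply:
  assumes \<beta>: "bilinear_product_on (\<gg>) \<beta>" and u: "u \<in> \<gg>" and v: "v \<in> \<gg>"
  shows "\<beta> u v f = (\<Sum>i\<in>B. \<Sum>j\<in>B. u (x i) * v (x j) * \<beta> (c i) (c j) f)"
proof -
  have "\<beta> u v = \<beta> (\<Sum>i\<in>B. u (x i) *\<^sub>R c i) (\<Sum>j\<in>B. v (x j) *\<^sub>R c j)"
    by (rule arg_cong2[OF frame[OF u] frame[OF v]])
  also have "\<dots> = (\<Sum>i\<in>B. \<Sum>j\<in>B. (u (x i) * v (x j)) *\<^sub>R \<beta> (c i) (c j))"
    by (rule bilinear_product_sum[OF subspace_lie_alg \<beta> c c])
  finally show ?thesis by (simp add: sum_fun_apply scaleR_fun_def)
qed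

text \<open>The witness differentiates the coefficients of \<open>Y\<close> along \<open>X\<close>
  and adds the value of \<beta> on the coefficients of both fields. Left invariant fields have
  constant coefficients, so on them only the part with \<beta> remains.\<close>

lemma connection_exists:
  assumes \<beta>: "bilinear_product_on (\<gg>) \<beta>"
  shows "\<exists>D. linear_connection M D \<and>
    (\<forall>u\<in>\<gg>. \<forall>v\<in>\<gg>. D (left_field u) (left_field v) = left_field (\<beta> u v))"
proof -
  define E where "E = (\<lambda>X Y. (\<Sum>j\<in>B. scale_vf (app_vf X (coef j Y)) (left_field (c j))) +
    (\<Sum>i\<in>B. \<Sum>j\<in>B. scale_vf (\<lambda>p. coef i X p * coef j Y p) (left_field (\<beta> (c i) (c j)))))"
  define D where "D = (\<lambda>X Y. if X \<in> VM \<and> Y \<in> VM then E X Y else 0)"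
  have \<beta>c: "\<beta> (c i) (c j) \<in> \<gg>" for i j by (rule bilinear_product_onD(1)[OF \<beta> c c])
  have E: "E X Y p f = (\<Sum>j\<in>B. app_vf X (coef j Y) p * left_field (c j) p f) +
      (\<Sum>i\<in>B. \<Sum>j\<in>B. coef i X p * coef j Y p * left_field (\<beta> (c i) (c j)) p f)" for X Y p f
    by (simp add: E_def sum_fun_apply scale_vf_def scaleR_fun_def)
  have D_eq: "D X Y = E X Y" if "X \<in> VM" "Y \<in> VM" for X Y
    using that by (simp add: D_def)
  have "linear_connection M D"
    unfolding linear_connection_def
  proof (intro conjI ballI allI impI)
    fix X Y assume X: "X \<in> VM" and Y: "Y \<in> VM"
    have "E X Y \<in> VM"
      unfolding E_def
      by (intro vector_fields_add[OF SM] vector_fields_sum[OF SM] vector_fields_scale[OF SM]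
          left_field_vector_field c \<beta>c smooth_functions_mult[OF SM] coef_smooth X Y vector_field_app)
    then show "D X Y \<in> VM" using X Y by (simp add: D_eq)
  next
    fix X X' Y assume X: "X \<in> VM" "X' \<in> VM" and Y: "Y \<in> VM"
    have "E (X + X') Y = E X Y + E X' Y"
      by (simp add: fun_eq_iff E coef_add app_vf_def sum.distrib algebra_simps)
    then show "D (X + X') Y = D X Y + D X' Y" using X Y by (simp add: D_eq vector_fields_add[OF SM])
  next
    fix X Y Y' assume X: "X \<in> VM" and Y: "Y \<in> VM" "Y' \<in> VM"
    have "E X (Y + Y') = E X Y + E X Y'"
      using X Y by (simp add: fun_eq_iff E coef_add app_vf_fun_add[OF SM] coef_smooth sum.distrib algebra_simps)
    then show "D X (Y + Y') = D X Y + D X Y'" using X Y by (simp add: D_eq vector_fields_add[OF SM])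
  next
    fix g X Y assume g: "g \<in> CM" and X: "X \<in> VM" and Y: "Y \<in> VM"
    have "app_vf (scale_vf g X) h p = g p * app_vf X h p" for h p
      by (simp add: app_vf_def scale_vf_def scaleR_fun_def)
    then have "E (scale_vf g X) Y p f = g p * E X Y p f" for p f
      by (simp add: E coef_scale sum_distrib_left algebra_simps)
    then have "E (scale_vf g X) Y = scale_vf g (E X Y)"
      by (simp add: fun_eq_iff scale_vf_def scaleR_fun_def)
    then show "D (scale_vf g X) Y = scale_vf g (D X Y)" using g X Y by (simp add: D_eq vector_fields_scale[OF SM])
    \<comment> \<open>For the Leibniz rule: the additional terms
      \<open>app_vf X g p * coef b Y p\<close> on the frame have to add up to a multiple of
      \<open>Y\<close>, and the expansion of \<open>Y\<close> provides this.\<close>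
    have "Y p f = (\<Sum>b\<in>B. coef b Y p * left_field (c b) p f)" for p f
      using fun_cong[OF fun_cong[OF vector_field_expansion[OF Y]], of p f]
      by (simp add: sum_fun_apply scale_vf_def scaleR_fun_def)
    then have "E X (scale_vf g Y) p f = g p * E X Y p f + app_vf X g p * Y p f" for p f
      using g X Y by (simp add: E coef_scale app_vf_fun_mult[OF SM] coef_smooth sum.distrib sum_distrib_left algebra_simps)
    then have "E X (scale_vf g Y) = scale_vf g (E X Y) + scale_vf (app_vf X g) Y"
      by (simp add: fun_eq_iff scale_vf_def scaleR_fun_def)
    then show "D X (scale_vf g Y) = scale_vf g (D X Y) + scale_vf (app_vf X g) Y"
      using g X Y by (simp add: D_eq vector_fields_scale[OF SM])
  next
    fix X Y assume "X \<notin> VM \<or> Y \<notin> VM"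
    then show "D X Y = 0" by (auto simp: D_def)
  qed
  moreover have "D (left_field u) (left_field v) = left_field (\<beta> u v)" if u: "u \<in> \<gg>" and v: "v \<in> \<gg>" for u v
  proof -
    have "left_field (\<beta> u v) p f = (\<Sum>i\<in>B. \<Sum>j\<in>B. u (x i) * v (x j) * left_field (\<beta> (c i) (c j)) p f)" for p f
      by (simp add: left_field_def product_apply[OF \<beta> u v])
    then have "E (left_field u) (left_field v) = left_field (\<beta> u v)"
      by (simp add: fun_eq_iff E coef_left_field app_vf_fun_const[OF SM left_field_vector_field[OF u]])
    then show ?thesis using u v by (simp add: D_eq left_field_vector_field)
  qed
  ultimately show ?thesis by blast
qed

text \<open>Both sides obey the same rules for sums and for scaling, functions being transported to
  \<open>g (F' p)\<close>, and \<open>app_push\<close> matches the derivative terms of the Leibniz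
  rule. So the generators of \<open>vector_field_induct\<close> decide.\<close>

lemma invariant_connectionI:
  assumes D: "linear_connection M D"
    and F: "smooth_map M M F" "smooth_map M M F'" "\<And>x. F (F' x) = x" "\<And>x. F' (F x) = x"
    and inv: "\<And>u v. u \<in> \<gg> \<Longrightarrow> v \<in> \<gg> \<Longrightarrow>
      D (push_vf F (left_field u)) (push_vf F (left_field v)) = push_vf F (D (left_field u) (left_field v))"
  shows "invariant_connection M F D"
  unfolding invariant_connection_def
proof (intro ballI)
  fix X Y assume X: "X \<in> VM" and Y: "Y \<in> VM"
  note push = push_add[OF SM F] push_zero[OF SM F] push_scale[OF SM F]
  note pvf = push_vector_field[OF SM F]
  have F'_smooth: "(\<lambda>p. g (F' p)) \<in> CM" if "g \<in> CM" for g
    by (rule smooth_functions_comp[OF SM SM that F(2)])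
  from X show "D (push_vf F X) (push_vf F Y) = push_vf F (D X Y)"
  proof (induction rule: vector_field_induct)
    case (scale g u)
    have u: "left_field u \<in> VM" by (rule left_field_vector_field[OF scale(2)])
    from Y have "D (push_vf F (left_field u)) (push_vf F Y) = push_vf F (D (left_field u) Y)"
    proof (induction rule: vector_field_induct)
      case (scale h v)
      have v: "left_field v \<in> VM" by (rule left_field_vector_field[OF scale(2)])
      show ?case
        unfolding push(3) conn_scale2[OF SM D F'_smooth[OF scale(1)] pvf[OF u] pvf[OF v]]
          conn_scale2[OF SM D scale(1) u v] push(1) app_push[OF SM F] inv[OF \<open>u \<in> \<gg>\<close> scale(2)] ..
    next
      case zero
      show ?case unfolding push(2) conn_zero2[OF SM D pvf[OF u]] conn_zero2[OF SM D u] ..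
    next
      case (add Y Z)
      show ?case
        unfolding push(1) conn_add2[OF SM D pvf[OF u] pvf[OF add(1)] pvf[OF add(2)]]
          conn_add2[OF SM D u add(1,2)] add(3,4) ..
    qed
    then show ?case
      unfolding push(3) conn_scale1[OF SM D F'_smooth[OF scale(1)] pvf[OF u] pvf[OF Y]]
        conn_scale1[OF SM D scale(1) u Y] by (rule arg_cong)
  next
    case zero
    show ?case unfolding push(2) conn_zero1[OF SM D pvf[OF Y]] conn_zero1[OF SM D Y] ..
  next
    case (add X Z)
    show ?case
      unfolding push(1) conn_add1[OF SM D pvf[OF add(1)] pvf[OF add(2)] pvf[OF Y]]
        conn_add1[OF SM D add(1,2) Y] add(3,4) ..
  qed
qed

subsection \<open>Invariance of a bilinear product under the adjoint representation\<close>

definition Ad_invariant :: "('a tangent \<Rightarrow> 'a tangent \<Rightarrow> 'a tangent) \<Rightarrow> bool" where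
  "Ad_invariant \<beta> \<longleftrightarrow> (\<forall>a. \<forall>u\<in>\<gg>. \<forall>v\<in>\<gg>. \<beta> (Ad a u) (Ad a v) = Ad a (\<beta> u v))"

definition ad_derivation :: "('a tangent \<Rightarrow> 'a tangent \<Rightarrow> 'a tangent) \<Rightarrow> bool" where
  "ad_derivation \<beta> \<longleftrightarrow> (\<forall>w\<in>\<gg>. \<forall>u\<in>\<gg>. \<forall>v\<in>\<gg>.
    br w (\<beta> u v) = \<beta> (br w u) v + \<beta> u (br w v))"

lemma lie_bracket_product_apply:
  assumes \<beta>: "bilinear_product_on (\<gg>) \<beta>" and u: "u \<in> \<gg>" and v: "v \<in> \<gg>" and w: "w \<in> \<gg>"
  shows "br w (\<beta> u v) f = (\<Sum>i\<in>B. \<Sum>j\<in>B. u (x i) * v (x j) * br w (\<beta> (c i) (c j)) f)"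
proof -
  have br: "bilinear_product_on (\<gg>) (br)" using lie_algebra by (simp add: lie_algebra_on_def)
  note D = bilinear_product_onD[OF \<beta>] bilinear_product_onD[OF br]
  have "bilinear_product_on (\<gg>) (\<lambda>u v. br w (\<beta> u v))"
    using w by (simp add: bilinear_product_on_def D)
  from product_apply[OF this u v] show ?thesis .
qed

text \<open>
  \<open>Ad_invariant\<close> says that the function \<open>s \<mapsto> Ad (inv s) (\<gamma> (Ad s u) (Ad s v)) f\<close> is constant;
  its derivative at \<open>\<one>\<close> measures the failure of \<open>ad_derivation\<close>.
\<close>

lemma Ad_twist_expand:
  assumes "bilinear_product_on \<gg> \<gamma>" "u \<in> \<gg>" "v \<in> \<gg>"
  shows "Ad (inv s) (\<gamma> (Ad s u) (Ad s v)) f =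
    (\<Sum>i\<in>B. \<Sum>j\<in>B. Ad s u (x i) * (Ad s v (x j) * Ad (inv s) (\<gamma> (c i) (c j)) f))"
  using assms unfolding Ad_def[of "inv s"] by (simp add: product_apply[of \<gamma>] Ad_closed mult_ac)

lemma smooth_Ad_inv: "z \<in> \<gg> \<Longrightarrow> f \<in> CM \<Longrightarrow> (\<lambda>a. Ad (inv a) z f) \<in> CM"
  by (rule smooth_functions_comp[OF SM SM smooth_Ad smooth_inv[OF SM smooth_map_id[OF SM]]])

lemma smooth_Ad_twist:
  assumes \<gamma>: "bilinear_product_on \<gg> \<gamma>" and u: "u \<in> \<gg>" and v: "v \<in> \<gg>" and f: "f \<in> CM"
  shows "(\<lambda>s. Ad (inv s) (\<gamma> (Ad s u) (Ad s v)) f) \<in> CM"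
  unfolding Ad_twist_expand[OF \<gamma> u v]
  by (intro smooth_functions_sum[OF SM] smooth_functions_mult[OF SM] smooth_Ad smooth_Ad_inv x u v f
      bilinear_product_onD(1)[OF \<gamma>] c)

text \<open>Product rule for the three factors of the expansion: \<open>Ad s u\<close> and
  \<open>Ad s v\<close> contribute brackets by \<open>tangent_Ad\<close>, the factor with
  \<open>inv s\<close> contributes a bracket with a minus sign by \<open>tangent_inv\<close>. The
  frame sums are then folded back into products.\<close>

lemma tangent_Ad_twist:
  assumes \<gamma>: "bilinear_product_on \<gg> \<gamma>"
    and w: "w \<in> \<gg>" and u: "u \<in> \<gg>" and v: "v \<in> \<gg>" and f: "f \<in> CM"
  shows "w (\<lambda>s. Ad (inv s) (\<gamma> (Ad s u) (Ad s v)) f) = (\<gamma> (br w u) v + \<gamma> u (br w v) - br w (\<gamma> u v)) f"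
proof -
  note w' = w[unfolded lie_alg_tangent]
  note mem = bilinear_product_onD(1)[OF \<gamma>] lie_bracket_closed Ad_closed
  have "w (\<lambda>s. Ad (inv s) (\<gamma> (Ad s u) (Ad s v)) f) =
      (\<Sum>i\<in>B. \<Sum>j\<in>B. w (\<lambda>s. Ad s u (x i) * (Ad s v (x j) * Ad (inv s) (\<gamma> (c i) (c j)) f)))"
    unfolding Ad_twist_expand[OF \<gamma> u v]
    by (simp add: tangent_sum[OF SM w'] smooth_functions_sum[OF SM] smooth_functions_mult[OF SM]
        smooth_Ad smooth_Ad_inv x u v mem c f)
  also have "\<dots> = (\<Sum>i\<in>B. \<Sum>j\<in>B. u (x i) * (v (x j) * - br w (\<gamma> (c i) (c j)) f +
      \<gamma> (c i) (c j) f * br w v (x j)) + v (x j) * \<gamma> (c i) (c j) f * br w u (x i))"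
    by (simp add: tangent_mult[OF w'] smooth_functions_mult[OF SM] smooth_Ad smooth_Ad_inv u v mem c f x
        tangent_Ad[OF w _ x] tangent_Ad[OF w _ f] tangent_inv[OF w smooth_Ad])
  also have "\<dots> = \<gamma> (br w u) v f + \<gamma> u (br w v) f - br w (\<gamma> u v) f"
    using u v w
    by (simp add: product_apply[OF \<gamma>] lie_bracket_product_apply[OF \<gamma>] mem sum.distrib sum_subtractf algebra_simps sum_negf)
  finally show ?thesis by simp
qed

lemma Ad_invariant_imp_derivation:
  assumes \<beta>: "bilinear_product_on \<gg> \<beta>" and inv: "Ad_invariant \<beta>"
  shows "ad_derivation \<beta>"
  unfolding ad_derivation_def
proof (intro ballI)
  fix w u v assume w: "w \<in> \<gg>" and u: "u \<in> \<gg>" and v: "v \<in> \<gg>"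
  note mem = bilinear_product_onD(1)[OF \<beta>] lie_bracket_closed subspace_add[OF subspace_lie_alg]
  have "br w (\<beta> u v) \<in> \<gg>" "\<beta> (br w u) v + \<beta> u (br w v) \<in> \<gg>" by (intro mem u v w)+
  then show "br w (\<beta> u v) = \<beta> (br w u) v + \<beta> u (br w v)"
    unfolding lie_alg_tangent
  proof (rule tangent_eqI)
    fix f assume f: "f \<in> CM"
    have "Ad (inv s) (\<beta> (Ad s u) (Ad s v)) f = \<beta> u v f" for s
      using inv u v by (simp add: Ad_invariant_def)
    then show "br w (\<beta> u v) f = (\<beta> (br w u) v + \<beta> u (br w v)) f"
      using tangent_Ad_twist[OF \<beta> w u v f] tangent_const[OF SM w[unfolded lie_alg_tangent]] by simp
  qed
qed

lemma derivation_imp_Ad_invariant: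
  assumes \<beta>: "bilinear_product_on \<gg> \<beta>" and der: "ad_derivation \<beta>"
    and conn: "connected (UNIV :: 'a set)"
  shows "Ad_invariant \<beta>"
proof -
  have const: "Ad (inv a) (\<beta> (Ad a u) (Ad a v)) f = \<beta> u v f"
    if u: "u \<in> \<gg>" and v: "v \<in> \<gg>" and f: "f \<in> CM" for a u v f
  proof -
    define h where "h = (\<lambda>a. Ad (inv a) (\<beta> (Ad a u) (Ad a v)) f)"
    have h: "h \<in> CM" unfolding h_def by (rule smooth_Ad_twist[OF \<beta> u v f])
    have "h a = h \<one>"
    proof (rule tangent_vanishing_constant[OF SM h _ conn])
      fix p w assume w: "w \<in> \<T> M p"
      obtain w' where w': "w' \<in> \<gg>" "\<And>f. w f = w' (\<lambda>s. f (p \<otimes> s))" using tangent_translate[OF w] by blast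
      \<comment> \<open>Since \<open>Ad (p \<otimes> s) u = Ad p (Ad s u)\<close>, the value of
        \<open>h\<close> at \<open>p \<otimes> s\<close> is the twist of \<gamma> at
        \<open>s\<close>, so \<open>w h\<close> is a derivative at the identity. By
        \<open>Ad_bracket\<close>, \<gamma> satisfies the Leibniz rule along with \<beta>.\<close>
      define \<gamma> where "\<gamma> = (\<lambda>u v. Ad (inv p) (\<beta> (Ad p u) (Ad p v)))"
      have \<gamma>: "bilinear_product_on \<gg> \<gamma>"
        using bilinear_product_onD[OF \<beta>] by (simp add: bilinear_product_on_def \<gamma>_def Ad_closed Ad_add Ad_scale)
      have "br w' (\<gamma> u v) = Ad (inv p) (br (Ad p w') (\<beta> (Ad p u) (Ad p v)))"
        using w'(1) u v by (simp add: \<gamma>_def Ad_bracket Ad_closed bilinear_product_onD(1)[OF \<beta>])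
      also have "\<dots> = \<gamma> (br w' u) v + \<gamma> u (br w' v)"
        using der w'(1) u v by (simp add: \<gamma>_def ad_derivation_def Ad_closed Ad_bracket Ad_add)
      finally show "w h = 0"
        using tangent_Ad_twist[OF \<gamma> w'(1) u v f] by (simp add: w'(2) h_def \<gamma>_def Ad_mult)
    qed
    then show ?thesis by (simp add: h_def)
  qed
  show ?thesis
    unfolding Ad_invariant_def
  proof (intro allI ballI)
    fix a u v assume u: "u \<in> \<gg>" and v: "v \<in> \<gg>"
    have "Ad (inv a) (\<beta> (Ad a u) (Ad a v)) \<in> \<gg>" "\<beta> u v \<in> \<gg>"
      by (intro Ad_closed bilinear_product_onD(1)[OF \<beta>] u v)+
    then have "Ad (inv a) (\<beta> (Ad a u) (Ad a v)) = \<beta> u v"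
      unfolding lie_alg_tangent by (rule tangent_eqI[OF _ _ const[OF u v]])
    then show "\<beta> (Ad a u) (Ad a v) = Ad a (\<beta> u v)" by (metis Ad_inv(2))
  qed
qed

end

subsection \<open>Poisson algebras\<close>

text \<open>For the product \<beta> of a left invariant connection this is the curvature on left
  invariant fields, as \<open>connection_curvature\<close> shows; comparing curvatures becomes pure
  algebra.\<close>

definition curvature_product :: "('a \<Rightarrow> 'a \<Rightarrow> 'a) \<Rightarrow> ('a \<Rightarrow> 'a \<Rightarrow> 'a) \<Rightarrow> 'a \<Rightarrow> 'a \<Rightarrow> 'a \<Rightarrow> 'a::ab_group_add" where
  "curvature_product br \<beta> u v w = \<beta> u (\<beta> v w) - \<beta> v (\<beta> u w) - \<beta> (br u v) w"

text \<open>The elements of \<open>V\<close> are functionals so that identities can be evaluated at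
  an argument \<open>t\<close> and settled by linear arithmetic over the reals. Commutativity and
  the Leibniz rule have counterparts of their own; associativity corresponds to the curvature
  condition only in the presence of these two.\<close>

lemma poisson_product_iff:
  fixes V :: "('a \<Rightarrow> real) set"
  assumes lie: "lie_algebra_on V br" and pr: "bilinear_product_on V pr"
    and \<beta>: "\<And>u v. u \<in> V \<Longrightarrow> v \<in> V \<Longrightarrow> \<beta> u v = (1/2) *\<^sub>R br u v + pr u v"
  shows "(\<forall>u\<in>V. \<forall>v\<in>V. pr u v = pr v u) \<and>
      (\<forall>u\<in>V. \<forall>v\<in>V. \<forall>w\<in>V. pr (pr u v) w = pr u (pr v w)) \<and>
      (\<forall>u\<in>V. \<forall>v\<in>V. \<forall>w\<in>V. br u (pr v w) = pr (br u v) w + pr v (br u w)) \<longleftrightarrow>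
    (\<forall>u\<in>V. \<forall>v\<in>V. \<beta> u v - \<beta> v u = br u v) \<and>
    (\<forall>w\<in>V. \<forall>u\<in>V. \<forall>v\<in>V. br w (\<beta> u v) = \<beta> (br w u) v + \<beta> u (br w v)) \<and>
    (\<forall>u\<in>V. \<forall>v\<in>V. \<forall>w\<in>V. curvature_product br \<beta> u v w = curvature_product br (\<lambda>u v. (1/2) *\<^sub>R br u v) u v w)"
    (is "?comm \<and> ?assoc \<and> ?leib \<longleftrightarrow> ?tor \<and> ?der \<and> ?curv")
proof -
  have V: "subspace V" and br: "bilinear_product_on V br" using lie by (simp_all add: lie_algebra_on_def)
  note D = bilinear_product_onD[OF br] bilinear_product_onD[OF pr] subspace_add[OF V] subspace_scale[OF V]
  have alt: "br u v t = - br v u t" if u: "u \<in> V" and v: "v \<in> V" for u v t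
  proof -
    have "br (u + v) (u + v) = 0" "br u u = 0" "br v v = 0"
      using lie u v subspace_add[OF V u v] by (simp_all add: lie_algebra_on_def)
    then have "br u v + br v u = 0" using u v by (simp add: D add.commute)
    from fun_cong[OF this, of t] show ?thesis by simp
  qed
  have neg: "f (br u v) w t = - f (br v u) w t"
    if f: "bilinear_product_on V f" and u: "u \<in> V" and v: "v \<in> V" and w: "w \<in> V" for f u v w t
  proof -
    have "br u v = (-1) *\<^sub>R br v u" using alt[OF u v] by (simp add: fun_eq_iff)
    then have "f (br u v) w = (-1) *\<^sub>R f (br v u) w"
      using bilinear_product_onD(4)[OF f _ w, of "br v u" "-1"] u v by (simp add: D)
    then show ?thesis by simp
  qed
  \<comment> \<open>The Jacobi identity in derivation form: it makes the half bracket drop out when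
    the Leibniz rules for \<beta> and \<open>pr\<close> are compared.\<close>
  have jac: "br w (br u v) t = br (br w u) v t + br u (br w v) t"
    if "w \<in> V" "u \<in> V" "v \<in> V" for u v w t
  proof -
    have sum: "br u (br v w) + br v (br w u) + br w (br u v) = 0" using lie that by (simp add: lie_algebra_on_def)
    have "br u (br v w) t + br v (br w u) t + br w (br u v) t = 0" using fun_cong[OF sum, of t] by simp
    moreover have "br u (br v w) t = - br u (br w v) t"
      using alt[of u "br v w" t] alt[of u "br w v" t] neg[OF br that(3,1,2), of t] that by (simp add: D)
    moreover have "br v (br w u) t = - br (br w u) v t" using that by (intro alt) (simp_all add: D)
    ultimately show ?thesis by linarith
  qed
  have \<beta>_apply: "\<beta> u v t = (1/2) * br u v t + pr u v t" if "u \<in> V" "v \<in> V" for u v t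
    using \<beta>[OF that] by (simp add: scaleR_fun_def)
  have tor: "?tor \<longleftrightarrow> ?comm"
  proof -
    have "\<beta> u v - \<beta> v u = br u v \<longleftrightarrow> pr u v = pr v u" if "u \<in> V" "v \<in> V" for u v
      using that by (simp add: fun_eq_iff \<beta>_apply alt[OF that])
    then show ?thesis by blast
  qed
  have der: "?der \<longleftrightarrow> ?leib"
  proof -
    have "br w (\<beta> u v) = \<beta> (br w u) v + \<beta> u (br w v) \<longleftrightarrow> br w (pr u v) = pr (br w u) v + pr u (br w v)"
      if uvw: "w \<in> V" "u \<in> V" "v \<in> V" for u v w
    proof -
      have l: "br w (\<beta> u v) = (1/2) *\<^sub>R br w (br u v) + br w (pr u v)" using uvw by (simp add: \<beta> D)
      have "br w (\<beta> u v) t = (\<beta> (br w u) v + \<beta> u (br w v)) t \<longleftrightarrow> br w (pr u v) t = (pr (br w u) v + pr u (br w v)) t" for t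
      proof -
        have "br w (\<beta> u v) t = (1/2) * br w (br u v) t + br w (pr u v) t"
          unfolding l by (simp add: scaleR_fun_def)
        moreover have "\<beta> (br w u) v t = (1/2) * br (br w u) v t + pr (br w u) v t"
          "\<beta> u (br w v) t = (1/2) * br u (br w v) t + pr u (br w v) t"
          using uvw by (simp_all add: \<beta>_apply D)
        ultimately show ?thesis
          unfolding plus_fun_apply using jac[OF uvw, of t] by (intro iffI) linarith+
      qed
      then show ?thesis by (simp only: fun_eq_iff)
    qed
    then show ?thesis by blast
  qed
  have K: "curvature_product br \<beta> u v w t - curvature_product br (\<lambda>u v. (1/2) *\<^sub>R br u v) u v w t =
      (1/2) * br u (pr v w) t + (1/2) * pr u (br v w) t + pr u (pr v w) t -
      (1/2) * br v (pr u w) t - (1/2) * pr v (br u w) t - pr v (pr u w) t - pr (br u v) w t"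
    if "u \<in> V" "v \<in> V" "w \<in> V" for u v w t
  proof -
    have \<beta>\<beta>: "\<beta> x (\<beta> y z) = (1/2) *\<^sub>R br x ((1/2) *\<^sub>R br y z) + (1/2) *\<^sub>R br x (pr y z) +
        (1/2) *\<^sub>R pr x (br y z) + pr x (pr y z)" if "x \<in> V" "y \<in> V" "z \<in> V" for x y z
      using that by (simp add: \<beta> D scaleR_add_right)
    show ?thesis
      using that by (simp add: curvature_product_def \<beta>\<beta> D) (simp add: \<beta>_apply D scaleR_fun_def)
  qed
  have curv: "curvature_product br \<beta> u v w = curvature_product br (\<lambda>u v. (1/2) *\<^sub>R br u v) u v w \<longleftrightarrow>
      pr u (pr v w) = pr v (pr u w)" if leib: ?leib and "u \<in> V" "v \<in> V" "w \<in> V" for u v w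
  proof -
    \<comment> \<open>Each of the two Leibniz expansions contributes half of
      \<open>pr (br u v) w\<close>, and together they absorb the last term of \<open>K\<close>; the
      terms \<open>pr u (br v w)\<close> and \<open>pr v (br u w)\<close> cancel.\<close>
    have "curvature_product br \<beta> u v w t - curvature_product br (\<lambda>u v. (1/2) *\<^sub>R br u v) u v w t =
        pr u (pr v w) t - pr v (pr u w) t" for t
    proof -
      have "br u (pr v w) t = pr (br u v) w t + pr v (br u w) t" "br v (pr u w) t = pr (br v u) w t + pr u (br v w) t"
        using leib that(2-4) by simp_all
      then show ?thesis using K[OF that(2-4), of t] neg[OF pr that(2-4), of t] by argo
    qed
    then show ?thesis by (metis (no_types, lifting) eq_iff_diff_eq_0 ext)
  qed
  have assoc: "?assoc \<longleftrightarrow> (\<forall>u\<in>V. \<forall>v\<in>V. \<forall>w\<in>V. pr u (pr v w) = pr v (pr u w))" if comm: ?comm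
  proof (intro iffI ballI)
    fix u v w assume a: ?assoc and uvw: "u \<in> V" "v \<in> V" "w \<in> V"
    have "pr u (pr v w) = pr (pr u v) w" "pr v (pr u w) = pr (pr v u) w" using a uvw by simp_all
    moreover have "pr u v = pr v u" using comm uvw by blast
    ultimately show "pr u (pr v w) = pr v (pr u w)" by simp
  next
    fix u v w assume a: "\<forall>u\<in>V. \<forall>v\<in>V. \<forall>w\<in>V. pr u (pr v w) = pr v (pr u w)" and uvw: "u \<in> V" "v \<in> V" "w \<in> V"
    have "pr (pr u v) w = pr w (pr u v)" using comm uvw by (simp add: D)
    also have "\<dots> = pr u (pr w v)" using a uvw by blast
    also have "pr w v = pr v w" using comm uvw by blast
    finally show "pr (pr u v) w = pr u (pr v w)" .
  qed
  have curv': "?curv \<longleftrightarrow> (\<forall>u\<in>V. \<forall>v\<in>V. \<forall>w\<in>V. pr u (pr v w) = pr v (pr u w))" if ?leib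
    using curv[OF that] by simp
  \<comment> \<open>A propositional scheme that respects the dependencies: \<open>curv'\<close> is
    available only under the Leibniz rule, \<open>assoc\<close> only under commutativity.\<close>
  have "(P = P') \<Longrightarrow> (Q = Q') \<Longrightarrow> (Q' \<Longrightarrow> R = S) \<Longrightarrow> (P' \<Longrightarrow> T = S) \<Longrightarrow> (P' \<and> T \<and> Q') = (P \<and> Q \<and> R)" for P P' Q Q' R S T
    by blast
  from this[OF tor der curv' assoc] show ?thesis .
qed

section \<open>Torsion, curvature and invariance in terms of the product on the Lie algebra\<close>

context framed_group
begin

lemma left_field_minus_eq: "left_field u - left_field v = left_field w \<longleftrightarrow> u - v = w"
  by (simp flip: left_field_diff add: left_field_eq_iff)

lemma connection_torsion_free_iff:
  assumes D: "linear_connection M D" and \<beta>: "\<And>u v. u \<in> \<gg> \<Longrightarrow> v \<in> \<gg> \<Longrightarrow> D (left_field u) (left_field v) = left_field (\<beta> u v)"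
  shows "torsion_free M D \<longleftrightarrow> (\<forall>u\<in>\<gg>. \<forall>v\<in>\<gg>. \<beta> u v - \<beta> v u = br u v)"
proof -
  have t: "torsion D (left_field u) (left_field v) = 0 \<longleftrightarrow> \<beta> u v - \<beta> v u = br u v"
    if "u \<in> \<gg>" "v \<in> \<gg>" for u v
    using that by (simp add: torsion_def \<beta> left_field_bracket left_field_minus_eq)
  note tensor = torsion_add[OF SM D] torsion_scale[OF SM D] scale_vf_zero add_0
  have "torsion_free M D" if *: "\<And>u v. u \<in> \<gg> \<Longrightarrow> v \<in> \<gg> \<Longrightarrow> torsion D (left_field u) (left_field v) = 0"
    unfolding torsion_free_def
  proof (intro ballI)
    fix X Y assume X: "X \<in> VM" and Y: "Y \<in> VM"
    show "torsion D X Y = 0"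
    proof (rule tensor_eqI[OF X, where T' = "\<lambda>_. 0"])
      fix u assume u: "u \<in> \<gg>"
      have "torsion D Y (left_field u) = 0"
        by (rule tensor_eqI[OF Y, where T' = "\<lambda>_. 0"])
          (simp_all only: tensor left_field_vector_field[OF u] *[OF _ u])
      then show "torsion D (left_field u) Y = 0"
        by (simp only: torsion_swap[OF SM D, of "left_field u" Y] minus_zero)
    qed (simp_all only: tensor Y)
  qed
  moreover have "torsion D (left_field u) (left_field v) = 0" if "torsion_free M D" "u \<in> \<gg>" "v \<in> \<gg>" for u v
    using that by (simp add: torsion_free_def left_field_vector_field)
  ultimately show ?thesis using t by blast
qed

lemma connection_curvature:
  assumes "\<And>u v. u \<in> \<gg> \<Longrightarrow> v \<in> \<gg> \<Longrightarrow> D (left_field u) (left_field v) = left_field (\<beta> u v)"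
    and "\<And>u v. u \<in> \<gg> \<Longrightarrow> v \<in> \<gg> \<Longrightarrow> \<beta> u v \<in> \<gg>"
    and "u \<in> \<gg>" "v \<in> \<gg>" "w \<in> \<gg>"
  shows "curvature D (left_field u) (left_field v) (left_field w) =
    left_field (curvature_product (br) \<beta> u v w)"
  using assms by (simp add: curvature_def curvature_product_def left_field_bracket lie_bracket_closed left_field_diff)

lemma same_curvature_iff:
  assumes D: "linear_connection M D" and D': "linear_connection M D'"
    and \<beta>: "\<And>u v. u \<in> \<gg> \<Longrightarrow> v \<in> \<gg> \<Longrightarrow> D (left_field u) (left_field v) = left_field (\<beta> u v)"
      "\<And>u v. u \<in> \<gg> \<Longrightarrow> v \<in> \<gg> \<Longrightarrow> \<beta> u v \<in> \<gg>"
    and \<beta>': "\<And>u v. u \<in> \<gg> \<Longrightarrow> v \<in> \<gg> \<Longrightarrow> D' (left_field u) (left_field v) = left_field (\<beta>' u v)"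
      "\<And>u v. u \<in> \<gg> \<Longrightarrow> v \<in> \<gg> \<Longrightarrow> \<beta>' u v \<in> \<gg>"
  shows "same_curvature M D D' \<longleftrightarrow> (\<forall>u\<in>\<gg>. \<forall>v\<in>\<gg>. \<forall>w\<in>\<gg>.
    curvature_product (br) \<beta> u v w = curvature_product (br) \<beta>' u v w)"
proof -
  have t: "curvature D (left_field u) (left_field v) (left_field w) = curvature D' (left_field u) (left_field v) (left_field w) \<longleftrightarrow>
      curvature_product (br) \<beta> u v w = curvature_product (br) \<beta>' u v w"
    if "u \<in> \<gg>" "v \<in> \<gg>" "w \<in> \<gg>" for u v w
    by (simp only: connection_curvature[where D = D and \<beta> = \<beta>, OF \<beta> that]
        connection_curvature[where D = D' and \<beta> = \<beta>', OF \<beta>' that] left_field_eq_iff)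
  have "same_curvature M D D'" if *: "\<And>u v w. u \<in> \<gg> \<Longrightarrow> v \<in> \<gg> \<Longrightarrow> w \<in> \<gg> \<Longrightarrow>
      curvature D (left_field u) (left_field v) (left_field w) = curvature D' (left_field u) (left_field v) (left_field w)"
    unfolding same_curvature_def
  proof (intro ballI)
    fix X Y Z assume X: "X \<in> VM" and Y: "Y \<in> VM" and Z: "Z \<in> VM"
    note tensor1 = curvature_add1[OF SM D] curvature_scale1[OF SM D] curvature_add1[OF SM D'] curvature_scale1[OF SM D']
    note tensor3 = curvature_add3[OF SM D] curvature_scale3[OF SM D] curvature_add3[OF SM D'] curvature_scale3[OF SM D']
    show "curvature D X Y Z = curvature D' X Y Z"
    proof (rule tensor_eqI[OF X])
      fix u assume u: "u \<in> \<gg>"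
      note u' = left_field_vector_field[OF u]
      \<comment> \<open>Antisymmetry moves the second slot to the front, so that linearity in the
        first and third slots suffices.\<close>
      have "curvature D Y (left_field u) Z = curvature D' Y (left_field u) Z"
      proof (rule tensor_eqI[OF Y])
        fix v assume v: "v \<in> \<gg>"
        show "curvature D (left_field v) (left_field u) Z = curvature D' (left_field v) (left_field u) Z"
          by (rule tensor_eqI[OF Z]) (simp_all only: tensor3 u' left_field_vector_field[OF v] *[OF v u])
      qed (simp_all only: tensor1 u' Z)
      then show "curvature D (left_field u) Y Z = curvature D' (left_field u) Y Z"
        by (simp only: curvature_swap[OF SM D u' Y Z] curvature_swap[OF SM D' u' Y Z])
    qed (simp_all only: tensor1 Y Z)
  qed
  moreover have "curvature D (left_field u) (left_field v) (left_field w) = curvature D' (left_field u) (left_field v) (left_field w)"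
    if "same_curvature M D D'" "u \<in> \<gg>" "v \<in> \<gg>" "w \<in> \<gg>" for u v w
    using that by (simp add: same_curvature_def left_field_vector_field)
  ultimately show ?thesis using t by blast
qed

lemma connection_left_invariant:
  assumes D: "linear_connection M D" and \<beta>: "\<And>u v. u \<in> \<gg> \<Longrightarrow> v \<in> \<gg> \<Longrightarrow> D (left_field u) (left_field v) = left_field (\<beta> u v)"
  shows "left_invariant_connection G D"
  unfolding left_invariant_connection_def
proof
  fix a
  show "invariant_connection M (\<lambda>x. a \<otimes> x) D"
    by (rule invariant_connectionI[OF D left_facts]) (simp add: push_left_field \<beta>)
qed

lemma connection_bi_invariant_iff:
  assumes D: "linear_connection M D" and \<beta>: "\<And>u v. u \<in> \<gg> \<Longrightarrow> v \<in> \<gg> \<Longrightarrow> D (left_field u) (left_field v) = left_field (\<beta> u v)"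
  shows "bi_invariant_connection G D \<longleftrightarrow> Ad_invariant \<beta>"
proof
  assume "Ad_invariant \<beta>"
  then have "\<beta> (Ad a u) (Ad a v) = Ad a (\<beta> u v)" if "u \<in> \<gg>" "v \<in> \<gg>" for a u v
    using that by (simp add: Ad_invariant_def)
  then have right: "invariant_connection M (\<lambda>x. x \<otimes> a) D" for a
    by (intro invariant_connectionI[OF D right_facts]) (simp add: push_right_left_field \<beta> Ad_closed)
  have left: "left_invariant_connection G D"
    by (rule connection_left_invariant[where \<beta> = \<beta>, OF D \<beta>])
  show "bi_invariant_connection G D"
    unfolding bi_invariant_connection_def by (intro conjI allI left right)
next
  assume bi: "bi_invariant_connection G D"
  show "Ad_invariant \<beta>"
    unfolding Ad_invariant_def
  proof (intro allI ballI)
    fix a u v assume uv: "u \<in> \<gg>" "v \<in> \<gg>"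
    \<comment> \<open>Right translation by \<open>inv a\<close> is chosen because it acts on left
      invariant fields as \<open>Ad (inv (inv a))\<close>, that is, as \<open>Ad a\<close>.\<close>
    have "D (push_vf (\<lambda>x. x \<otimes> inv a) (left_field u)) (push_vf (\<lambda>x. x \<otimes> inv a) (left_field v)) =
        push_vf (\<lambda>x. x \<otimes> inv a) (D (left_field u) (left_field v))"
      using bi uv by (simp add: bi_invariant_connection_def invariant_connection_def left_field_vector_field)
    then show "\<beta> (Ad a u) (Ad a v) = Ad a (\<beta> u v)"
      using uv by (simp add: push_right_left_field \<beta> Ad_closed left_field_eq_iff)
  qed
qed

text \<open>Invariance of \<open>D\<close> makes its value on two left invariant fields left
  invariant again, hence determined at the identity. This is why the product carries all information
  about \<open>D\<close>.\<close>

lemma left_invariant_connection_product: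
  assumes D: "linear_connection M D" and inv: "left_invariant_connection G D"
    and u: "u \<in> \<gg>" and v: "v \<in> \<gg>"
  shows "D (left_field u) (left_field v) = left_field (D (left_field u) (left_field v) \<one>)"
proof (rule left_invariant_eq)
  fix a
  have "push_vf (\<lambda>x. a \<otimes> x) (D (left_field u) (left_field v)) =
      D (push_vf (\<lambda>x. a \<otimes> x) (left_field u)) (push_vf (\<lambda>x. a \<otimes> x) (left_field v))"
    using inv u v by (simp add: left_invariant_connection_def invariant_connection_def left_field_vector_field)
  then show "push_vf (\<lambda>x. a \<otimes> x) (D (left_field u) (left_field v)) = D (left_field u) (left_field v)"
    by (simp add: push_left_field)
qed

lemma connection_product_bilinear:
  assumes D: "linear_connection M D"
  shows "bilinear_product_on (\<gg>) (\<lambda>u v. D (left_field u) (left_field v) \<one>)"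
  unfolding bilinear_product_on_def
proof (intro conjI ballI allI)
  fix u v w assume *: "u \<in> \<gg>" "v \<in> \<gg>" "w \<in> \<gg>"
  note lf = *[THEN left_field_vector_field]
  show "D (left_field (u + v)) (left_field w) \<one> = D (left_field u) (left_field w) \<one> + D (left_field v) (left_field w) \<one>"
    by (simp add: left_field_add conn_add1[OF SM D lf])
  show "D (left_field u) (left_field (v + w)) \<one> = D (left_field u) (left_field v) \<one> + D (left_field u) (left_field w) \<one>"
    by (simp add: left_field_add conn_add2[OF SM D lf])
next
  fix r u v assume *: "u \<in> \<gg>" "v \<in> \<gg>"
  note lf = *[THEN left_field_vector_field]
  show "D (left_field u) (left_field v) \<one> \<in> \<gg>"
    unfolding lie_alg_tangent by (rule vector_field_tangent[OF conn_closed[OF SM D lf]])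
  show "D (left_field (r *\<^sub>R u)) (left_field v) \<one> = r *\<^sub>R D (left_field u) (left_field v) \<one>"
    unfolding left_field_scale conn_cmult1[OF SM D lf] by (simp add: scaleR_fun_def)
  show "D (left_field u) (left_field (r *\<^sub>R v)) \<one> = r *\<^sub>R D (left_field u) (left_field v) \<one>"
    unfolding left_field_scale conn_cmult2[OF SM D lf] by (simp add: scaleR_fun_def)
qed

text \<open>The factor \<open>r\<close> is free because both signs occur: 1/2 leads from the product
  \<open>pr\<close> to that of the connection, -1/2 leads back, and 1/2 with the zero product gives
  the half bracket itself.\<close>

lemma bilinear_product_half_bracket_add:
  assumes pr: "bilinear_product_on (\<gg>) pr"
  shows "bilinear_product_on (\<gg>) (\<lambda>u v. r *\<^sub>R br u v + pr u v)"
proof -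
  have br: "bilinear_product_on (\<gg>) (br)" using lie_algebra by (simp add: lie_algebra_on_def)
  show ?thesis
    using subspace_add[OF subspace_lie_alg] subspace_scale[OF subspace_lie_alg]
    by (simp add: bilinear_product_on_def bilinear_product_onD[OF br] bilinear_product_onD[OF pr]
        scaleR_add_right add_ac scaleR_left_commute)
qed

text \<open>\<open>D\<close> and \<open>pr\<close> are only assumed to be related by
  \<open>D_eq\<close>, so the equivalence serves both claims: the one where \<open>pr\<close> is
  read off from \<open>D\<close>, and the one where \<open>D\<close> is prescribed by
  \<open>pr\<close>.\<close>

theorem poisson_iff_connection:
  assumes conn: "connected (UNIV :: 'a set)"
    and D: "linear_connection M D" and D0: "linear_connection M D0"
    and D0_eq: "\<And>u v. u \<in> \<gg> \<Longrightarrow> v \<in> \<gg> \<Longrightarrow>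
      D0 (left_field u) (left_field v) = left_field ((1/2) *\<^sub>R br u v)"
    and pr: "bilinear_product_on (\<gg>) pr"
    and D_eq: "\<And>u v. u \<in> \<gg> \<Longrightarrow> v \<in> \<gg> \<Longrightarrow>
      D (left_field u) (left_field v) = left_field ((1/2) *\<^sub>R br u v + pr u v)"
  shows "poisson_algebra (\<gg>) (br) pr \<longleftrightarrow>
    torsion_free M D \<and> bi_invariant_connection G D \<and> same_curvature M D D0"
proof -
  define \<beta> where "\<beta> = (\<lambda>u v. (1/2) *\<^sub>R br u v + pr u v)"
  have \<beta>: "bilinear_product_on (\<gg>) \<beta>"
    unfolding \<beta>_def by (rule bilinear_product_half_bracket_add[OF pr])
  have D\<beta>: "D (left_field u) (left_field v) = left_field (\<beta> u v)" if "u \<in> \<gg>" "v \<in> \<gg>" for u v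
    using D_eq[OF that] by (simp add: \<beta>_def)
  have half: "(1/2) *\<^sub>R br u v \<in> \<gg>" if "u \<in> \<gg>" "v \<in> \<gg>" for u v
    by (intro subspace_scale[OF subspace_lie_alg] lie_bracket_closed that)
  have bi: "bi_invariant_connection G D \<longleftrightarrow> ad_derivation \<beta>"
    using connection_bi_invariant_iff[where \<beta> = \<beta>, OF D D\<beta>] Ad_invariant_imp_derivation[OF \<beta>]
      derivation_imp_Ad_invariant[OF \<beta> _ conn] by blast
  have tor: "torsion_free M D \<longleftrightarrow> (\<forall>u\<in>\<gg>. \<forall>v\<in>\<gg>. \<beta> u v - \<beta> v u = br u v)"
    by (rule connection_torsion_free_iff[OF D]) (rule D\<beta>)
  have curv: "same_curvature M D D0 \<longleftrightarrow> (\<forall>u\<in>\<gg>. \<forall>v\<in>\<gg>. \<forall>w\<in>\<gg>.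
      curvature_product (br) \<beta> u v w =
      curvature_product (br) (\<lambda>u v. (1/2) *\<^sub>R br u v) u v w)"
    by (rule same_curvature_iff[OF D D0]) (auto intro: D\<beta> D0_eq half bilinear_product_onD(1)[OF \<beta>])
  have fin: "\<exists>B. finite B \<and> span B = \<gg>"
    unfolding lie_alg_def by (rule tangent_space_finite_dim[OF SM])
  have "\<beta> u v = (1/2) *\<^sub>R br u v + pr u v" for u v by (simp add: \<beta>_def)
  from poisson_product_iff[OF lie_algebra pr this]
  show ?thesis
    by (simp only: poisson_algebra_def tor bi ad_derivation_def curv fin lie_algebra pr simp_thms)
qed

end

theorem theorem2p1:
  fixes G :: "('g::{t2_space, second_countable_topology}, 'e::real_inner) lie_group_data"
  assumes "lie_group G" and "connected (UNIV :: 'g set)"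
  shows "(\<exists>!D0. left_invariant_connection G D0 \<and> connection_given_by G (half_bracket G) D0) \<and>
    (\<forall>D0. left_invariant_connection G D0 \<and> connection_given_by G (half_bracket G) D0 \<longrightarrow>
      (\<forall>D. linear_connection (atlas G) D \<and> left_invariant_connection G D \<longrightarrow>
        (poisson_algebra (lie_alg G) (lie_bracket G)
           (\<lambda>u v. D (left_inv_field G u) (left_inv_field G v) \<one>\<^bsub>G\<^esub>
                    - (1/2) *\<^sub>R lie_bracket G u v)
         \<longleftrightarrow> torsion_free (atlas G) D \<and> bi_invariant_connection G D \<and>
             same_curvature (atlas G) D D0)) \<and>
      (\<forall>pr. poisson_algebra (lie_alg G) (lie_bracket G) pr \<longrightarrow>
        (\<exists>!D. connection_given_by G (\<lambda>u v. half_bracket G u v + left_inv_field G (pr u v)) D) \<and>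
        (\<forall>D. connection_given_by G (\<lambda>u v. half_bracket G u v + left_inv_field G (pr u v)) D \<longrightarrow>
           torsion_free (atlas G) D \<and> bi_invariant_connection G D \<and>
           same_curvature (atlas G) D D0)))"
proof -
  interpret smooth_group G by standard (rule assms(1))
  obtain B :: "'e set" and c x where frame: "finite B" "\<And>b. c b \<in> tangent_space (atlas G) \<one>\<^bsub>G\<^esub>"
    "\<And>b. x b \<in> smooth_functions (atlas G)"
    "\<And>u. u \<in> tangent_space (atlas G) \<one>\<^bsub>G\<^esub> \<Longrightarrow> u = (\<Sum>b\<in>B. u (x b) *\<^sub>R c b)"
    using tangent_frame[OF SM, of "\<one>\<^bsub>G\<^esub>"] by blast
  interpret framed_group G B c x
    by unfold_locales (use frame in \<open>simp_all add: lie_alg_def\<close>)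
  let ?L = "lie_alg G" and ?br = "lie_bracket G"
  have br: "bilinear_product_on ?L ?br" using lie_algebra by (simp add: lie_algebra_on_def)
  have zero: "bilinear_product_on ?L (\<lambda>u v. 0)"
    by (simp add: bilinear_product_on_def subspace_0[OF subspace_lie_alg])
  have half: "half_bracket G u v = left_field ((1/2) *\<^sub>R ?br u v)" if "u \<in> ?L" "v \<in> ?L" for u v
    using that by (simp add: half_bracket_def left_field_bracket left_field_scale)
  have given: "connection_given_by G b D \<longleftrightarrow> linear_connection (atlas G) D \<and>
      (\<forall>u\<in>?L. \<forall>v\<in>?L. D (left_field u) (left_field v) = b u v)" for b D
    by (simp add: connection_given_by_def)
  \<comment> \<open>Makes sense of a connection given by its values on left invariant fields:
    \<open>connection_exists\<close> provides one, \<open>connection_eqI\<close> shows that there is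
    no other.\<close>
  have unique: "\<exists>!D. connection_given_by G b D"
    if \<beta>: "bilinear_product_on ?L \<beta>" and eq: "\<And>u v. u \<in> ?L \<Longrightarrow> v \<in> ?L \<Longrightarrow> b u v = left_field (\<beta> u v)" for b \<beta>
  proof -
    obtain D where "linear_connection (atlas G) D" "\<And>u v. u \<in> ?L \<Longrightarrow> v \<in> ?L \<Longrightarrow> D (left_field u) (left_field v) = left_field (\<beta> u v)"
      using connection_exists[OF \<beta>] by blast
    then have "connection_given_by G b D" by (simp add: given eq)
    moreover have "D' = D" if "connection_given_by G b D'" for D'
      using that \<open>connection_given_by G b D\<close> by (intro connection_eqI) (simp_all add: given)
    ultimately show ?thesis by blast
  qed
  \<comment> \<open>The values of \<open>D0\<close> on left invariant fields are left invariant, and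
    this passes to \<open>D0\<close> itself; so the unique connection just described is the one
    claimed.\<close>
  have left: "left_invariant_connection G D0" if "connection_given_by G (half_bracket G) D0" for D0
    using that by (intro connection_left_invariant[of D0 "\<lambda>u v. (1/2) *\<^sub>R ?br u v"]) (simp_all add: given half)
  have "\<exists>!D0. connection_given_by G (half_bracket G) D0"
    using bilinear_product_half_bracket_add[OF zero, of "1/2"] by (intro unique) (simp_all add: half)
  then have part0: "\<exists>!D0. left_invariant_connection G D0 \<and> connection_given_by G (half_bracket G) D0"
    using left by blast
  let ?P = "\<lambda>D D0. torsion_free (atlas G) D \<and> bi_invariant_connection G D \<and> same_curvature (atlas G) D D0"
  have part1: "poisson_algebra ?L ?br (\<lambda>u v. D (left_inv_field G u) (left_inv_field G v) \<one>\<^bsub>G\<^esub> - (1/2) *\<^sub>R ?br u v) \<longleftrightarrow> ?P D D0"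
    if D0: "connection_given_by G (half_bracket G) D0" and D: "linear_connection (atlas G) D"
      and inv: "left_invariant_connection G D" for D D0
  proof -
    let ?pr = "\<lambda>u v. D (left_field u) (left_field v) \<one>\<^bsub>G\<^esub> - (1/2) *\<^sub>R ?br u v"
    have pr: "bilinear_product_on ?L ?pr"
      using bilinear_product_half_bracket_add[OF connection_product_bilinear[OF D], of "-1/2"] by simp
    have "poisson_algebra ?L ?br ?pr \<longleftrightarrow> ?P D D0"
    proof (rule poisson_iff_connection[OF assms(2) D _ _ pr])
      show "linear_connection (atlas G) D0"
        "\<And>u v. u \<in> ?L \<Longrightarrow> v \<in> ?L \<Longrightarrow> D0 (left_field u) (left_field v) = left_field ((1/2) *\<^sub>R ?br u v)"
        using D0 by (simp_all add: given half)
      show "D (left_field u) (left_field v) = left_field ((1/2) *\<^sub>R ?br u v + ?pr u v)" if "u \<in> ?L" "v \<in> ?L" for u v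
        using left_invariant_connection_product[OF D inv that] by simp
    qed
    \<comment> \<open>\<open>left_inv_field\<close> is a definite description that is known to agree
      with \<open>left_field\<close> on the Lie algebra only. Closure of the bracket and of
      \<open>?pr\<close> is what carries the laws with nested products over.\<close>
    moreover have "poisson_algebra ?L ?br (\<lambda>u v. D (left_inv_field G u) (left_inv_field G v) \<one>\<^bsub>G\<^esub> - (1/2) *\<^sub>R ?br u v) \<longleftrightarrow>
        poisson_algebra ?L ?br ?pr"
      using bilinear_product_onD(1)[OF br] bilinear_product_onD(1)[OF pr]
      unfolding poisson_algebra_def bilinear_product_on_def
      by (simp add: subspace_add[OF subspace_lie_alg] subspace_scale[OF subspace_lie_alg] cong: ball_cong)
    ultimately show ?thesis by simp
  qed
  have part2: "(\<exists>!D. connection_given_by G (\<lambda>u v. half_bracket G u v + left_inv_field G (pr u v)) D) \<and>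
      (\<forall>D. connection_given_by G (\<lambda>u v. half_bracket G u v + left_inv_field G (pr u v)) D \<longrightarrow>
        ?P D D0)"
    if D0: "connection_given_by G (half_bracket G) D0" and poisson: "poisson_algebra ?L ?br pr" for D0 pr
  proof -
    have pr: "bilinear_product_on ?L pr" using poisson by (simp add: poisson_algebra_def)
    have eq: "half_bracket G u v + left_inv_field G (pr u v) = left_field ((1/2) *\<^sub>R ?br u v + pr u v)"
      if "u \<in> ?L" "v \<in> ?L" for u v
      using that by (simp add: half left_field_add bilinear_product_onD(1)[OF pr])
    have "?P D D0"
      if D: "connection_given_by G (\<lambda>u v. half_bracket G u v + left_inv_field G (pr u v)) D" for D
    proof (rule poisson_iff_connection[OF assms(2) _ _ _ pr, THEN iffD1, OF _ _ _ _ poisson])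
      show "linear_connection (atlas G) D" "linear_connection (atlas G) D0" using D D0 by (simp_all add: given)
      fix u v assume uv: "u \<in> ?L" "v \<in> ?L"
      show "D0 (left_field u) (left_field v) = left_field ((1/2) *\<^sub>R ?br u v)"
        using D0 uv by (simp add: given half)
      have "D (left_field u) (left_field v) = half_bracket G u v + left_inv_field G (pr u v)"
        using D uv unfolding given by blast
      then show "D (left_field u) (left_field v) = left_field ((1/2) *\<^sub>R ?br u v + pr u v)"
        by (simp only: eq[OF uv])
    qed
    then show ?thesis
      using unique[OF bilinear_product_half_bracket_add[OF pr] eq] by blast
  qed
  show ?thesis
  proof (intro conjI allI impI part0, goal_cases)
    case (1 D0 D)
    then show ?case by (intro part1) simp_all
  next
    case (2 D0 pr)
    then show ?case using part2[of D0 pr] by blast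
  next
    case (3 D0 pr D)
    then show ?case using part2[of D0 pr] by blast
  next
    case (4 D0 pr D)
    then show ?case using part2[of D0 pr] by blast
  next
    case (5 D0 pr D)
    then show ?case using part2[of D0 pr] by blast
  qed
qed

end
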